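(* Let $N\ge 3$ and let $f$ be a non-negative, continuous, radially symmetric function on $\{x\in\mathbb{R}^N:|x|\ge 1\}$ satisfying $f(x)\le K|x|^{-2-\sigma}$ for $|x|\ge1$, for some $\sigma,K>0$. For $\epsilon>0$ let $$V_\epsilon(x)=\begin{cases}\left(\frac{N-2}{2}\right)^2|x|^{-2},&|x|<1,\\ \epsilon f(x),&|x|\ge 1,\end{cases}$$ and let $$\epsilon_0=\inf_{u\in\mathcal{H}^1(B^c)}\frac{\int_{B^c}|\nabla u|^2dx-\frac{N-2}{2}\int_{\partial B}u^2dS}{\int_{B^c}fu^2dx}.$$ Then $\epsilon_0>0$, and for any $\epsilon\in(0,\epsilon_0)$ there is a constant $c>0$ such that $$\int_{\mathbb{R}^N}|\nabla u|^2dx-\int_{\mathbb{R}^N}V_\epsilon u^2dx\ \ge\ c\left(\int_{\mathbb{R}^N}|u|^{\frac{2N}{N-2}}\tilde X_1^{\frac{2N-2}{N-2}}(|x|)\,dx\right)^{\frac{N-2}{N}}\qquad\text{for all }u\in C^\infty_c(\mathbb{R}^N).$$ Moreover, for $\epsilon=\epsilon_0$ this inequality fails, i.e. there is no $c>0$ for which it holds for all $u\in C_c^\infty(\mathbb{R}^N)$ (here $f$ is not identically zero, so that $\epsilon_0<\infty$).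
   Context: $B$ is the unit ball of $\mathbb{R}^N$ centered at $0$ and $B^c$ its complement. $\mathcal{H}^1(B^c)$ is the completion of the set of restrictions to $B^c$ of functions in $C^\infty_c(\mathbb{R}^N)$ under the norm $\left(\int_{B^c}|\nabla u|^2dx\right)^{1/2}+\left(\int_{B^c}\frac{|u|^2}{|x|^2}dx\right)^{1/2}$. The infimum defining $\epsilon_0$ is over those $u$ with $\int_{B^c}fu^2dx>0$ (with value $+\infty$ if there are none). $X_1(t)=(1-\log t)^{-1}$ for $t\in(0,1)$, and $\tilde X_1(|x|)=X_1(|x|)$ for $|x|<1$, $\tilde X_1(|x|)=1$ for $|x|>1$. *)

theory Defs
  imports "HOL-Analysis.Analysis"
begin

primrec C_k :: "nat \<Rightarrow> ('a::euclidean_space \<Rightarrow> real) \<Rightarrow> bool" where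
  "C_k 0 u \<longleftrightarrow> continuous_on UNIV u"
| "C_k (Suc k) u \<longleftrightarrow> (\<forall>x. u differentiable (at x)) \<and>
     (\<forall>b\<in>Basis. C_k k (\<lambda>x. frechet_derivative u (at x) b))"

definition Cc_infinity :: "('a::euclidean_space \<Rightarrow> real) set" where
  "Cc_infinity = {u. (\<forall>k. C_k k u) \<and> compact (closure {x. u x \<noteq> 0})}"

definition grad :: "('a::euclidean_space \<Rightarrow> real) \<Rightarrow> 'a \<Rightarrow> 'a" where
  "grad u x = (\<Sum>b\<in>Basis. frechet_derivative u (at x) b *\<^sub>R b)"

definition ext_domain :: "'a::euclidean_space set" where
  "ext_domain = - ball 0 1"

(* The surface measure dS on the unit sphere, defined by radial projection:
   dS(A) is N times the volume of the cone {r y | 0 < r < 1, y in A}.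
   Here sgn x = x /\<^sub>R norm x. *)
definition sphere_measure :: "'a::euclidean_space measure" where
  "sphere_measure = scale_measure (of_nat DIM('a))
     (distr (restrict_space lborel (ball 0 1 - {0})) (restrict_space borel (sphere 0 1)) sgn)"

(* The map phi |-> (phi, grad phi) embeds the restrictions to B^c of test functions, with the norm
   of H^1(B^c), isometrically into L^2(B^c, dx/|x|^2) x L^2(B^c)^N. As the latter is complete, the
   completion is the closure of the image: an element is a pair (u, G), where G plays the role of
   grad u. Values of u and G inside the unit ball are irrelevant, and functions agreeing almost
   everywhere represent the same element. The integrals are nonnegative Lebesgue integrals,
   so that convergence to 0 includes their finiteness for large k. *)
definition H1_ext_approx ::
    "(nat \<Rightarrow> 'a::euclidean_space \<Rightarrow> real) \<Rightarrow> ('a \<Rightarrow> real) \<Rightarrow> ('a \<Rightarrow> 'a) \<Rightarrow> bool" where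
  "H1_ext_approx \<phi> u G \<longleftrightarrow> (\<forall>k. \<phi> k \<in> Cc_infinity) \<and>
     (\<lambda>k. \<integral>\<^sup>+x\<in>ext_domain. ennreal ((norm (grad (\<phi> k) x - G x))\<^sup>2) \<partial>lborel) \<longlonglongrightarrow> 0 \<and>
     (\<lambda>k. \<integral>\<^sup>+x\<in>ext_domain. ennreal (\<bar>\<phi> k x - u x\<bar>\<^sup>2 / (norm x)\<^sup>2) \<partial>lborel) \<longlonglongrightarrow> 0"

definition H1_ext :: "(('a::euclidean_space \<Rightarrow> real) \<times> ('a \<Rightarrow> 'a)) set" where
  "H1_ext = {(u, G). set_borel_measurable lborel ext_domain u \<and>
     set_borel_measurable lborel ext_domain G \<and> (\<exists>\<phi>. H1_ext_approx \<phi> u G)}"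

(* The trace on the unit sphere is the continuous extension, from test functions to H^1(B^c), of the
   restriction map into L^2(dS). By the trace inequality every element of H1_ext has a trace,
   it is unique up to dS-null sets, and it does not depend on the approximating sequence. *)
definition has_trace ::
    "('a::euclidean_space \<Rightarrow> real) \<times> ('a \<Rightarrow> 'a) \<Rightarrow> ('a \<Rightarrow> real) \<Rightarrow> bool" where
  "has_trace = (\<lambda>(u, G) T. T \<in> borel_measurable sphere_measure \<and>
     (\<exists>\<phi>. H1_ext_approx \<phi> u G \<and>
       (\<lambda>k. \<integral>\<^sup>+y. ennreal (\<bar>\<phi> k y - T y\<bar>\<^sup>2) \<partial>sphere_measure) \<longlonglongrightarrow> 0))"

(* Infimum in the extended reals; it is infinity if there are no admissible functions. *)
definition epsilon0 :: "('a::euclidean_space \<Rightarrow> real) \<Rightarrow> ereal" where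
  "epsilon0 f = Inf {ereal
       (((LINT x:ext_domain|lborel. (norm (G x))\<^sup>2)
          - (real DIM('a) - 2) / 2 * (LINT y|sphere_measure. (T y)\<^sup>2))
        / (LINT x:ext_domain|lborel. f x * (u x)\<^sup>2)) | u G T.
     (u, G) \<in> H1_ext \<and> has_trace (u, G) T \<and>
     (LINT x:ext_domain|lborel. f x * (u x)\<^sup>2) > 0}"

definition V_pot :: "('a::euclidean_space \<Rightarrow> real) \<Rightarrow> real \<Rightarrow> 'a \<Rightarrow> real" where
  "V_pot f \<epsilon> x = (if norm x < 1 then ((real DIM('a) - 2) / 2)\<^sup>2 / (norm x)\<^sup>2 else \<epsilon> * f x)"

definition X1 :: "real \<Rightarrow> real" where
  "X1 t = inverse (1 - ln t)"

definition X1_tilde :: "real \<Rightarrow> real" where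
  "X1_tilde r = (if r < 1 then X1 r else 1)"

definition hardy_sobolev_ineq ::
    "('a::euclidean_space \<Rightarrow> real) \<Rightarrow> real \<Rightarrow> real \<Rightarrow> ('a \<Rightarrow> real) \<Rightarrow> bool" where
  "hardy_sobolev_ineq f \<epsilon> c u \<longleftrightarrow>
     (LINT x|lborel. (norm (grad u x))\<^sup>2) - (LINT x|lborel. V_pot f \<epsilon> x * (u x)\<^sup>2)
     \<ge> c * (LINT x|lborel. \<bar>u x\<bar> powr (2 * real DIM('a) / (real DIM('a) - 2))
               * X1_tilde (norm x) powr ((2 * real DIM('a) - 2) / (real DIM('a) - 2)))
           powr ((real DIM('a) - 2) / real DIM('a))"

end

theory Submission
  imports Defs
begin

text \<open>The ground state substitution $v = |x|^{(N-2)/2} u$, together with the divergence of $u^2 x/|x|^2$ inside and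
  outside the ball, turns the left-hand side into $\int_B |x|^{-(N-2)} |\nabla v|^2$ plus the exterior energy that
  defines $\epsilon_0$, minus $\epsilon$ times the exterior mass. For $\epsilon < \epsilon_0$ a
  fixed fraction of the exterior energy remains. It dominates the trace and the exterior Hardy integral, and the
  trace controls, by a logarithmic Hardy inequality, the integral of $X_1^2 u^2/|x|^2$ over $B$.
  The logarithmically weighted inequality then follows by applying the plain Sobolev
  inequality to $W(y) = (|y|/(1+|y|))^{1/2} e^{-(N-2)/(2|y|)} u(e^{-1/|y|} y)$.

  At $\epsilon = \epsilon_0$, test functions whose exterior quotient is close to $\epsilon_0$ can be taken radial outside
  $B$ and continued inward by $|x|^{-(N-2)/2}$, which after a logarithmic cutoff costs arbitrarily little energy. The
  left-hand side is then at most an arbitrarily small multiple of $\int f u^2$, which by Hoelder's inequality and the decay of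
  $f$ is bounded by a multiple of the right-hand side.\<close>

section \<open>Hoelder and Sobolev inequalities\<close>

text \<open>In terms of v the energy of a radial function over B is, up to the area of the sphere,
  the integral of r v'(r)^2 over (0,1). This is a two-dimensional Dirichlet energy, in which a point
  has capacity zero; hence the ground state can be cut off at the origin at little cost. The
  divergence of u^2 x/|x|^2 leaves the trace with coefficient (N-2)/2, so what the ball loses is
  exactly what the numerator of \<open>epsilon0\<close> subtracts. The map e^{-1/|y|} y makes 1 -
  log |x| comparable to 1 + 1/|y|. With q = 2N/(N-2) the weight exponent is (2N-2)/(N-2) = 1 + q/2:
  the summand 1 absorbs the Jacobian factor 1 + 1/|y|, the summand q/2 matches the q-th power of the
  square root in W, and the q-th power of the exponential in W is e^{-N/|y|}. At the critical
  parameter nearly minimizing test functions take the place of a minimizer. The exterior mass of the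
  radial competitor is fixed by its profile before the cutoff in B is chosen, so the cutoff error
  can be made small relative to that mass.\<close>

definition epowr :: "ennreal \<Rightarrow> real \<Rightarrow> ennreal" where
  "epowr x p = (if x = \<infinity> then \<infinity> else ennreal (enn2real x powr p))"

lemma epowr_ennreal [simp]: "r \<ge> 0 \<Longrightarrow> epowr (ennreal r) p = ennreal (r powr p)"
  by (simp add: epowr_def)

lemma epowr_0 [simp]: "epowr 0 p = 0"
  by (simp add: epowr_def)

lemma epowr_top [simp]: "epowr \<infinity> p = \<infinity>" "epowr top p = top"
  by (simp_all add: epowr_def)

lemma epowr_eq_0_iff [simp]: "epowr x p = 0 \<longleftrightarrow> x = 0"
  by (cases x) (auto simp: epowr_def ennreal_eq_0_iff)

lemma epowr_mono: "p \<ge> 0 \<Longrightarrow> x \<le> y \<Longrightarrow> epowr x p \<le> epowr y p"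
  by (cases x; cases y) (auto simp: epowr_def top_unique intro!: ennreal_leI powr_mono2)

lemma borel_measurable_epowr [measurable (raw)]:
  assumes [measurable]: "f \<in> borel_measurable M"
  shows "(\<lambda>x. epowr (f x) p) \<in> borel_measurable M"
  unfolding epowr_def by measurable

text \<open>Jensen's inequality for exp at the points ln (x i). A vanishing x i is treated apart;
  there the product is 0 because \<open>0 powr w = 0\<close> for every w, including w = 0.\<close>

lemma weighted_arith_geom_mean:
  fixes x w :: "'i \<Rightarrow> real"
  assumes "finite I" and "\<And>i. i \<in> I \<Longrightarrow> x i \<ge> 0" and w: "\<And>i. i \<in> I \<Longrightarrow> w i \<ge> 0" "sum w I = 1"
  shows "(\<Prod>i\<in>I. x i powr w i) \<le> (\<Sum>i\<in>I. w i * x i)"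
proof (cases "\<exists>i\<in>I. x i = 0")
  case True
  then have "(\<Prod>i\<in>I. x i powr w i) = 0"
    using assms(1) by (auto simp: prod_zero_iff)
  moreover have "(\<Sum>i\<in>I. w i * x i) \<ge> 0"
    using assms(2) w by (intro sum_nonneg mult_nonneg_nonneg)
  ultimately show ?thesis by linarith
next
  case False
  then have pos: "x i > 0" if "i \<in> I" for i
    using assms(2)[OF that] that by force
  have "(\<Prod>i\<in>I. x i powr w i) = exp (\<Sum>i\<in>I. w i *\<^sub>R ln (x i))"
    using assms(1) by (simp add: exp_sum powr_def pos) (intro prod.cong, auto dest: pos)
  also have "\<dots> \<le> (\<Sum>i\<in>I. w i * exp (ln (x i)))"
    using assms w by (intro convex_on_sum[OF _ _ exp_convex]) (auto simp: convex_on_def)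
  also have "\<dots> = (\<Sum>i\<in>I. w i * x i)"
    by (intro sum.cong) (auto simp: pos)
  finally show ?thesis .
qed

text \<open>The mean inequality for the ratios x i / c i. The free scales c i are there for
  Hoelder's inequality, where c i is the integral of the i-th factor, so that the right-hand side
  integrates to the product of the powers of the c i.\<close>

lemma epowr_arith_geom_mean:
  fixes x :: "'i \<Rightarrow> ennreal" and w c :: "'i \<Rightarrow> real"
  assumes I: "finite I" and w: "\<And>i. i \<in> I \<Longrightarrow> w i > 0" "sum w I = 1"
    and c: "\<And>i. i \<in> I \<Longrightarrow> c i > 0"
  shows "(\<Prod>i\<in>I. epowr (x i) (w i)) \<le>
    (\<Prod>i\<in>I. ennreal (c i powr w i)) * (\<Sum>i\<in>I. ennreal (w i / c i) * x i)"
proof (cases "\<exists>i\<in>I. x i = \<infinity>")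
  case True
  then obtain i where i: "i \<in> I" "x i = \<infinity>" by auto
  have "(\<Sum>i\<in>I. ennreal (w i / c i) * x i) = \<infinity>"
    using i I w(1)[of i] c[of i]
    by (auto simp: ennreal_mult_eq_top_iff ennreal_eq_0_iff divide_le_0_iff intro!: bexI[of _ i])
  moreover have "(\<Prod>i\<in>I. ennreal (c i powr w i)) \<noteq> 0"
    using I c by (auto simp: prod_zero_iff) force
  ultimately have "(\<Prod>i\<in>I. ennreal (c i powr w i)) * (\<Sum>i\<in>I. ennreal (w i / c i) * x i) = \<infinity>"
    by (simp only: infinity_ennreal_def ennreal_mult_top if_False)
  then show ?thesis
    by (simp only: infinity_ennreal_def top_greatest)
next
  case False
  define r where "r i = enn2real (x i)" for i
  have x: "x i = ennreal (r i)" "r i \<ge> 0" if "i \<in> I" for i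
    using False that by (auto simp: r_def less_top)
  have "(\<Prod>i\<in>I. epowr (x i) (w i)) = (\<Prod>i\<in>I. ennreal (r i powr w i))"
    using x by (intro prod.cong) auto
  also have "\<dots> = ennreal (\<Prod>i\<in>I. r i powr w i)"
    by (intro prod_ennreal) auto
  also have "(\<Prod>i\<in>I. r i powr w i) = (\<Prod>i\<in>I. c i powr w i) * (\<Prod>i\<in>I. (r i / c i) powr w i)"
    unfolding prod.distrib[symmetric]
    by (intro prod.cong refl, subst powr_mult[symmetric]) (auto simp: x c less_imp_le dest: c)
  also have "ennreal \<dots> \<le> ennreal ((\<Prod>i\<in>I. c i powr w i) * (\<Sum>i\<in>I. w i * (r i / c i)))"
    using x c w I by (intro ennreal_leI mult_left_mono weighted_arith_geom_mean prod_nonneg)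
      (auto simp: less_imp_le)
  also have "\<dots> = ennreal (\<Prod>i\<in>I. c i powr w i) * ennreal (\<Sum>i\<in>I. w i * (r i / c i))"
    using x c w I by (intro ennreal_mult prod_nonneg sum_nonneg) (auto simp: less_imp_le)
  also have "ennreal (\<Prod>i\<in>I. c i powr w i) = (\<Prod>i\<in>I. ennreal (c i powr w i))"
    by (intro prod_ennreal[symmetric]) auto
  also have "ennreal (\<Sum>i\<in>I. w i * (r i / c i)) = (\<Sum>i\<in>I. ennreal (w i * (r i / c i)))"
    using x c w by (intro sum_ennreal[symmetric]) (auto simp: less_imp_le)
  also have "\<dots> = (\<Sum>i\<in>I. ennreal (w i / c i) * x i)"
    using x c w by (intro sum.cong) (auto simp: less_imp_le simp flip: ennreal_mult)
  finally show ?thesis .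
qed

text \<open>A version with finitely many factors, because the slicing argument below uses N - 1
  factors of weight 1/(N-1) at once. After normalisation by the integrals the pointwise mean
  inequality integrates to the sum of the weights, which is 1; a zero or infinite integral is
  treated separately.\<close>

lemma nn_integral_Holder:
  fixes f :: "'i \<Rightarrow> 'b \<Rightarrow> ennreal" and w :: "'i \<Rightarrow> real"
  assumes I: "finite I" and w: "\<And>i. i \<in> I \<Longrightarrow> w i > 0" "sum w I = 1"
    and [measurable]: "\<And>i. i \<in> I \<Longrightarrow> f i \<in> borel_measurable M"
  shows "(\<integral>\<^sup>+x. (\<Prod>i\<in>I. epowr (f i x) (w i)) \<partial>M) \<le> (\<Prod>i\<in>I. epowr (\<integral>\<^sup>+x. f i x \<partial>M) (w i))"
proof -
  consider i where "i \<in> I" "integral\<^sup>N M (f i) = 0"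
    | i where "i \<in> I" "integral\<^sup>N M (f i) = \<infinity>" "\<forall>i\<in>I. integral\<^sup>N M (f i) \<noteq> 0"
    | "\<forall>i\<in>I. integral\<^sup>N M (f i) \<noteq> 0 \<and> integral\<^sup>N M (f i) \<noteq> \<infinity>"
    by blast
  then show ?thesis
  proof cases
    case 1
    then have "AE x in M. f i x = 0"
      by (subst nn_integral_0_iff_AE[symmetric]) auto
    then have "AE x in M. (\<Prod>i\<in>I. epowr (f i x) (w i)) = 0"
      by eventually_elim (use 1 I in \<open>auto simp: prod_zero_iff\<close>)
    then have "(\<integral>\<^sup>+x. (\<Prod>i\<in>I. epowr (f i x) (w i)) \<partial>M) = 0"
      using nn_integral_cong_AE[of "\<lambda>x. \<Prod>i\<in>I. epowr (f i x) (w i)" "\<lambda>_. 0" M] by simp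
    then show ?thesis by simp
  next
    case 2
    have "(\<Prod>i\<in>I. epowr (integral\<^sup>N M (f i)) (w i)) =
        epowr (integral\<^sup>N M (f i)) (w i) * (\<Prod>i\<in>I-{i}. epowr (integral\<^sup>N M (f i)) (w i))"
      using I 2(1) by (rule prod.remove)
    moreover have "(\<Prod>i\<in>I-{i}. epowr (integral\<^sup>N M (f i)) (w i)) \<noteq> 0"
      using I 2(3) by (auto simp: prod_zero_iff)
    ultimately show ?thesis
      using 2(2) by (auto simp: ennreal_top_mult)
  next
    case 3
    define c where "c i = enn2real (integral\<^sup>N M (f i))" for i
    have c: "integral\<^sup>N M (f i) = ennreal (c i)" "c i > 0" if "i \<in> I" for i
      using 3 that by (auto simp: c_def less_top enn2real_positive_iff zero_less_iff_neq_zero)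
    have "(\<integral>\<^sup>+x. (\<Prod>i\<in>I. epowr (f i x) (w i)) \<partial>M) \<le>
      (\<integral>\<^sup>+x. (\<Prod>i\<in>I. ennreal (c i powr w i)) * (\<Sum>i\<in>I. ennreal (w i / c i) * f i x) \<partial>M)"
      by (intro nn_integral_mono epowr_arith_geom_mean I w c(2))
    also have "\<dots> = (\<Prod>i\<in>I. ennreal (c i powr w i)) * (\<Sum>i\<in>I. ennreal (w i / c i) * integral\<^sup>N M (f i))"
      by (simp add: nn_integral_cmult nn_integral_sum)
    also have "(\<Sum>i\<in>I. ennreal (w i / c i) * integral\<^sup>N M (f i)) = (\<Sum>i\<in>I. ennreal (w i))"
      using c w(1) by (intro sum.cong refl) (force simp: less_imp_le simp flip: ennreal_mult)
    also have "\<dots> = 1"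
      using w by (simp add: sum_ennreal less_imp_le)
    also have "(\<Prod>i\<in>I. ennreal (c i powr w i)) * 1 = (\<Prod>i\<in>I. epowr (\<integral>\<^sup>+x. f i x \<partial>M) (w i))"
      using c by (auto intro!: prod.cong simp: less_imp_le)
    finally show ?thesis .
  qed
qed

lemma nn_integral_Holder2:
  assumes [measurable]: "f \<in> borel_measurable M" "g \<in> borel_measurable M" and p: "0 < p" "p < 1"
  shows "(\<integral>\<^sup>+x. epowr (f x) p * epowr (g x) (1 - p) \<partial>M) \<le>
    epowr (\<integral>\<^sup>+x. f x \<partial>M) p * epowr (\<integral>\<^sup>+x. g x \<partial>M) (1 - p)"
  using nn_integral_Holder[of "UNIV :: bool set" "\<lambda>i. if i then p else 1 - p" "\<lambda>i. if i then f else g" M] p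
  by (simp add: UNIV_bool mult.commute split: if_splits)

text \<open>The integral over the coordinates in A is kept as a function on the whole space,
  constant in those coordinates. The induction over A then never changes the type of the
  domain.\<close>

definition line_nn_integral :: "'a::euclidean_space set \<Rightarrow> ('a \<Rightarrow> ennreal) \<Rightarrow> 'a \<Rightarrow> ennreal" where
  "line_nn_integral A g x = (\<integral>\<^sup>+y. g (x + (\<Sum>b\<in>A. y b *\<^sub>R b)) \<partial>(\<Pi>\<^sub>M b\<in>A. lborel))"

interpretation lborel_prod: product_sigma_finite "\<lambda>_. lborel :: real measure"
  by (rule product_sigma_finite.intro) (rule sigma_finite_lborel)

lemma borel_measurable_line_nn_integral [measurable]:
  assumes "finite A" and [measurable]: "g \<in> borel_measurable borel"
  shows "line_nn_integral A g \<in> borel_measurable borel"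
proof -
  interpret sigma_finite_measure "\<Pi>\<^sub>M b\<in>A. (lborel :: real measure)"
    by (rule lborel_prod.sigma_finite) fact
  show ?thesis
    unfolding line_nn_integral_def by measurable
qed

lemma line_nn_integral_empty [simp]: "line_nn_integral {} g = g"
  by (simp add: line_nn_integral_def fun_eq_iff lborel_prod.nn_integral_empty PiM_empty)

lemma line_nn_integral_insert:
  assumes "finite A" "c \<notin> A" and [measurable]: "g \<in> borel_measurable borel"
  shows "line_nn_integral (insert c A) g x = (\<integral>\<^sup>+s. line_nn_integral A g (x + s *\<^sub>R c) \<partial>lborel)"
proof -
  have "line_nn_integral (insert c A) g x =
      (\<integral>\<^sup>+s. \<integral>\<^sup>+y. g (x + (\<Sum>b\<in>insert c A. (y(c := s)) b *\<^sub>R b)) \<partial>(\<Pi>\<^sub>M b\<in>A. lborel) \<partial>lborel)"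
    unfolding line_nn_integral_def
    using assms(1,2) by (intro lborel_prod.product_nn_integral_insert_rev) measurable
  also have "\<dots> = (\<integral>\<^sup>+s. line_nn_integral A g (x + s *\<^sub>R c) \<partial>lborel)"
    unfolding line_nn_integral_def
  proof (intro nn_integral_cong)
    fix s :: real and y :: "'a \<Rightarrow> real"
    have "(\<Sum>b\<in>A. (y(c := s)) b *\<^sub>R b) = (\<Sum>b\<in>A. y b *\<^sub>R b)"
      using assms(2) by (intro sum.cong) auto
    then show "g (x + (\<Sum>b\<in>insert c A. (y(c := s)) b *\<^sub>R b)) = g (x + s *\<^sub>R c + (\<Sum>b\<in>A. y b *\<^sub>R b))"
      using assms(1,2) by (simp add: add.assoc)
  qed
  finally show ?thesis .
qed

lemma line_nn_integral_translate:
  assumes "finite A" "c \<in> A" and [measurable]: "g \<in> borel_measurable borel"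
  shows "line_nn_integral A g (x + s *\<^sub>R c) = line_nn_integral A g x"
proof -
  define B where "B = A - {c}"
  have A: "A = insert c B" "c \<notin> B" "finite B" using assms by (auto simp: B_def)
  have "(\<integral>\<^sup>+r. line_nn_integral B g (x + r *\<^sub>R c) \<partial>lborel) =
      (\<integral>\<^sup>+r. line_nn_integral B g (x + (s + 1 * r) *\<^sub>R c) \<partial>lborel)"
    using A by (subst nn_integral_real_affine[where c=1 and t=s]) auto
  then show ?thesis
    unfolding A(1) using A by (simp add: line_nn_integral_insert algebra_simps)
qed

lemma line_nn_integral_Basis:
  assumes [measurable]: "g \<in> borel_measurable borel"
  shows "line_nn_integral Basis g 0 = (\<integral>\<^sup>+x. g x \<partial>lborel)"
  unfolding line_nn_integral_def by (subst lborel_eq, subst nn_integral_distr) auto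

text \<open>Induction over the coordinates already integrated. When c is added, the factor belonging
  to b = c has been integrated along c already and does not depend on that coordinate, so it leaves
  the integral. The other N - 1 factors have weights 1/(N-1) with sum 1, and Hoelder's inequality
  applies to them.\<close>

lemma Gagliardo_Nirenberg_step:
  fixes g D :: "'a::euclidean_space \<Rightarrow> ennreal"
  assumes dim: "DIM('a) \<ge> 2" and [measurable]: "g \<in> borel_measurable borel" "D \<in> borel_measurable borel"
    and bound: "\<And>x. g x \<le> (\<Prod>b\<in>Basis. epowr (line_nn_integral {b} D x) (1 / (real DIM('a) - 1)))"
    and "finite A" "A \<subseteq> Basis"
  shows "line_nn_integral A g x \<le>
      (\<Prod>b\<in>Basis. epowr (line_nn_integral (insert b A) D x) (1 / (real DIM('a) - 1)))"
  using assms(5,6)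
proof (induction A arbitrary: x)
  case empty
  then show ?case using bound by simp
next
  case (insert c A)
  let ?w = "1 / (real DIM('a) - 1)"
  have c: "c \<in> Basis" "A \<subseteq> Basis" using insert.prems by auto
  have fin: "finite (insert b A)" for b using insert.hyps by simp
  note [measurable] = borel_measurable_line_nn_integral[OF fin]
  have card: "card (Basis - {c}) = DIM('a) - 1" "DIM('a) - 1 > 0"
    using dim c by (auto simp: card_Diff_singleton)
  have w: "?w > 0" "(\<Sum>b\<in>Basis - {c}. ?w) = 1"
    unfolding sum_constant card(1) using dim by (simp_all add: of_nat_diff)
  have "line_nn_integral (insert c A) g x = (\<integral>\<^sup>+s. line_nn_integral A g (x + s *\<^sub>R c) \<partial>lborel)"
    using insert.hyps by (rule line_nn_integral_insert) measurable
  also have "\<dots> \<le> (\<integral>\<^sup>+s. (\<Prod>b\<in>Basis. epowr (line_nn_integral (insert b A) D (x + s *\<^sub>R c)) ?w) \<partial>lborel)"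
    by (intro nn_integral_mono insert.IH c)
  also have "\<dots> = (\<integral>\<^sup>+s. epowr (line_nn_integral (insert c A) D x) ?w *
      (\<Prod>b\<in>Basis - {c}. epowr (line_nn_integral (insert b A) D (x + s *\<^sub>R c)) ?w) \<partial>lborel)"
    using c insert.hyps by (subst prod.remove[of _ c]) (auto simp: line_nn_integral_translate)
  also have "\<dots> = epowr (line_nn_integral (insert c A) D x) ?w *
      (\<integral>\<^sup>+s. (\<Prod>b\<in>Basis - {c}. epowr (line_nn_integral (insert b A) D (x + s *\<^sub>R c)) ?w) \<partial>lborel)"
    by (intro nn_integral_cmult) measurable
  also have "(\<integral>\<^sup>+s. (\<Prod>b\<in>Basis - {c}. epowr (line_nn_integral (insert b A) D (x + s *\<^sub>R c)) ?w) \<partial>lborel) \<le>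
      (\<Prod>b\<in>Basis - {c}. epowr (\<integral>\<^sup>+s. line_nn_integral (insert b A) D (x + s *\<^sub>R c) \<partial>lborel) ?w)"
  proof (rule nn_integral_Holder)
    show "(\<Sum>b\<in>Basis - {c}. ?w) = 1" by (rule w(2))
  qed (use w(1) in auto)
  also have "\<dots> = (\<Prod>b\<in>Basis - {c}. epowr (line_nn_integral (insert b (insert c A)) D x) ?w)"
  proof (intro prod.cong refl arg_cong2[where f=epowr])
    fix b assume "b \<in> Basis - {c}"
    then have "c \<notin> insert b A" using insert.hyps by auto
    then have "(\<integral>\<^sup>+s. line_nn_integral (insert b A) D (x + s *\<^sub>R c) \<partial>lborel) =
        line_nn_integral (insert c (insert b A)) D x"
      by (intro line_nn_integral_insert[symmetric] fin) measurable
    then show "(\<integral>\<^sup>+s. line_nn_integral (insert b A) D (x + s *\<^sub>R c) \<partial>lborel) =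
        line_nn_integral (insert b (insert c A)) D x"
      by (simp add: insert_commute)
  qed
  also have "epowr (line_nn_integral (insert c A) D x) ?w *
      (\<Prod>b\<in>Basis - {c}. epowr (line_nn_integral (insert b (insert c A)) D x) ?w) =
      (\<Prod>b\<in>Basis. epowr (line_nn_integral (insert b (insert c A)) D x) ?w)"
    using c by (subst prod.remove[of Basis c]) auto
  finally show ?case by (simp add: mult_left_mono)
qed

text \<open>The pointwise bounds for the N directions are multiplied, each to the power 1/(N-1).
  Once all coordinates have been integrated, the N factors coincide.\<close>

corollary Gagliardo_Nirenberg:
  fixes g D :: "'a::euclidean_space \<Rightarrow> ennreal"
  assumes dim: "DIM('a) \<ge> 2" and [measurable]: "g \<in> borel_measurable borel" "D \<in> borel_measurable borel"
    and bound: "\<And>x b. b \<in> Basis \<Longrightarrow> g x \<le> (\<integral>\<^sup>+s. D (x + s *\<^sub>R b) \<partial>lborel)"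
  shows "(\<integral>\<^sup>+x. epowr (g x) (DIM('a) / (real DIM('a) - 1)) \<partial>lborel) \<le>
      epowr (\<integral>\<^sup>+x. D x \<partial>lborel) (1 / (real DIM('a) - 1)) ^ DIM('a)"
proof -
  let ?w = "1 / (real DIM('a) - 1)"
  \<comment> \<open>Splitting the exponent N/(N-1) into N equal ones needs the values 0 and infinity
    checked separately, because \<open>powr\<close> and \<open>power\<close> follow different
    conventions there.\<close>
  have *: "epowr y (DIM('a) / (real DIM('a) - 1)) = epowr y ?w ^ DIM('a)" for y
  proof (cases y)
    case (real r)
    then show ?thesis using dim by (cases "r = 0") (auto simp: ennreal_power powr_power power_0_left)
  qed (use dim in \<open>simp add: epowr_def top_power_ennreal\<close>)
  have "line_nn_integral Basis (\<lambda>x. epowr (g x) (DIM('a) / (real DIM('a) - 1))) 0 \<le>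
     (\<Prod>b\<in>(Basis::'a set). epowr (line_nn_integral (insert b Basis) D 0) ?w)"
  proof (rule Gagliardo_Nirenberg_step[OF dim])
    fix x
    have le: "epowr (g x) ?w \<le> epowr (line_nn_integral {b} D x) ?w" if "b \<in> Basis" for b
      using bound[OF that, of x] dim by (intro epowr_mono) (simp_all add: line_nn_integral_insert)
    have "(\<Prod>b\<in>B. epowr (g x) ?w) \<le> (\<Prod>b\<in>B. epowr (line_nn_integral {b} D x) ?w)"
      if "finite B" "B \<subseteq> Basis" for B
      using that by (induction B) (auto intro!: mult_mono le)
    from this[of Basis] have "(\<Prod>b\<in>(Basis::'a set). epowr (g x) ?w) \<le>
        (\<Prod>b\<in>Basis. epowr (line_nn_integral {b} D x) ?w)"
      by simp
    then show "epowr (g x) (DIM('a) / (real DIM('a) - 1)) \<le> (\<Prod>b\<in>Basis. epowr (line_nn_integral {b} D x) ?w)"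
      by (simp add: *)
  qed auto
  also have "\<dots> = (\<Prod>b\<in>(Basis::'a set). epowr (line_nn_integral Basis D 0) ?w)"
    by (intro prod.cong) (auto simp: insert_absorb)
  finally show ?thesis
    by (simp add: line_nn_integral_Basis)
qed

text \<open>The gradient is carried as data, so that an explicit formula can be used in place of a
  Frechet derivative. The class has to contain the transformed function \<open>sob_trans\<close>,
  whose regularity at the origin is established to first order only.\<close>

definition C1c :: "('a::euclidean_space \<Rightarrow> real) \<Rightarrow> ('a \<Rightarrow> 'a) \<Rightarrow> bool" where
  "C1c u G \<longleftrightarrow> (\<forall>x. (u has_derivative (\<lambda>h. G x \<bullet> h)) (at x)) \<and> continuous_on UNIV G \<and>
     (\<exists>M. \<forall>x. norm x > M \<longrightarrow> u x = 0)"

lemma C1c_D: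
  assumes "C1c u G"
  shows C1c_has_derivative: "(u has_derivative (\<lambda>h. G x \<bullet> h)) (at x)"
    and C1c_continuous: "continuous_on UNIV u" and C1c_continuous_grad: "continuous_on UNIV G"
  using assms by (auto simp: C1c_def continuous_on_eq_continuous_at intro: has_derivative_continuous)

lemma C1c_support:
  assumes "C1c u G"
  obtains M where "M > 1" "\<And>x. norm x > M \<Longrightarrow> u x = 0" "\<And>x. norm x > M \<Longrightarrow> G x = 0"
proof -
  obtain M0 where M0: "\<And>x. norm x > M0 \<Longrightarrow> u x = 0"
    using assms by (auto simp: C1c_def)
  define M where "M = max M0 2"
  have M: "u x = 0" if "norm x > M" for x using M0 that by (auto simp: M_def)
  have "G x = 0" if "norm x > M" for x
  proof -
    have "open {x::'a. norm x > M}" by (intro open_Collect_less continuous_intros)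
    then have "((\<lambda>_. 0) has_derivative (\<lambda>h. G x \<bullet> h)) (at x)"
      using C1c_has_derivative[OF assms, of x] M that
      by (elim has_derivative_transform_within_open) auto
    then have "(\<lambda>h. G x \<bullet> h) = (\<lambda>h. 0)"
      by (rule has_derivative_unique) (rule has_derivative_const)
    then show ?thesis by (metis inner_eq_zero_iff)
  qed
  with M show ?thesis using that[of M] by (auto simp: M_def)
qed

lemma integrable_continuous_bounded_support:
  fixes g :: "'a::euclidean_space \<Rightarrow> real"
  assumes "continuous_on UNIV g" "\<And>x. norm x > M \<Longrightarrow> g x = 0"
  shows "integrable lborel g"
proof -
  have "integrable lborel (\<lambda>x. indicator (cball 0 M) x *\<^sub>R g x)"
    using assms(1) by (intro borel_integrable_compact) (auto intro: continuous_on_subset)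
  also have "(\<lambda>x. indicator (cball 0 M) x *\<^sub>R g x) = g"
    using assms(2) by (auto split: split_indicator simp: fun_eq_iff not_le)
  finally show ?thesis .
qed

text \<open>At t = 0 the difference quotient has absolute value |t|^(p-1), which tends to 0 because
  p > 1; this agrees with \<open>sgn 0 = 0\<close>.\<close>

lemma DERIV_abs_powr:
  fixes p t :: real
  assumes "p > 1"
  shows "((\<lambda>t. \<bar>t\<bar> powr p) has_real_derivative p * \<bar>t\<bar> powr (p - 1) * sgn t) (at t)"
proof -
  consider "t > 0" | "t < 0" | "t = 0" by linarith
  then show ?thesis
  proof cases
    case 1
    have "((\<lambda>t. t powr p) has_real_derivative p * \<bar>t\<bar> powr (p - 1) * sgn t) (at t)"
      using 1 by (auto intro!: derivative_eq_intros)
    then show ?thesis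
      by (rule has_field_derivative_transform_within_open[where S="{0<..}"]) (use 1 in auto)
  next
    case 2
    have "((\<lambda>t. (-t) powr p) has_real_derivative p * \<bar>t\<bar> powr (p - 1) * sgn t) (at t)"
      using 2 by (auto intro!: derivative_eq_intros)
    then show ?thesis
      by (rule has_field_derivative_transform_within_open[where S="{..<0}"]) (use 2 in auto)
  next
    case 3
    have "((\<lambda>h. \<bar>h\<bar> powr (p - 1)) \<longlongrightarrow> 0 powr (p - 1)) (at 0)"
      using assms by (intro tendsto_powr' tendsto_rabs_zero tendsto_ident_at tendsto_const) auto
    then have "((\<lambda>h. \<bar>h\<bar> powr (p - 1)) \<longlongrightarrow> 0) (at 0)"
      using assms by simp
    then have "((\<lambda>h. \<bar>\<bar>h\<bar> powr p / h\<bar>) \<longlongrightarrow> 0) (at 0)"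
    proof (rule Lim_transform_eventually)
      show "\<forall>\<^sub>F h in at 0. \<bar>h\<bar> powr (p - 1) = \<bar>\<bar>h\<bar> powr p / h\<bar>"
        by (auto simp: eventually_at_filter abs_divide powr_diff)
    qed
    then have "((\<lambda>h. \<bar>h\<bar> powr p / h) \<longlongrightarrow> 0) (at 0)"
      by (rule tendsto_rabs_zero_cancel)
    then show ?thesis using 3 assms by (simp add: DERIV_def)
  qed
qed

text \<open>The fundamental theorem of calculus for |u|^p along the line through x in direction b,
  started outside the support. This supplies the directional hypothesis of
  \<open>Gagliardo_Nirenberg\<close>.\<close>

lemma C1c_line_bound:
  fixes u :: "'a::euclidean_space \<Rightarrow> real"
  assumes u: "C1c u G" and b: "b \<in> Basis" and p: "p > 1"
  shows "ennreal (\<bar>u x\<bar> powr p) \<le>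
      (\<integral>\<^sup>+s. ennreal (p * \<bar>u (x + s *\<^sub>R b)\<bar> powr (p - 1) * norm (G (x + s *\<^sub>R b))) \<partial>lborel)"
proof -
  obtain M where M: "M > 1" "\<And>x. norm x > M \<Longrightarrow> u x = 0" using C1c_support[OF u] by metis
  \<comment> \<open>The norm of x - R b is at least R - |x|, which exceeds M; hence u vanishes at
    the lower end of the segment.\<close>
  define R where "R = M + norm x + 1"
  have "norm (x - R *\<^sub>R b) > M"
  proof -
    have "R = norm (R *\<^sub>R b)" using b M by (simp add: R_def)
    also have "\<dots> \<le> norm (x - R *\<^sub>R b) + norm x" using norm_triangle_ineq4[of x "x - R *\<^sub>R b"] by simp
    finally show ?thesis by (simp add: R_def)
  qed
  then have u0: "u (x + (-R) *\<^sub>R b) = 0" using M by simp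
  have "continuous_on UNIV u" "continuous_on UNIV G" using C1c_continuous[OF u] C1c_continuous_grad[OF u]
    by auto
  note cont = continuous_on_compose2[OF this(1)] continuous_on_compose2[OF this(2)]
  let ?D = "\<lambda>s. p * \<bar>u (x + s *\<^sub>R b)\<bar> powr (p - 1) * norm (G (x + s *\<^sub>R b))"
  let ?d = "\<lambda>s. p * \<bar>u (x + s *\<^sub>R b)\<bar> powr (p - 1) * sgn (u (x + s *\<^sub>R b)) * (G (x + s *\<^sub>R b) \<bullet> b)"
  have D_cont: "continuous_on UNIV ?D"
    using p by (intro continuous_intros continuous_on_powr' cont) auto
  have "(?d has_integral (\<bar>u (x + 0 *\<^sub>R b)\<bar> powr p - \<bar>u (x + (-R) *\<^sub>R b)\<bar> powr p)) {-R..0}"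
  proof (rule fundamental_theorem_of_calculus)
    show "-R \<le> 0" using M(1) norm_ge_zero[of x] unfolding R_def by linarith
    fix s
    have "((\<lambda>s. u (x + s *\<^sub>R b)) has_derivative (\<lambda>h. G (x + s *\<^sub>R b) \<bullet> (h *\<^sub>R b))) (at s within {-R..0})"
      by (rule has_derivative_compose[OF _ C1c_has_derivative[OF u]]) (auto intro!: derivative_eq_intros)
    then have "((\<lambda>s. u (x + s *\<^sub>R b)) has_real_derivative (G (x + s *\<^sub>R b) \<bullet> b)) (at s within {-R..0})"
      by (simp add: has_field_derivative_def mult_commute_abs)
    from DERIV_chain2[OF DERIV_abs_powr[OF p] this]
    show "((\<lambda>s. \<bar>u (x + s *\<^sub>R b)\<bar> powr p) has_vector_derivative ?d s) (at s within {-R..0})"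
      by (simp add: has_real_derivative_iff_has_vector_derivative)
  qed
  then have d: "(?d has_integral \<bar>u x\<bar> powr p) {-R..0}" using u0 p by simp
  have D: "(?D has_integral integral {-R..0} ?D) {-R..0}"
    by (intro integrable_integral integrable_continuous_interval continuous_on_subset[OF D_cont]) auto
  have "\<bar>u x\<bar> powr p \<le> integral {-R..0} ?D"
  proof (rule has_integral_le[OF d D])
    fix s
    have "sgn (u (x + s *\<^sub>R b)) * (G (x + s *\<^sub>R b) \<bullet> b) \<le> \<bar>G (x + s *\<^sub>R b) \<bullet> b\<bar>"
      by (auto simp: sgn_if)
    also have "\<dots> \<le> norm (G (x + s *\<^sub>R b))"
      using b by (rule Basis_le_norm)
    finally have "(p * \<bar>u (x + s *\<^sub>R b)\<bar> powr (p - 1)) * (sgn (u (x + s *\<^sub>R b)) * (G (x + s *\<^sub>R b) \<bullet> b))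
        \<le> (p * \<bar>u (x + s *\<^sub>R b)\<bar> powr (p - 1)) * norm (G (x + s *\<^sub>R b))"
      using p by (intro mult_left_mono) auto
    then show "?d s \<le> ?D s" by (simp add: mult.assoc)
  qed
  moreover have "(\<integral>\<^sup>+s. ennreal (indicator {-R..0} s * ?D s) \<partial>lborel) = ennreal (integral {-R..0} ?D)"
    using p by (intro nn_integral_has_integral_lebesgue[OF _ D]) auto
  moreover have "(\<integral>\<^sup>+s. ennreal (indicator {-R..0} s * ?D s) \<partial>lborel) \<le> (\<integral>\<^sup>+s. ennreal (?D s) \<partial>lborel)"
    using p by (intro nn_integral_mono ennreal_leI) (auto split: split_indicator)
  ultimately show ?thesis
    by (metis (no_types, lifting) ennreal_leI order_trans)
qed

text \<open>\<open>Gagliardo_Nirenberg\<close> is applied to |u|^p with p N/(N-1) = q, that is p =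
  2(N-1)/(N-2). Then 2(p-1) = q too, so Cauchy-Schwarz bounds the integral of p |u|^(p-1) |G| by p
  sqrt \<alpha> sqrt \<beta>, with the same integral \<alpha> of |u|^q that stands on the left. The
  constant is p squared.\<close>

theorem Sobolev_inequality:
  fixes u :: "'a::euclidean_space \<Rightarrow> real"
  assumes dim: "DIM('a) \<ge> 3" and u: "C1c u G"
  shows "(LINT x|lborel. \<bar>u x\<bar> powr (2 * real DIM('a) / (real DIM('a) - 2)))
      powr ((real DIM('a) - 2) / real DIM('a)) \<le>
    (2 * (real DIM('a) - 1) / (real DIM('a) - 2))\<^sup>2 * (LINT x|lborel. (norm (G x))\<^sup>2)"
proof -
  define n where "n = real DIM('a)"
  have n: "n \<ge> 3" using dim by (simp add: n_def)
  define p where "p = 2 * (n - 1) / (n - 2)"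
  define q where "q = 2 * n / (n - 2)"
  have p: "p > 1" using n by (simp add: p_def field_simps)
  have pq: "p * (n / (n - 1)) = q" "p - 1 = q * (1/2)" "q > 0"
    using n by (simp_all add: p_def q_def times_divide_times_eq frac_eq_eq) (simp_all add: field_simps)
  note [continuous_intros] = C1c_continuous[OF u] C1c_continuous_grad[OF u]
  have [measurable]: "u \<in> borel_measurable borel" "G \<in> borel_measurable borel"
    by (intro borel_measurable_continuous_onI C1c_continuous[OF u] C1c_continuous_grad[OF u])+
  obtain M where M: "M > 1" "\<And>x. norm x > M \<Longrightarrow> u x = 0" "\<And>x. norm x > M \<Longrightarrow> G x = 0"
    using C1c_support[OF u] by metis
  define \<alpha> where "\<alpha> = (LINT x|lborel. \<bar>u x\<bar> powr q)"
  define \<beta> where "\<beta> = (LINT x|lborel. (norm (G x))\<^sup>2)"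
  have \<alpha>: "(\<integral>\<^sup>+x. ennreal (\<bar>u x\<bar> powr q) \<partial>lborel) = ennreal \<alpha>" "\<alpha> \<ge> 0"
    unfolding \<alpha>_def using M pq
    by (auto intro!: nn_integral_eq_integral integrable_continuous_bounded_support[of _ M]
        continuous_intros continuous_on_powr')
  have \<beta>: "(\<integral>\<^sup>+x. ennreal ((norm (G x))\<^sup>2) \<partial>lborel) = ennreal \<beta>" "\<beta> \<ge> 0"
    unfolding \<beta>_def using M
    by (auto intro!: nn_integral_eq_integral integrable_continuous_bounded_support[of _ M] continuous_intros)
  let ?D = "\<lambda>x. p * \<bar>u x\<bar> powr (p - 1) * norm (G x)"
  have "(\<integral>\<^sup>+x. ?D x \<partial>lborel) =
      (\<integral>\<^sup>+x. ennreal p * (epowr (ennreal (\<bar>u x\<bar> powr q)) (1/2) * epowr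
          (ennreal ((norm (G x))\<^sup>2)) (1 - 1/2)) \<partial>lborel)"
  proof (intro nn_integral_cong)
    fix x
    have "((norm (G x))\<^sup>2) powr (1/2) = norm (G x)"
      by (simp add: powr_half_sqrt)
    moreover have "\<bar>u x\<bar> powr (p - 1) = (\<bar>u x\<bar> powr q) powr (1/2)"
      unfolding pq powr_powr ..
    ultimately show "ennreal (?D x) = ennreal
        p * (epowr (ennreal (\<bar>u x\<bar> powr q)) (1/2) * epowr (ennreal ((norm (G x))\<^sup>2)) (1 - 1/2))"
      using p by (simp add: ennreal_mult mult.assoc)
  qed
  also have "\<dots> = ennreal
      p * (\<integral>\<^sup>+x. (epowr (ennreal (\<bar>u x\<bar> powr q)) (1/2) * epowr (ennreal ((norm (G x))\<^sup>2)) (1 - 1/2)) \<partial>lborel)"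
    by (intro nn_integral_cmult) measurable
  also have "\<dots> \<le> ennreal p * (epowr (ennreal \<alpha>) (1/2) * epowr (ennreal \<beta>) (1 - 1/2))"
    unfolding \<alpha>(1)[symmetric] \<beta>(1)[symmetric]
    by (intro mult_left_mono nn_integral_Holder2) auto
  also have "\<dots> = ennreal (p * sqrt \<alpha> * sqrt \<beta>)"
    using \<alpha> \<beta> p by (simp add: ennreal_mult powr_half_sqrt mult.assoc)
  finally have D: "(\<integral>\<^sup>+x. ?D x \<partial>lborel) \<le> ennreal (p * sqrt \<alpha> * sqrt \<beta>)" .
  have "ennreal \<alpha> = (\<integral>\<^sup>+x. epowr (ennreal (\<bar>u x\<bar> powr p)) (n / (n - 1)) \<partial>lborel)"
    unfolding \<alpha>(1)[symmetric] by (simp only: epowr_ennreal powr_ge_zero powr_powr pq)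
  also have "\<dots> \<le> epowr (\<integral>\<^sup>+x. ?D x \<partial>lborel) (1 / (n - 1)) ^ DIM('a)"
    unfolding n_def
  proof (rule Gagliardo_Nirenberg)
    show "ennreal (\<bar>u x\<bar> powr p) \<le> (\<integral>\<^sup>+s. ennreal (?D (x + s *\<^sub>R b)) \<partial>lborel)" if "b \<in> Basis" for x b
      by (rule C1c_line_bound[OF u that p])
  qed (use dim in auto)
  also have "\<dots> \<le> epowr (ennreal (p * sqrt \<alpha> * sqrt \<beta>)) (1 / (n - 1)) ^ DIM('a)"
    using n by (intro power_mono epowr_mono D) auto
  also have "\<dots> = ennreal ((p * sqrt \<alpha> * sqrt \<beta>) powr (n / (n - 1)))"
    using p \<alpha> \<beta> n by (cases "p * sqrt \<alpha> * sqrt \<beta> = 0") (auto simp: ennreal_power powr_power n_def)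
  finally have "\<alpha> \<le> (p * sqrt \<alpha> * sqrt \<beta>) powr (n / (n - 1))"
    by (simp add: ennreal_le_iff)
  then have "\<alpha> powr ((n - 1) / n) \<le> ((p * sqrt \<alpha> * sqrt \<beta>) powr (n / (n - 1))) powr ((n - 1) / n)"
    using \<alpha> n by (intro powr_mono2) auto
  also have "\<dots> = p * sqrt \<alpha> * sqrt \<beta>"
    using n p \<alpha> \<beta> by (simp add: powr_powr)
  finally have *: "\<alpha> powr ((n - 1) / n) \<le> p * sqrt \<alpha> * sqrt \<beta>" .
  \<comment> \<open>Squaring leaves one factor \<alpha> on the right, which can be cancelled:
    \<alpha> is finite by compactness of the support, and \<alpha> = 0 is a separate case.\<close>
  have "\<alpha> powr ((n - 2) / n) \<le> p\<^sup>2 * \<beta>"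
  proof (cases "\<alpha> = 0")
    case False
    then have pos: "\<alpha> > 0" using \<alpha> by simp
    have "(\<alpha> powr ((n - 1) / n))\<^sup>2 \<le> (p * sqrt \<alpha> * sqrt \<beta>)\<^sup>2"
      by (intro power_mono *) auto
    also have "\<dots> = (p\<^sup>2 * \<beta>) * \<alpha>"
      using \<alpha> \<beta> by (simp add: power_mult_distrib)
    also have "(\<alpha> powr ((n - 1) / n))\<^sup>2 = \<alpha> powr ((n - 2) / n + 1)"
      using n by (simp add: power2_eq_square flip: powr_add) (simp add: field_simps)
    also have "\<dots> = \<alpha> powr ((n - 2) / n) * \<alpha>"
      using pos by (simp add: powr_add)
    finally show ?thesis using pos by simp
  qed (use \<beta> in simp)
  then show ?thesis
    by (simp add: \<alpha>_def \<beta>_def p_def q_def n_def)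
qed

section \<open>Polar coordinates\<close>

lemma space_sphere_measure [simp]: "space (sphere_measure :: 'a::euclidean_space measure) = sphere 0 1"
  by (simp add: sphere_measure_def space_scale_measure space_restrict_space)

lemma sets_sphere_measure [measurable_cong]:
  "sets (sphere_measure :: 'a::euclidean_space measure) = sets (restrict_space borel (sphere 0 1))"
  by (simp add: sphere_measure_def)

lemma measurable_sgn_sphere:
  "sgn \<in> restrict_space lborel (A - {0::'a::euclidean_space}) \<rightarrow>\<^sub>M restrict_space borel (sphere 0 1)"
  by (intro measurable_restrict_space3) (auto simp: norm_sgn sgn_div_norm[abs_def])

lemma emeasure_sphere_measure:
  fixes B :: "'a::euclidean_space set"
  assumes "B \<in> sets (restrict_space borel (sphere 0 1))"
  shows "emeasure sphere_measure B =
    DIM('a) * emeasure lborel {x. x \<noteq> 0 \<and> norm x < 1 \<and> sgn x \<in> B}"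
proof -
  have "sgn -` B \<inter> space (restrict_space lborel (ball 0 1 - {0})) = {x. x \<noteq> 0 \<and> norm x < 1 \<and> sgn x \<in> B}"
    by (auto simp: space_restrict_space)
  moreover have "emeasure
      (distr (restrict_space lborel (ball 0 1 - {0})) (restrict_space borel (sphere 0 1)) sgn) B
     = emeasure (restrict_space lborel (ball 0 1 - {0}))
         (sgn -` B \<inter> space (restrict_space lborel (ball 0 1 - {0})))"
    using assms by (intro emeasure_distr measurable_sgn_sphere)
  moreover have "emeasure (restrict_space lborel (ball 0 1 - {0})) {x. x \<noteq> 0 \<and> norm x < 1 \<and> sgn x \<in> B}
     = emeasure lborel {x. x \<noteq> 0 \<and> norm x < 1 \<and> sgn x \<in> B}"
    by (intro emeasure_restrict_space) auto
  ultimately show ?thesis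
    by (simp add: sphere_measure_def emeasure_scale_measure ennreal_of_nat_eq_real_of_nat)
qed

lemma finite_measure_sphere_measure: "finite_measure (sphere_measure :: 'a::euclidean_space measure)"
proof (rule finite_measureI)
  have "emeasure lborel {x::'a. x \<noteq> 0 \<and> norm x < 1 \<and> sgn x \<in> sphere 0 1} \<le>
      emeasure lborel (ball 0 1 :: 'a set)"
    by (intro emeasure_mono) auto
  also have "\<dots> < \<infinity>" using emeasure_bounded_finite[of "ball 0 1 :: 'a set"] by simp
  finally show "emeasure (sphere_measure :: 'a measure) (space sphere_measure) \<noteq> \<infinity>"
    by (subst space_sphere_measure, subst emeasure_sphere_measure)
      (auto simp: ennreal_mult_eq_top_iff sets_restrict_space_iff)
qed

definition radial_measure :: "nat \<Rightarrow> real measure" where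
  "radial_measure n = density lborel (\<lambda>r. ennreal (indicator {0<..} r * r ^ (n - 1)))"

lemma sets_radial_measure [measurable_cong, simp]: "sets (radial_measure n) = sets borel"
  by (simp add: radial_measure_def)

lemma emeasure_radial_measure_lessThan:
  assumes "n \<ge> 1"
  shows "emeasure (radial_measure n) {..<b} = ennreal (max 0 b ^ n / n)"
proof -
  have "emeasure (radial_measure n) {..<b} = (\<integral>\<^sup>+r. ennreal (r ^ (n-1)) * indicator {0..max 0 b} r \<partial>lborel)"
  proof -
    have "emeasure (radial_measure n) {..<b} =
        (\<integral>\<^sup>+r. ennreal (indicator {0<..} r * r ^ (n - 1)) * indicator {..<b} r \<partial>lborel)"
      unfolding radial_measure_def by (subst emeasure_density) auto
    also have "\<dots> = (\<integral>\<^sup>+r. ennreal (r ^ (n-1)) * indicator {0..max 0 b} r \<partial>lborel)"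
    proof (rule nn_integral_cong_AE)
      have "AE r in lborel. r \<noteq> 0" "AE r in lborel. r \<noteq> b"
        by (simp_all add: AE_lborel_singleton)
      then show "AE r in lborel. ennreal (indicator {0<..} r * r ^ (n - 1)) * indicator {..<b} r =
          ennreal (r ^ (n-1)) * indicator {0..max 0 b} r"
        by eventually_elim (auto split: split_indicator simp: max_def)
    qed
    finally show ?thesis .
  qed
  also have "\<dots> = ennreal (max 0 b ^ n / n - 0 ^ n / n)"
    using assms by (intro nn_integral_FTC_Icc) (auto intro!: derivative_eq_intros)
  finally show ?thesis using assms by (simp add: power_0_left)
qed

lemma sigma_finite_radial_measure: "n \<ge> 1 \<Longrightarrow> sigma_finite_measure (radial_measure n)"
proof (rule sigma_finite_measure.intro, intro exI conjI)
  show "countable (range (\<lambda>i::nat. {..<real i}))" by simp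
  show "\<Union> (range (\<lambda>i::nat. {..<real i})) = space (radial_measure n)"
    by (auto simp: radial_measure_def reals_Archimedean2)
qed (auto simp: emeasure_radial_measure_lessThan)

section \<open>Polar decomposition of Lebesgue measure\<close>

lemma emeasure_lborel_scaleR_vimage:
  fixes C :: "'a::euclidean_space set"
  assumes "C \<in> sets borel" "c > 0"
  shows "emeasure lborel ((\<lambda>x. x /\<^sub>R c) -` C) = ennreal (c ^ DIM('a)) * emeasure lborel C"
proof -
  have "emeasure lborel C = (\<integral>\<^sup>+x. indicator C x \<partial>lborel)"
    using assms by simp
  also have "\<dots> = (\<integral>\<^sup>+x. ennreal ((1/c) ^ DIM('a)) * indicator C (x /\<^sub>R c) \<partial>lborel)"
    using assms by (subst lborel_affine[of "1/c" 0])
     (auto simp: nn_integral_density nn_integral_distr inverse_eq_divide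
         nn_integral_cmult simp del: nn_integral_indicator)
  also have "(\<lambda>x. indicator C (x /\<^sub>R c) :: ennreal) = indicator ((\<lambda>x. x /\<^sub>R c) -` C)"
    by (auto split: split_indicator)
  also have "(\<integral>\<^sup>+x. ennreal ((1/c) ^ DIM('a)) * indicator ((\<lambda>x. x /\<^sub>R c) -` C) x \<partial>lborel) =
      ennreal ((1/c) ^ DIM('a)) * emeasure lborel ((\<lambda>x. x /\<^sub>R c) -` C)"
    using assms by (subst nn_integral_cmult_indicator)
        (auto intro!: measurable_sets_borel[of "\<lambda>x. x /\<^sub>R c" borel])
  finally show ?thesis
    using assms by (simp add: mult.assoc[symmetric] power_one_over flip: ennreal_mult)
qed

text \<open>For fixed B both sides are measures in A, so it suffices to compare them on half-lines
  below b. There the set is a dilation by b of the unit cone over B, and the volume of the unit cone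
  is what defines \<open>sphere_measure\<close>.\<close>

lemma emeasure_cone:
  fixes B :: "'a::euclidean_space set"
  assumes B: "B \<in> sets (restrict_space borel (sphere 0 1))" and A: "A \<in> sets borel"
  shows "emeasure lborel {x. x \<noteq> 0 \<and> norm x \<in> A \<and> sgn x \<in> B} =
    emeasure (radial_measure DIM('a)) A * emeasure sphere_measure B"
proof -
  let ?n = "DIM('a)"
  have B': "B \<in> sets borel"
    using B by (auto simp: sets_restrict_space)
  define M where "M = distr (density lborel (indicator {x::'a. x \<noteq> 0 \<and> sgn x \<in> B})) borel norm"
  define N where "N = scale_measure (emeasure sphere_measure B) (radial_measure ?n)"
  have sgn_meas: "{x::'a. x \<noteq> 0 \<and> sgn x \<in> B} \<in> sets borel"
  proof -
    have "(sgn :: 'a \<Rightarrow> 'a) \<in> borel \<rightarrow>\<^sub>M borel" by (auto simp: sgn_div_norm[abs_def])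
    then show ?thesis using B' by measurable
  qed
  have fin: "emeasure sphere_measure B < \<infinity>"
    using finite_measure.emeasure_finite[OF finite_measure_sphere_measure, of B] by (simp add: less_top)
  have M_eq: "emeasure M A = emeasure lborel {x. x \<noteq> 0 \<and> norm x \<in> A \<and> sgn x \<in> B}" if "A \<in> sets borel" for A
  proof -
    have 1: "norm -` A \<in> sets (borel :: 'a measure)"
      using that by (auto intro!: measurable_sets_borel[of norm borel])
    have "emeasure M A = (\<integral>\<^sup>+x. indicator {x::'a. x \<noteq> 0 \<and> sgn x \<in> B} x * indicator (norm -` A) x \<partial>lborel)"
      unfolding M_def using that sgn_meas 1 by (subst emeasure_distr) (auto simp: emeasure_density)
    also have "\<dots> = (\<integral>\<^sup>+x. indicator {x. x \<noteq> 0 \<and> norm x \<in> A \<and> sgn x \<in> B} x \<partial>lborel)"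
      by (intro nn_integral_cong) (auto split: split_indicator)
    also have "{x. x \<noteq> 0 \<and> norm x \<in> A \<and> sgn x \<in> B} = {x::'a. x \<noteq> 0 \<and> sgn x \<in> B} \<inter> norm -` A" by auto
    also have "(\<integral>\<^sup>+x. indicator ({x::'a. x \<noteq> 0 \<and> sgn x \<in> B} \<inter> norm -` A) x \<partial>lborel) =
       emeasure lborel ({x::'a. x \<noteq> 0 \<and> sgn x \<in> B} \<inter> norm -` A)"
      using sgn_meas 1 by (intro nn_integral_indicator) auto
    finally show ?thesis by (simp add: Int_def conj_ac)
  qed
  have N_eq: "emeasure N A = emeasure (radial_measure ?n) A * emeasure sphere_measure B" for A
    by (simp add: N_def mult.commute)
  have "M = N"
  proof (rule measure_eqI_generator_eq[where E="range lessThan" and \<Omega>=UNIV and A="\<lambda>i. {..<real i}"])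
    show "Int_stable (range lessThan :: real set set)"
    proof (rule Int_stableI)
      fix a b :: "real set" assume "a \<in> range lessThan" "b \<in> range lessThan"
      then obtain x y where "a = {..<x}" "b = {..<y}" by auto
      then have "a \<inter> b = {..<min x y}" by auto
      then show "a \<inter> b \<in> range lessThan" by blast
    qed
    have "sets (borel :: real measure) = sigma_sets UNIV (range lessThan)"
      by (subst borel_Iio) (auto intro!: sets_measure_of)
    then show "sets M = sigma_sets UNIV (range lessThan)" "sets N = sigma_sets UNIV (range lessThan)"
      by (simp_all add: M_def N_def)
    fix X :: "real set" assume "X \<in> range lessThan"
    then obtain b where X: "X = {..<b}" by auto
    show "emeasure M X = emeasure N X"
    proof (cases "b \<le> 0")
      case True
      then have "{x::'a. x \<noteq> 0 \<and> norm x \<in> {..<b} \<and> sgn x \<in> B} = {}"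
        by (auto simp: not_less intro: order_trans)
      moreover have "emeasure M X = emeasure lborel {x::'a. x \<noteq> 0 \<and> norm x \<in> {..<b} \<and> sgn x \<in> B}"
        unfolding X by (rule M_eq) simp
      ultimately have "emeasure M X = emeasure lborel ({}::'a set)"
        by metis
      then show ?thesis
        using True by (simp add: X N_eq emeasure_radial_measure_lessThan max_def power_0_left)
    next
      case False
      have "{x::'a. x \<noteq> 0 \<and> norm x \<in> {..<b} \<and> sgn x \<in> B} =
         (\<lambda>x. x /\<^sub>R b) -` {x. x \<noteq> 0 \<and> norm x < 1 \<and> sgn x \<in> B}"
        using False by (auto simp: sgn_scaleR field_simps)
      then have "emeasure M X = emeasure lborel ((\<lambda>x. x /\<^sub>R b) -` {x. x \<noteq> 0 \<and> norm x < 1 \<and> sgn x \<in> B})"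
        by (simp add: M_eq X)
      also have "\<dots> = ennreal (b ^ ?n) * emeasure lborel {x. x \<noteq> 0 \<and> norm x < 1 \<and> sgn x \<in> B}"
      proof (intro emeasure_lborel_scaleR_vimage)
        have "{x::'a. x \<noteq> 0 \<and> norm x < 1 \<and> sgn x \<in> B} = {x::'a. x \<noteq> 0 \<and> sgn x \<in> B} \<inter> ball 0 1" by auto
        then show "{x::'a. x \<noteq> 0 \<and> norm x < 1 \<and> sgn x \<in> B} \<in> sets borel" using sgn_meas by auto
      qed (use False in auto)
      also have "\<dots> = ennreal (b ^ ?n / ?n) * emeasure sphere_measure B"
        using False unfolding emeasure_sphere_measure[OF B] mult.assoc[symmetric]
        by (simp flip: ennreal_mult' add: ennreal_of_nat_eq_real_of_nat)
      finally show ?thesis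
        using False by (simp add: X N_eq emeasure_radial_measure_lessThan)
    qed
  next
    fix i :: nat
    show "emeasure M {..<real i} \<noteq> \<infinity>"
    proof -
      have "emeasure M {..<real i} \<le> emeasure lborel (ball 0 (real i) :: 'a set)"
        by (subst M_eq) (auto intro!: emeasure_mono)
      also have "\<dots> < \<infinity>" using emeasure_bounded_finite[of "ball 0 (real i) :: 'a set"] by simp
      finally show ?thesis by simp
    qed
  qed (auto simp: reals_Archimedean2)
  then show ?thesis
    using M_eq[OF A] N_eq by metis
qed

text \<open>A product of sigma-finite measures is determined by its values on rectangles, and
  \<open>emeasure_cone\<close> gives these. The origin is removed because \<open>sgn 0 = 0\<close>
  is not on the sphere.\<close>

lemma polar_measure_eq:
  "radial_measure DIM('a) \<Otimes>\<^sub>M sphere_measure =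
   distr (restrict_space lborel (- {0::'a::euclidean_space})) (radial_measure DIM('a) \<Otimes>\<^sub>M sphere_measure)
     (\<lambda>x. (norm x, sgn x))"
proof (rule pair_measure_eqI)
  have m: "(\<lambda>x. (norm x, sgn x)) \<in> restrict_space lborel (- {0::'a})
      \<rightarrow>\<^sub>M radial_measure DIM('a) \<Otimes>\<^sub>M sphere_measure"
    using measurable_sgn_sphere[of "UNIV::'a set"]
    by (intro measurable_Pair) (auto simp: Compl_eq_Diff_UNIV
        intro!: measurable_restrict_space1 cong: measurable_cong_sets sets_sphere_measure)
  fix A :: "real set" and B :: "'a set" assume A: "A \<in> sets (radial_measure DIM('a))"
      and B: "B \<in> sets sphere_measure"
  have "emeasure (distr (restrict_space lborel (- {0::'a})) (radial_measure DIM('a) \<Otimes>\<^sub>M sphere_measure)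
      (\<lambda>x. (norm x, sgn x))) (A \<times> B) =
    emeasure (restrict_space lborel (- {0::'a}))
        ((\<lambda>x. (norm x, sgn x)) -` (A \<times> B) \<inter> space (restrict_space lborel (- {0::'a})))"
    using A B m by (intro emeasure_distr) auto
  also have "(\<lambda>x. (norm x, sgn x)) -` (A \<times> B) \<inter> space (restrict_space lborel (- {0::'a})) =
      {x. x \<noteq> 0 \<and> norm x \<in> A \<and> sgn x \<in> B}"
    by (auto simp: space_restrict_space)
  also have "emeasure (restrict_space lborel (- {0::'a})) {x. x \<noteq> 0 \<and>
      norm x \<in> A \<and> sgn x \<in> B} = emeasure lborel {x. x \<noteq> 0 \<and> norm x \<in> A \<and> sgn x \<in> B}"
    by (intro emeasure_restrict_space) auto
  finally show "emeasure (radial_measure DIM('a)) A * emeasure sphere_measure B =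
    emeasure (distr (restrict_space lborel (- {0::'a})) (radial_measure DIM('a) \<Otimes>\<^sub>M sphere_measure)
        (\<lambda>x. (norm x, sgn x))) (A \<times> B)"
    using A B by (simp add: emeasure_cone sets_sphere_measure)
qed (auto intro!: sigma_finite_radial_measure finite_measure.axioms(1)[OF finite_measure_sphere_measure]
    simp: Suc_le_eq)

lemma measurable_sphere_measure_ident:
  "(\<lambda>w. w) \<in> (sphere_measure :: 'a::euclidean_space measure) \<rightarrow>\<^sub>M borel"
  by (subst measurable_cong_sets[OF sets_sphere_measure refl]) (rule measurable_restrict_space1, simp)

lemma measurable_sphere_measure:
  "f \<in> borel_measurable borel \<Longrightarrow> f \<in> borel_measurable sphere_measure"
  by (rule measurable_compose[OF measurable_sphere_measure_ident])

lemma pair_sigma_finite_polar: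
  "pair_sigma_finite (radial_measure DIM('a)) (sphere_measure :: 'a::euclidean_space measure)"
  by (intro pair_sigma_finite.intro sigma_finite_radial_measure
      finite_measure.axioms(1) finite_measure_sphere_measure)
    (simp add: Suc_le_eq)

lemma measurable_polar_coordinates:
  "(\<lambda>x. (norm x, sgn x)) \<in> restrict_space lborel (- {0::'a::euclidean_space})
      \<rightarrow>\<^sub>M radial_measure DIM('a) \<Otimes>\<^sub>M sphere_measure"
  using measurable_sgn_sphere[of "UNIV::'a set"]
  by (intro measurable_Pair) (auto simp: Compl_eq_Diff_UNIV
      intro!: measurable_restrict_space1 cong: measurable_cong_sets sets_sphere_measure)

lemma norm_scaleR_sgn: "norm x *\<^sub>R sgn x = (x :: 'a::real_normed_vector)"
  by (cases "x = 0") (simp_all add: sgn_div_norm)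

lemma nn_integral_polar:
  fixes g :: "'a::euclidean_space \<Rightarrow> ennreal"
  assumes [measurable]: "g \<in> borel_measurable borel"
  shows "(\<integral>\<^sup>+x. g x \<partial>lborel) =
    (\<integral>\<^sup>+w. \<integral>\<^sup>+r. ennreal (indicator {0<..} r * r ^ (DIM('a) - 1)) * g (r *\<^sub>R w) \<partial>lborel \<partial>sphere_measure)"
proof -
  interpret pair_sigma_finite "radial_measure DIM('a)" "sphere_measure :: 'a measure"
    by (rule pair_sigma_finite_polar)
  note [measurable] = measurable_sphere_measure_ident
  have "AE x in lborel. x \<noteq> (0::'a)" by (rule AE_lborel_singleton)
  then have "AE x in lborel. g x = g x * indicator (- {0}) x"
    by eventually_elim auto
  then have "(\<integral>\<^sup>+x. g x \<partial>lborel) = (\<integral>\<^sup>+x. g x * indicator (- {0}) x \<partial>lborel)"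
    by (rule nn_integral_cong_AE)
  also have "\<dots> = (\<integral>\<^sup>+x. (\<lambda>(r, w). g (r *\<^sub>R w)) (norm x, sgn x) \<partial>restrict_space lborel (- {0}))"
    by (simp add: nn_integral_restrict_space norm_scaleR_sgn)
  also have "\<dots> = (\<integral>\<^sup>+z. (\<lambda>(r, w). g (r *\<^sub>R w)) z \<partial>distr (restrict_space lborel (- {0::'a}))
      (radial_measure DIM('a) \<Otimes>\<^sub>M sphere_measure)
     (\<lambda>x. (norm x, sgn x)))"
    by (subst nn_integral_distr[OF measurable_polar_coordinates]) auto
  also have "\<dots> = (\<integral>\<^sup>+z. (\<lambda>(r, w). g (r *\<^sub>R w)) z \<partial>(radial_measure DIM('a) \<Otimes>\<^sub>M sphere_measure))"
    by (simp only: polar_measure_eq[symmetric])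
  also have "\<dots> = (\<integral>\<^sup>+w. \<integral>\<^sup>+r. g (r *\<^sub>R w) \<partial>radial_measure DIM('a) \<partial>sphere_measure)"
    by (subst nn_integral_snd[symmetric]) auto
  also have "\<dots> =
      (\<integral>\<^sup>+w. \<integral>\<^sup>+r. ennreal (indicator {0<..} r * r ^ (DIM('a) - 1)) * g (r *\<^sub>R w) \<partial>lborel \<partial>sphere_measure)"
    unfolding radial_measure_def by (intro nn_integral_cong nn_integral_density) auto
  finally show ?thesis .
qed

text \<open>The sphere integral is the outer one, and integrability on almost every ray is recorded,
  so that the fundamental theorem of calculus can be applied ray by ray.\<close>

lemma integral_polar:
  fixes g :: "'a::euclidean_space \<Rightarrow> real"
  assumes g: "integrable lborel g"
  defines "h \<equiv> (\<lambda>w r. indicator {0<..} r * r ^ (DIM('a) - 1) * g (r *\<^sub>R w))"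
  shows "(LINT x|lborel. g x) = (LINT w|sphere_measure. LINT r|lborel. h w r)"
    and "integrable sphere_measure (\<lambda>w. LINT r|lborel. h w r)"
    and "AE w in sphere_measure. integrable lborel (h w)"
proof -
  interpret pair_sigma_finite "radial_measure DIM('a)" "sphere_measure :: 'a measure"
    by (rule pair_sigma_finite_polar)
  note [measurable] = measurable_sphere_measure_ident
  have [measurable]: "g \<in> borel_measurable borel" using g by auto
  let ?f = "\<lambda>(r, w). g (r *\<^sub>R w)" and ?R = "restrict_space lborel (- {0::'a})"
  have "AE x in lborel. x \<noteq> (0::'a)" by (rule AE_lborel_singleton)
  then have AE0: "AE x in lborel. g x = indicator (- {0}) x *\<^sub>R g x"
    by eventually_elim auto
  then have AE1: "AE x in lborel. indicator (- {0}) x *\<^sub>R g x = g x"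
    by eventually_elim simp
  have "integrable lborel (\<lambda>x. indicator (- {0}) x *\<^sub>R g x)"
    using g by (subst integrable_cong_AE[where g=g]) (use AE1 in simp_all)
  then have "integrable ?R (\<lambda>x. ?f (norm x, sgn x))"
    by (subst integrable_restrict_space) (auto simp: norm_scaleR_sgn)
  then have "integrable (distr ?R (radial_measure DIM('a) \<Otimes>\<^sub>M sphere_measure) (\<lambda>x. (norm x, sgn x))) ?f"
    by (subst integrable_distr_eq[OF measurable_polar_coordinates]) auto
  then have int: "integrable (radial_measure DIM('a) \<Otimes>\<^sub>M sphere_measure) ?f"
    by (simp only: polar_measure_eq[symmetric])
  have dens: "(LINT r|radial_measure DIM('a). g (r *\<^sub>R w)) = (LINT r|lborel. h w r)" for w
    unfolding radial_measure_def h_def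
      by (subst integral_density) (auto simp: mult.assoc split: split_indicator intro!: AE_I2)
  have dens': "integrable (radial_measure DIM('a)) (\<lambda>r. g (r *\<^sub>R w)) \<longleftrightarrow> integrable lborel (h w)" for w
    unfolding radial_measure_def h_def
      by (subst integrable_density) (auto simp: mult.assoc split: split_indicator intro!: AE_I2)
  have "(LINT x|lborel. g x) = (LINT x|lborel. indicator (- {0}) x *\<^sub>R g x)"
    by (intro integral_cong_AE AE0) auto
  also have "\<dots> = (LINT x|?R. ?f (norm x, sgn x))"
    by (subst integral_restrict_space) (auto simp: norm_scaleR_sgn)
  also have "\<dots> = (LINT z|distr ?R (radial_measure DIM('a) \<Otimes>\<^sub>M sphere_measure) (\<lambda>x. (norm x, sgn x)). ?f z)"
    by (subst integral_distr[OF measurable_polar_coordinates]) auto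
  also have "\<dots> = (LINT z|(radial_measure DIM('a) \<Otimes>\<^sub>M sphere_measure). ?f z)"
    by (simp only: polar_measure_eq[symmetric])
  also have "\<dots> = (LINT w|sphere_measure. LINT r|radial_measure DIM('a). g (r *\<^sub>R w))"
    using int by (subst integral_snd) auto
  finally show "(LINT x|lborel. g x) = (LINT w|sphere_measure. LINT r|lborel. h w r)"
    by (simp add: dens)
  show "integrable sphere_measure (\<lambda>w. LINT r|lborel. h w r)"
    using integrable_snd[OF int] by (simp add: dens)
  show "AE w in sphere_measure. integrable lborel (h w)"
    using AE_integrable_snd[OF int] by (simp add: dens')
qed

text \<open>The substitution rule on compact intervals exhausting the half-line, followed by
  monotone convergence on both sides. The limits of h at 0 and at infinity ensure that the image
  intervals exhaust the half-line as well.\<close>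

lemma nn_integral_substitution_Ioi:
  fixes f :: "real \<Rightarrow> ennreal" and h h' :: "real \<Rightarrow> real"
  assumes [measurable]: "f \<in> borel_measurable borel" "h \<in> borel_measurable borel"
      "h' \<in> borel_measurable borel"
    and deriv: "\<And>r. r > 0 \<Longrightarrow> (h has_real_derivative h' r) (at r)"
    and cont: "continuous_on {0<..} h'" and nonneg: "\<And>r. r > 0 \<Longrightarrow> h' r \<ge> 0"
    and pos: "\<And>r. r > 0 \<Longrightarrow> h r > 0"
    and lim0: "(h \<longlongrightarrow> 0) (at_right 0)" and lim1: "filterlim h at_top at_top"
  shows "(\<integral>\<^sup>+r. f r * indicator {0<..} r \<partial>lborel) =
      (\<integral>\<^sup>+r. f (h r) * ennreal (h' r) * indicator {0<..} r \<partial>lborel)"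
proof -
  \<comment> \<open>b is shifted by two because a 0 = 1 must lie strictly below b 0.\<close>
  define a b where "a i = 1 / real (Suc i)" and "b i = real (Suc (Suc i))" for i
  have ab: "0 < a i" "a i < b i" for i
    by (simp_all add: a_def b_def divide_simps) (simp add: distrib_left add_pos_nonneg)
  have mono_h: "h x \<le> h y" if "0 < x" "x \<le> y" for x y
    by (rule DERIV_nonneg_imp_nondecreasing[OF that(2)]) (use that deriv nonneg in \<open>meson less_le_trans\<close>)
  have a_mono: "a (Suc i) \<le> a i" and b_mono: "b i \<le> b (Suc i)" for i
    by (simp_all add: a_def b_def divide_simps)
  have sub: "{a i..b i} \<subseteq> {a (Suc i)..b (Suc i)}" "{h (a i)..h (b i)} \<subseteq> {h (a (Suc i))..h (b (Suc i))}" for i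
    using a_mono[of i] b_mono[of i] mono_h[OF ab(1) a_mono[of i]]
        mono_h[OF order.strict_trans[OF ab] b_mono[of i]] by auto
  have a_lim: "a \<longlonglongrightarrow> 0"
    unfolding a_def using LIMSEQ_inverse_real_of_nat by (simp add: inverse_eq_divide)
  have b_lim: "filterlim b at_top sequentially"
    unfolding b_def
      by (intro filterlim_compose[OF filterlim_real_sequentially]
          filterlim_compose[OF filterlim_Suc] filterlim_Suc)
  have ha_lim: "(\<lambda>i. h (a i)) \<longlonglongrightarrow> 0"
    by (rule filterlim_compose[OF lim0])
        (use ab(1) a_lim in \<open>auto simp: filterlim_at less_imp_neq[symmetric]\<close>)
  have hb_lim: "filterlim (\<lambda>i. h (b i)) at_top sequentially"
    by (rule filterlim_compose[OF lim1 b_lim])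
  have ind: "indicator {0<..} r = (SUP i. indicator {l i..m i} r :: ennreal)"
    if "\<And>i. l i > 0" "l \<longlonglongrightarrow> 0" "filterlim m at_top sequentially" for l m :: "nat \<Rightarrow> real" and r
  proof (cases "r > 0")
    case True
    have "eventually (\<lambda>i. l i < r \<and> r \<le> m i) sequentially"
      using order_tendstoD(2)[OF that(2) True] that(3) by (auto simp: filterlim_at_top intro: eventually_conj)
    then obtain i where i: "l i < r" "r \<le> m i" by (auto simp: eventually_sequentially)
    have "(1::ennreal) \<le> (SUP i. indicator {l i..m i} r)"
      by (rule SUP_upper2[of i]) (use i in auto)
    moreover have "(SUP i. indicator {l i..m i} r) \<le> (1::ennreal)"
      by (intro SUP_least) (auto split: split_indicator)
    ultimately show ?thesis using True by (auto intro: antisym)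
  next
    case False
    then have "\<not> l i \<le> r" for i using that(1)[of i] by linarith
    then show ?thesis using False by simp
  qed
  have "(\<integral>\<^sup>+r. f r * indicator {0<..} r \<partial>lborel) =
      (\<integral>\<^sup>+r. (SUP i. f r * indicator {h (a i)..h (b i)} r) \<partial>lborel)"
    by (subst ind[of "\<lambda>i. h (a i)" "\<lambda>i. h (b i)"])
        (use ab pos ha_lim hb_lim in \<open>auto simp: SUP_mult_left_ennreal\<close>)
  also have "\<dots> = (SUP i. \<integral>\<^sup>+r. f r * indicator {h (a i)..h (b i)} r \<partial>lborel)"
    by (intro nn_integral_monotone_convergence_SUP incseq_SucI le_funI mult_left_mono)
      (auto split: split_indicator dest!: subsetD[OF sub(2)] simp del: atLeastAtMost_iff)
  also have "\<dots> = (SUP i. \<integral>\<^sup>+r. f (h r) * ennreal (h' r) * indicator {a i..b i} r \<partial>lborel)"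
  proof (intro SUP_cong refl nn_integral_substitution_aux ab)
    fix i x assume "x \<in> {a i..b i}"
    then have "x > 0" using ab(1)[of i] by auto
    then show "(h has_real_derivative h' x) (at x)" "0 \<le> h' x" by (auto intro: deriv nonneg)
  next
    show "continuous_on {a i..b i} h'" for i
      using cont by (rule continuous_on_subset) (use ab(1)[of i] in auto)
  qed auto
  also have "\<dots> = (\<integral>\<^sup>+r. (SUP i. f (h r) * ennreal (h' r) * indicator {a i..b i} r) \<partial>lborel)"
    by (intro nn_integral_monotone_convergence_SUP[symmetric] incseq_SucI le_funI mult_left_mono)
      (auto split: split_indicator dest!: subsetD[OF sub(1)] simp del: atLeastAtMost_iff)
  also have "\<dots> = (\<integral>\<^sup>+r. f (h r) * ennreal (h' r) * indicator {0<..} r \<partial>lborel)"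
    by (subst ind[of a b]) (use ab a_lim b_lim in \<open>auto simp: SUP_mult_left_ennreal\<close>)
  finally show ?thesis .
qed

text \<open>On each ray this is the substitution h(r) = r e^{-1/r}. The Jacobian comes from h^{N-1}
  h' = r^{N-1} e^{-N/r} (1 + 1/r).\<close>

lemma nn_integral_radial_substitution:
  fixes H :: "'a::euclidean_space \<Rightarrow> ennreal"
  assumes [measurable]: "H \<in> borel_measurable borel"
  shows "(\<integral>\<^sup>+x. H x \<partial>lborel) =
    (\<integral>\<^sup>+y. H (exp (- 1 / norm y) *\<^sub>R y) * ennreal (exp (- real DIM('a) / norm y) * (1 + 1 / norm y)) \<partial>lborel)"
proof -
  let ?n = "DIM('a)"
  define h where "h r = r * exp (- 1 / r)" for r :: real
  define h' where "h' r = exp (- 1 / r) * (1 + 1 / r)" for r :: real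
  have [measurable]: "h \<in> borel_measurable borel" "h' \<in> borel_measurable borel"
    unfolding h_def h'_def by measurable
  have sub: "(\<integral>\<^sup>+r. f r * indicator {0<..} r \<partial>lborel) =
      (\<integral>\<^sup>+r. f (h r) * ennreal (h' r) * indicator {0<..} r \<partial>lborel)"
    if [measurable]: "f \<in> borel_measurable borel" for f :: "real \<Rightarrow> ennreal"
  proof (rule nn_integral_substitution_Ioi)
    fix r :: real assume "r > 0"
    then show "(h has_real_derivative h' r) (at r)" "h' r \<ge> 0" "h r > 0"
      unfolding h_def h'_def
        by (auto intro!: derivative_eq_intros simp: field_simps power2_eq_square add_pos_pos)
  next
    show "continuous_on {0<..} h'"
      unfolding h'_def by (intro continuous_intros) auto
    have "eventually (\<lambda>r. norm (h r) \<le> r) (at_right 0)"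
      by (auto simp: eventually_at_filter h_def abs_mult intro!: mult_left_le)
    then show "(h \<longlongrightarrow> 0) (at_right 0)"
      by (rule Lim_null_comparison) (auto intro!: tendsto_eq_intros)
    have "eventually (\<lambda>r. exp (-1) * r \<le> h r) at_top"
      using eventually_ge_at_top[of 1] by eventually_elim (auto simp: h_def)
    then show "filterlim h at_top at_top"
      by (rule filterlim_at_top_mono[rotated])
        (intro filterlim_tendsto_pos_mult_at_top[where c="exp (-1)"] filterlim_ident tendsto_const; simp)
  qed auto
  have "(\<integral>\<^sup>+x. H x \<partial>lborel) =
      (\<integral>\<^sup>+w. \<integral>\<^sup>+r. (ennreal (r ^ (?n - 1)) * H (r *\<^sub>R w)) * indicator {0<..} r \<partial>lborel \<partial>sphere_measure)"
    by (subst nn_integral_polar) (auto intro!: nn_integral_cong split: split_indicator)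
  also have "\<dots> = (\<integral>\<^sup>+w. \<integral>\<^sup>+r. (ennreal (h r ^ (?n - 1)) * H (h r *\<^sub>R w)) * ennreal
      (h' r) * indicator {0<..} r \<partial>lborel \<partial>sphere_measure)"
    by (intro nn_integral_cong sub) auto
  also have "\<dots> = (\<integral>\<^sup>+w. \<integral>\<^sup>+r. ennreal (indicator {0<..} r * r ^ (?n - 1)) *
      (H (exp (- 1 / norm (r *\<^sub>R w)) *\<^sub>R r *\<^sub>R w) * ennreal
          (exp (- real ?n / norm (r *\<^sub>R w)) * (1 + 1 / norm (r *\<^sub>R w)))) \<partial>lborel \<partial>sphere_measure)"
  proof (intro nn_integral_cong)
    fix w :: 'a and r :: real
    assume w: "w \<in> space sphere_measure"
    then have w: "norm w = 1" by simp
    show "(ennreal (h r ^ (?n - 1)) * H (h r *\<^sub>R w)) * ennreal (h' r) * indicator {0<..} r =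
      ennreal (indicator {0<..} r * r ^ (?n - 1)) *
      (H (exp (- 1 / norm (r *\<^sub>R w)) *\<^sub>R r *\<^sub>R w) * ennreal
          (exp (- real ?n / norm (r *\<^sub>R w)) * (1 + 1 / norm (r *\<^sub>R w))))"
    proof (cases "r > 0")
      case True
      have "exp (- 1 / r) ^ ?n = exp (- real ?n / r)"
        by (simp flip: exp_of_nat_mult)
      then have "exp (- 1 / r) ^ (?n - 1) * exp (- 1 / r) = exp (- real ?n / r)"
        by (simp flip: power_Suc2)
      then have eq: "h r ^ (?n - 1) * h' r = r ^ (?n - 1) * (exp (- real ?n / r) * (1 + 1 / r))"
        by (simp add: h_def h'_def power_mult_distrib mult.assoc[symmetric])
      have nonneg: "h r \<ge> 0" "h' r \<ge> 0" using True by (auto simp: h_def h'_def)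
      have "(ennreal (h r ^ (?n - 1)) * H (h r *\<^sub>R w)) * ennreal (h' r) =
          H (h r *\<^sub>R w) * ennreal (h r ^ (?n - 1) * h' r)"
        using nonneg by (simp add: ennreal_mult mult_ac)
      also have "\<dots> = H (h r *\<^sub>R w) * (ennreal (r ^ (?n - 1)) * ennreal (exp (- real ?n / r) * (1 + 1 / r)))"
        unfolding eq using True by (subst ennreal_mult) auto
      also have "h r *\<^sub>R w = exp (- 1 / r) *\<^sub>R r *\<^sub>R w" by (simp add: h_def mult.commute)
      finally show ?thesis
        using True w by (simp add: mult_ac h_def)
    qed simp
  qed
  also have "\<dots> =
      (\<integral>\<^sup>+y. H (exp (- 1 / norm y) *\<^sub>R y) * ennreal (exp (- real ?n / norm y) * (1 + 1 / norm y)) \<partial>lborel)"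
    by (subst nn_integral_polar) auto
  finally show ?thesis .
qed

text \<open>The divergence theorem on a spherical shell for the field \<beta>(|x|) u^2 x/|x|^N.
  Division by |x|^{N-1} cancels the polar Jacobian, so on each ray the integrand is the derivative
  of \<beta> u^2. Differentiability of \<beta> is asked for in the open interval only, which admits
  l = 0 and functions \<beta> that are merely continuous there.\<close>

lemma integral_radial_divergence:
  fixes u :: "'a::euclidean_space \<Rightarrow> real" and \<beta> \<beta>' :: "real \<Rightarrow> real"
  assumes u: "C1c u G" and lt: "0 \<le> l" "l < t"
    and cont: "continuous_on {l..t} \<beta>"
    and deriv: "\<And>r. l < r \<Longrightarrow> r < t \<Longrightarrow> (\<beta> has_real_derivative \<beta>' r) (at r)"
    and int: "integrable lborel (\<lambda>x. indicator {x. l < norm x \<and> norm x < t} x *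
       ((\<beta>' (norm x) * (u x)\<^sup>2 + 2 * \<beta> (norm x) * u x * (G x \<bullet> sgn x)) / norm x ^ (DIM('a) - 1)))"
  shows "(LINT x|lborel. indicator {x. l < norm x \<and> norm x < t} x *
       ((\<beta>' (norm x) * (u x)\<^sup>2 + 2 * \<beta> (norm x) * u x * (G x \<bullet> sgn x)) / norm x ^ (DIM('a) - 1))) =
    (LINT w|sphere_measure. \<beta> t * (u (t *\<^sub>R w))\<^sup>2 - \<beta> l * (u (l *\<^sub>R w))\<^sup>2)"
proof -
  let ?g = "\<lambda>x. indicator {x. l < norm x \<and> norm x < t} x *
       ((\<beta>' (norm x) * (u x)\<^sup>2 + 2 * \<beta> (norm x) * u x * (G x \<bullet> sgn x)) / norm x ^ (DIM('a) - 1))"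
  let ?h = "\<lambda>w r. indicator {0<..} r * r ^ (DIM('a) - 1) * ?g (r *\<^sub>R w)"
  let ?d = "\<lambda>w r. \<beta>' r * (u (r *\<^sub>R w))\<^sup>2 + \<beta> r * (2 * u (r *\<^sub>R w) * (G (r *\<^sub>R w) \<bullet> w))"
  have h_eq: "?h w r = indicator {l<..<t} r *\<^sub>R ?d w r" if "norm w = 1" for w r
    using that lt by (auto split: split_indicator simp: sgn_scaleR sgn_div_norm)
  have [measurable]: "u \<in> borel_measurable borel"
    by (intro borel_measurable_continuous_onI C1c_continuous[OF u])
  note [measurable (raw)] = measurable_sphere_measure and [measurable] = measurable_sphere_measure_ident
  have "AE w in sphere_measure. (LINT r|lborel. ?h w r) = \<beta> t * (u (t *\<^sub>R w))\<^sup>2 - \<beta> l * (u (l *\<^sub>R w))\<^sup>2"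
    using integral_polar(3)[OF int] AE_space
  proof eventually_elim
    fix w :: 'a assume int_w: "integrable lborel (?h w)" and "w \<in> space sphere_measure"
    then have w: "norm w = 1" by simp
    have int_d: "set_integrable lborel {l<..<t} (?d w)"
      using int_w unfolding set_integrable_def h_eq[OF w] .
    have "(LINT r|lborel. ?h w r) = (LINT r:{l<..<t}|lborel. ?d w r)"
      unfolding set_lebesgue_integral_def h_eq[OF w] ..
    also have "\<dots> = integral {l<..<t} (?d w)"
      by (rule set_borel_integral_eq_integral[OF int_d])
    also have "\<dots> = integral {l..t} (?d w)"
      using integral_open_interval[of l t "?d w"] by (simp add: box_real)
    also have "\<dots> = \<beta> t * (u (t *\<^sub>R w))\<^sup>2 - \<beta> l * (u (l *\<^sub>R w))\<^sup>2"
    proof (rule integral_unique, rule fundamental_theorem_of_calculus_interior)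
      show "continuous_on {l..t} (\<lambda>r. \<beta> r * (u (r *\<^sub>R w))\<^sup>2)"
        by (intro continuous_intros cont continuous_on_compose2[OF C1c_continuous[OF u]]) auto
      fix r assume r: "r \<in> {l<..<t}"
      have "((\<lambda>r. u (r *\<^sub>R w)) has_derivative (\<lambda>h. G (r *\<^sub>R w) \<bullet> (h *\<^sub>R w))) (at r)"
        by (rule has_derivative_compose[OF _ C1c_has_derivative[OF u]]) (auto intro!: derivative_eq_intros)
      then have [derivative_intros]: "((\<lambda>r. u (r *\<^sub>R w)) has_real_derivative (G (r *\<^sub>R w) \<bullet> w)) (at r)"
        by (simp add: has_field_derivative_def mult_commute_abs)
      have "((\<lambda>r. \<beta> r * (u (r *\<^sub>R w))\<^sup>2) has_real_derivative ?d w r) (at r)"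
        using r by (auto intro!: derivative_eq_intros deriv)
      then show "((\<lambda>r. \<beta> r * (u (r *\<^sub>R w))\<^sup>2) has_vector_derivative ?d w r) (at r)"
        by (simp add: has_real_derivative_iff_has_vector_derivative)
    qed (use lt in simp)
    finally show "(LINT r|lborel. ?h w r) = \<beta> t * (u (t *\<^sub>R w))\<^sup>2 - \<beta> l * (u (l *\<^sub>R w))\<^sup>2" .
  qed
  then have "(LINT w|sphere_measure. LINT r|lborel. ?h w r) =
      (LINT w|sphere_measure. \<beta> t * (u (t *\<^sub>R w))\<^sup>2 - \<beta> l * (u (l *\<^sub>R w))\<^sup>2)"
    using integral_polar(2)[OF int] by (intro integral_cong_AE) (auto intro: borel_measurable_integrable)
  with integral_polar(1)[OF int] show ?thesis by simp
qed

section \<open>Ground state representation and Hardy inequalities\<close>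

text \<open>Up to the factor $|x|^{-(N-2)/2}$, the gradient of $|x|^{(N-2)/2} u$; the function \<open>hardy_div\<close> is the divergence
  of $u^2 x/|x|^2$. Both are finite at the origin, because division by zero yields zero.\<close>

definition pgrad :: "('a::euclidean_space \<Rightarrow> real) \<Rightarrow> ('a \<Rightarrow> 'a) \<Rightarrow> 'a \<Rightarrow> 'a" where
  "pgrad u G x = G x + ((real DIM('a) - 2) / 2 * (u x / norm x)) *\<^sub>R sgn x"

definition hardy_div :: "('a::euclidean_space \<Rightarrow> real) \<Rightarrow> ('a \<Rightarrow> 'a) \<Rightarrow> 'a \<Rightarrow> real" where
  "hardy_div u G x = (real DIM('a) - 2) * (u x / norm x)\<^sup>2 + 2 * (u x / norm x) * (G x \<bullet> sgn x)"

lemma sgn_inner_sgn: "x \<noteq> 0 \<Longrightarrow> sgn x \<bullet> sgn x = (1::real)" for x :: "'a::real_inner"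
  by (simp add: norm_sgn flip: power2_norm_eq_inner)

lemma norm_add_scaleR_sgn:
  fixes v x :: "'a::real_inner"
  assumes "x = 0 \<Longrightarrow> c = 0"
  shows "(norm (v + c *\<^sub>R sgn x))\<^sup>2 = (norm v)\<^sup>2 + 2 * c * (v \<bullet> sgn x) + c\<^sup>2"
proof (cases "x = 0")
  case False
  show ?thesis
    unfolding power2_norm_eq_inner inner_add_left inner_add_right inner_scaleR_left inner_scaleR_right
      sgn_inner_sgn[OF False] inner_commute[of "sgn x" v]
    by (simp add: power2_eq_square algebra_simps)
qed (use assms in simp)

text \<open>Completing the square. The mixed term is a divergence, so after integration over the
  ball or its exterior it contributes only a sphere integral.\<close>

lemma norm_pgrad:
  fixes u :: "'a::euclidean_space \<Rightarrow> real"
  shows "(norm (pgrad u G x))\<^sup>2 = (norm (G x))\<^sup>2 - ((real DIM('a) - 2) / 2)\<^sup>2 * (u x / norm x)\<^sup>2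
     + (real DIM('a) - 2) / 2 * hardy_div u G x"
proof -
  define q where "q = u x / norm x"
  have "x = 0 \<Longrightarrow> q = 0" by (simp add: q_def)
  then have "(norm (pgrad u G x))\<^sup>2 = (norm (G x))\<^sup>2 + 2 * ((real DIM('a) - 2) / 2 * q) * (G x \<bullet> sgn x) +
      ((real DIM('a) - 2) / 2 * q)\<^sup>2"
    unfolding pgrad_def q_def[symmetric] by (intro norm_add_scaleR_sgn) simp
  then show ?thesis
    unfolding hardy_div_def q_def[symmetric] by (simp add: power2_eq_square field_simps)
qed

text \<open>The left-hand side is the square of \<open>pgrad u G x\<close> plus \<xi>/2 times
  (u/|x|) \<open>sgn x\<close>. It is used with \<xi> = X_1(|x|); a factor s in place of 1/2 would
  lead to the constant s - s^2 in the logarithmic Hardy inequality, which is largest, namely 1/4, at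
  s = 1/2.\<close>

lemma pgrad_log_ge:
  fixes u :: "'a::euclidean_space \<Rightarrow> real"
  shows "(norm (pgrad u G x))\<^sup>2 + \<xi> / 2 * hardy_div u G x + (\<xi> * (u x / norm x))\<^sup>2 / 4 \<ge> 0"
proof (cases "x = 0")
  case False
  have "0 \<le> (norm (pgrad u G x + (\<xi> / 2 * (u x / norm x)) *\<^sub>R sgn x))\<^sup>2" by simp
  also have "\<dots> = (norm (pgrad u G x))\<^sup>2 + \<xi> * (u x / norm x) * (pgrad u G x \<bullet> sgn x) +
      (\<xi> * (u x / norm x))\<^sup>2 / 4"
    by (subst norm_add_scaleR_sgn) (auto simp: power2_eq_square)
  also have "\<xi> * (u x / norm x) * (pgrad u G x \<bullet> sgn x) = \<xi> / 2 * hardy_div u G x"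
  proof -
    define q p c where "q = u x / norm x" and "p = G x \<bullet> sgn x" and "c = (real DIM('a) - 2) / 2"
    have "pgrad u G x \<bullet> sgn x = p + c * q"
      unfolding pgrad_def inner_add_left inner_scaleR_left sgn_inner_sgn[OF False] q_def p_def c_def by simp
    moreover have "hardy_div u G x = 2 * c * q\<^sup>2 + 2 * q * p"
      unfolding hardy_div_def q_def p_def c_def by simp
    ultimately show ?thesis
      unfolding q_def[symmetric] by (simp add: power2_eq_square distrib_left)
  qed
  finally show ?thesis .
qed (simp add: pgrad_def hardy_div_def)

lemma norm_le_pgrad:
  fixes u :: "'a::euclidean_space \<Rightarrow> real"
  shows "(norm (G x))\<^sup>2 \<le> 2 * (norm (pgrad u G x))\<^sup>2 + 2 * ((real DIM('a) - 2) / 2)\<^sup>2 * (u x / norm x)\<^sup>2"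
proof -
  let ?c = "(real DIM('a) - 2) / 2 * (u x / norm x)"
  have "G x = pgrad u G x + (- ?c) *\<^sub>R sgn x"
    by (simp add: pgrad_def)
  then have "norm (G x) \<le> norm (pgrad u G x) + \<bar>?c\<bar> * norm (sgn x)"
    by (metis norm_triangle_ineq norm_scaleR abs_minus_cancel)
  also have "\<dots> \<le> norm (pgrad u G x) + \<bar>?c\<bar>"
    by (simp add: norm_sgn)
  finally have "(norm (G x))\<^sup>2 \<le> (norm (pgrad u G x) + \<bar>?c\<bar>)\<^sup>2"
    by (intro power_mono) auto
  also have "\<dots> \<le> 2 * (norm (pgrad u G x))\<^sup>2 + 2 * \<bar>?c\<bar>\<^sup>2"
    using sum_squares_bound[of "norm (pgrad u G x)" "\<bar>?c\<bar>"] by (simp add: power2_sum)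
  also have "\<bar>?c\<bar>\<^sup>2 = ((real DIM('a) - 2) / 2)\<^sup>2 * (u x / norm x)\<^sup>2"
    by (simp only: power2_abs power_mult_distrib)
  finally show ?thesis by simp
qed

text \<open>In polar coordinates the density is r^{N-1}/r^2 = r^{N-3}, which is bounded on (0, M]
  because N is at least 3.\<close>

lemma integrable_inverse_norm_square:
  assumes "DIM('a::euclidean_space) \<ge> 3"
  shows "integrable lborel (\<lambda>x::'a. indicator (cball 0 M) x / (norm x)\<^sup>2 :: real)"
proof (cases "M > 0")
  case True
  let ?n = "DIM('a)"
  interpret finite_measure "sphere_measure :: 'a measure" by (rule finite_measure_sphere_measure)
  have "(\<integral>\<^sup>+x. ennreal (indicator (cball (0::'a) M) x / (norm x)\<^sup>2) \<partial>lborel) =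
    (\<integral>\<^sup>+w. \<integral>\<^sup>+r. ennreal (indicator {0<..} r * r ^ (?n - 1)) * ennreal
        (indicator (cball (0::'a) M) (r *\<^sub>R w) / (norm (r *\<^sub>R w))\<^sup>2) \<partial>lborel \<partial>sphere_measure)"
    by (subst nn_integral_polar) (auto intro!: borel_measurable_divide borel_measurable_indicator)
  also have "\<dots> \<le>
      (\<integral>\<^sup>+w. \<integral>\<^sup>+r. ennreal (M ^ (?n - 3)) * indicator {0..M} r \<partial>lborel \<partial>(sphere_measure :: 'a measure))"
  proof (intro nn_integral_mono)
    fix w :: 'a and r :: real assume "w \<in> space sphere_measure"
    then have w: "norm w = 1" by simp
    show "ennreal (indicator {0<..} r * r ^ (?n - 1)) * ennreal
        (indicator (cball 0 M) (r *\<^sub>R w) / (norm (r *\<^sub>R w))\<^sup>2)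
      \<le> ennreal (M ^ (?n - 3)) * indicator {0..M} r"
    proof (cases "0 < r \<and> r \<le> M")
      case True
      have "r ^ (?n - 1) = r ^ (?n - 3) * r\<^sup>2"
      proof -
        have "?n - 1 = (?n - 3) + 2" using assms by simp
        then show ?thesis by (simp only: power_add)
      qed
      then have "r ^ (?n - 1) * (1 / r\<^sup>2) = r ^ (?n - 3)" using True by simp
      moreover have "r ^ (?n - 3) \<le> M ^ (?n - 3)" using True by (intro power_mono) auto
      ultimately show ?thesis using True w by (simp flip: ennreal_mult)
    next
      case False
      then show ?thesis using w by (auto split: split_indicator)
    qed
  qed
  also have "\<dots> = ennreal (M ^ (?n - 3)) * ennreal M * emeasure sphere_measure (sphere (0::'a) 1)"
    using True by (simp add: nn_integral_cmult_indicator)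
  also have "\<dots> < \<infinity>"
  proof -
    have "emeasure sphere_measure (sphere (0::'a) 1) < \<infinity>"
      using emeasure_finite[of "sphere (0::'a) 1"] unfolding infinity_ennreal_def top.not_eq_extremum .
    then show ?thesis by (simp add: ennreal_mult_less_top)
  qed
  finally show ?thesis
    by (intro integrableI_nonneg) (auto intro!: borel_measurable_divide borel_measurable_indicator)
next
  case False
  have "AE x in lborel. x \<noteq> (0::'a)" by (rule AE_lborel_singleton)
  then have "AE x in lborel. (indicator (cball (0::'a) M) x / (norm x)\<^sup>2 :: real) = 0"
    by eventually_elim
        (use False in \<open>auto split: split_indicator simp: not_less dest!: order_trans[of _ M 0]\<close>)
  then show ?thesis
    by (subst integrable_cong_AE[where g="\<lambda>_. 0"])
        (auto intro!: borel_measurable_divide borel_measurable_indicator)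
qed

lemma AE_lborel_norm_neq: "AE x in lborel. norm (x::'a::euclidean_space) \<noteq> r"
proof -
  have "sphere (0::'a) r \<in> null_sets lebesgue"
    using negligible_sphere[of "0::'a" r] by (simp add: negligible_iff_null_sets)
  then have "sphere (0::'a) r \<in> null_sets lborel"
    by (subst (asm) null_sets_completion_iff) auto
  then have "AE x in lborel. x \<notin> sphere (0::'a) r"
    by (rule AE_not_in)
  then show ?thesis
    by eventually_elim simp
qed

lemma C1c_measurable:
  assumes "C1c u G" shows "u \<in> borel_measurable borel" "G \<in> borel_measurable borel"
  by (intro borel_measurable_continuous_onI C1c_continuous[OF assms] C1c_continuous_grad[OF assms])+

lemma C1c_bound:
  fixes u :: "'a::euclidean_space \<Rightarrow> real"
  assumes u: "C1c u G"
  obtains B where "B > 0" "\<And>x. \<bar>u x\<bar> \<le> B" "\<And>x. norm (G x) \<le> B"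
proof -
  obtain M where M: "M > 1" "\<And>x. norm x > M \<Longrightarrow> u x = 0" "\<And>x. norm x > M \<Longrightarrow> G x = 0"
    using C1c_support[OF u] by metis
  have "continuous_on UNIV u" "continuous_on UNIV G" using C1c_continuous[OF u] C1c_continuous_grad[OF u] .
  then have "compact (u ` cball 0 M)" "compact (G ` cball 0 M)"
    by (auto intro!: compact_continuous_image intro: continuous_on_subset)
  then have "bounded (u ` cball 0 M)" "bounded (G ` cball 0 M)"
    by (auto dest: compact_imp_bounded)
  then obtain B1 B2 where "\<forall>y\<in>u ` cball 0 M. norm y \<le> B1" "\<forall>y\<in>G ` cball 0 M. norm y \<le> B2"
    unfolding bounded_iff by blast
  then have B: "\<bar>u x\<bar> \<le> B1" "norm (G x) \<le> B2" if "norm x \<le> M" for x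
    using that by auto
  show ?thesis
  proof (rule that[of "max 1 (max B1 B2)"])
    fix x
    have "\<bar>u x\<bar> \<le> max 1 B1 \<and> norm (G x) \<le> max 1 B2"
    proof (cases "norm x \<le> M")
      case True
      then show ?thesis using B[OF True] by (auto simp: max_def)
    next
      case False
      then show ?thesis using M(2,3)[of x] by (auto simp: max_def)
    qed
    then show "\<bar>u x\<bar> \<le> max 1 (max B1 B2)" "norm (G x) \<le> max 1 (max B1 B2)"
      by auto
  qed simp
qed

lemma measurable_pgrad:
  assumes "C1c u G"
  shows "pgrad u G \<in> borel_measurable borel" "hardy_div u G \<in> borel_measurable borel"
proof -
  note [measurable] = C1c_measurable[OF assms]
  show "pgrad u G \<in> borel_measurable borel" "hardy_div u G \<in> borel_measurable borel"
    unfolding pgrad_def[abs_def] hardy_div_def[abs_def] sgn_div_norm by measurable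
qed

section \<open>Hardy identities on the unit ball and on its exterior\<close>

context
  fixes u :: "'a::euclidean_space \<Rightarrow> real" and G
  assumes dim: "DIM('a) \<ge> 3" and u: "C1c u G"
begin

private lemmas meas = C1c_measurable[OF u] measurable_pgrad[OF u]

lemma integrable_grad: "integrable lborel (\<lambda>x. (norm (G x))\<^sup>2)"
proof -
  obtain M where "M > 1" "\<And>x. norm x > M \<Longrightarrow> u x = 0" "\<And>x. norm x > M \<Longrightarrow> G x = 0"
    using C1c_support[OF u] by metis
  then show ?thesis
    by (intro integrable_continuous_bounded_support[of _ M] continuous_intros C1c_continuous_grad[OF u]) auto
qed

lemma integrable_hardy: "integrable lborel (\<lambda>x. (u x / norm x)\<^sup>2)"
proof -
  note [measurable] = meas
  obtain B where B: "B > 0" "\<And>x. \<bar>u x\<bar> \<le> B" using C1c_bound[OF u] by metis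
  obtain M where M: "M > 1" "\<And>x. norm x > M \<Longrightarrow> u x = 0" using C1c_support[OF u] by metis
  have "integrable lborel (\<lambda>x::'a. B\<^sup>2 * (indicator (cball 0 M) x / (norm x)\<^sup>2))"
    by (intro integrable_mult_right integrable_inverse_norm_square dim)
  then show ?thesis
  proof (rule Bochner_Integration.integrable_bound)
    show "AE x in lborel. norm ((u x / norm x)\<^sup>2) \<le> norm (B\<^sup>2 * (indicator (cball 0 M) x / (norm x)\<^sup>2))"
    proof (rule AE_I2)
      fix x
      have "(u x)\<^sup>2 \<le> B\<^sup>2 * indicator (cball 0 M) x"
        using M(2)[of x] B(2)[of x] by (auto split: split_indicator simp: abs_le_square_iff[symmetric] not_le)
      then have "(u x)\<^sup>2 / (norm x)\<^sup>2 \<le> B\<^sup>2 * indicator (cball 0 M) x / (norm x)\<^sup>2"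
        by (intro divide_right_mono) auto
      then show "norm ((u x / norm x)\<^sup>2) \<le> norm (B\<^sup>2 * (indicator (cball 0 M) x / (norm x)\<^sup>2))"
        by (simp add: power_divide)
    qed
  qed measurable
qed

lemma integrable_hardy_div: "integrable lborel (hardy_div u G)"
proof -
  note [measurable] = meas
  have "integrable lborel (\<lambda>x. real DIM('a) * (u x / norm x)\<^sup>2 + (norm (G x))\<^sup>2)"
    by (intro Bochner_Integration.integrable_add integrable_mult_right integrable_hardy integrable_grad)
  then show ?thesis
  proof (rule Bochner_Integration.integrable_bound)
    show "AE x in lborel. norm (hardy_div u G x) \<le> norm (real DIM('a) * (u x / norm x)\<^sup>2 + (norm (G x))\<^sup>2)"
    proof (rule AE_I2)
      fix x
      have "norm (hardy_div u G x) \<le> \<bar>(real DIM('a) - 2) * (u x / norm x)\<^sup>2\<bar> +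
          \<bar>2 * (u x / norm x) * (G x \<bullet> sgn x)\<bar>"
        unfolding hardy_div_def real_norm_def by (rule abs_triangle_ineq)
      also have "\<bar>G x \<bullet> sgn x\<bar> \<le> norm (G x)"
        using Cauchy_Schwarz_ineq2[of "G x" "sgn x"] by (simp add: norm_sgn split: if_splits)
      then have "\<bar>2 * (u x / norm x) * (G x \<bullet> sgn x)\<bar> \<le> 2 * \<bar>u x / norm x\<bar> * norm (G x)"
        unfolding abs_mult by (intro mult_mono) auto
      also have "\<dots> \<le> (u x / norm x)\<^sup>2 + (norm (G x))\<^sup>2"
        using sum_squares_bound[of "\<bar>u x / norm x\<bar>" "norm (G x)"] by (simp only: power2_abs)
      also have "\<bar>(real DIM('a) - 2) * (u x / norm x)\<^sup>2\<bar> = (real DIM('a) - 2) * (u x / norm x)\<^sup>2"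
        using dim by simp
      finally have "norm (hardy_div u G x) \<le> (real DIM('a) - 1) * (u x / norm x)\<^sup>2 + (norm (G x))\<^sup>2"
        by (simp add: algebra_simps)
      also have "\<dots> \<le> real DIM('a) * (u x / norm x)\<^sup>2 + (norm (G x))\<^sup>2"
        by (intro add_mono mult_right_mono) auto
      finally show "norm (hardy_div u G x) \<le> norm (real DIM('a) * (u x / norm x)\<^sup>2 + (norm (G x))\<^sup>2)"
        by simp
    qed
  qed measurable
qed

lemma integrable_pgrad: "integrable lborel (\<lambda>x. (norm (pgrad u G x))\<^sup>2)"
  unfolding norm_pgrad
  by (intro Bochner_Integration.integrable_add Bochner_Integration.integrable_diff integrable_mult_right
      integrable_hardy integrable_grad integrable_hardy_div)

lemma set_integrable_lborel:
  "integrable lborel f \<Longrightarrow> A \<in> sets borel \<Longrightarrow> set_integrable lborel A (f :: 'a \<Rightarrow> real)"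
  unfolding set_integrable_def by (rule integrable_mult_indicator) simp_all

lemma power_identities:
  fixes r :: real
  assumes "r \<noteq> 0"
  shows "r ^ (DIM('a) - 3) / r ^ (DIM('a) - 1) = 1 / r\<^sup>2" "r ^ (DIM('a) - 2) / r ^ (DIM('a) - 1) = 1 / r"
proof -
  have "DIM('a) - 1 = (DIM('a) - 3) + 2" "DIM('a) - 1 = Suc (DIM('a) - 2)" using dim by simp_all
  then show "r ^ (DIM('a) - 3) / r ^ (DIM('a) - 1) = 1 / r\<^sup>2" "r ^ (DIM('a) - 2) / r ^ (DIM('a) - 1) = 1 / r"
    using assms by (simp_all only: power_add power_Suc) (simp_all add: power2_eq_square)
qed

text \<open>This puts \<open>hardy_div\<close> in the form of
  \<open>integral_radial_divergence\<close> with \<beta>(r) = r^{N-2}. At x = 0 both sides are 0 by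
  division by zero.\<close>

lemma hardy_div_eq:
  "((real DIM('a) - 2) * norm x ^ (DIM('a) - 3) * (u x)\<^sup>2 +
      2 * norm x ^ (DIM('a) - 2) * u x * (G x \<bullet> sgn x)) / norm x ^ (DIM('a) - 1)
    = hardy_div u G x"
proof (cases "x = 0")
  case False
  then have nz: "norm x \<noteq> 0" by simp
  have "((real DIM('a) - 2) * norm x ^ (DIM('a) - 3) * (u x)\<^sup>2 +
      2 * norm x ^ (DIM('a) - 2) * u x * (G x \<bullet> sgn x)) / norm x ^ (DIM('a) - 1)
    = (real DIM('a) - 2) * (u x)\<^sup>2 * (norm x ^ (DIM('a) - 3) / norm x ^ (DIM('a) - 1))
        + 2 * u x * (G x \<bullet> sgn x) * (norm x ^ (DIM('a) - 2) / norm x ^ (DIM('a) - 1))"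
    by (simp add: add_divide_distrib mult_ac)
  also have "\<dots> = hardy_div u G x"
    using False unfolding power_identities[OF nz] by (simp add: hardy_div_def power_divide)
  finally show ?thesis .
qed (use dim in \<open>simp add: hardy_div_def power_0_left\<close>)

lemma DERIV_power_dim:
    "((\<lambda>r. r ^ (DIM('a) - 2)) has_real_derivative (real DIM('a) - 2) * r ^ (DIM('a) - 3)) (at r)"
proof -
  have "DIM('a) - 2 - 1 = DIM('a) - 3" "real (DIM('a) - 2) = real DIM('a) - 2"
    using dim by (simp_all add: of_nat_diff)
  then show ?thesis using DERIV_pow[of "DIM('a) - 2" r] by simp
qed

text \<open>The shell is 0 < |x| < 1 and \<beta>(r) = r^{N-2} vanishes at 0, so the origin
  contributes no boundary term.\<close>

lemma integral_hardy_div_ball: "(LINT x:ball 0 1|lborel. hardy_div u G x) = (LINT w|sphere_measure. (u w)\<^sup>2)"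
proof -
  have eq: "indicator {x. 0 < norm x \<and> norm x < 1} x *
     (((real DIM('a) - 2) * norm x ^ (DIM('a) - 3) * (u x)\<^sup>2
         + 2 * norm x ^ (DIM('a) - 2) * u x * (G x \<bullet> sgn x)) / norm x ^ (DIM('a) - 1))
     = indicator (ball 0 1) x *\<^sub>R hardy_div u G x" for x
    unfolding hardy_div_eq by (auto split: split_indicator simp: hardy_div_def)
  have "integrable lborel (\<lambda>x. indicator (ball 0 1) x *\<^sub>R hardy_div u G x)"
    using set_integrable_lborel[OF integrable_hardy_div, of "ball 0 1"] by (simp add: set_integrable_def)
  then have "(LINT x|lborel. indicator (ball 0 1) x *\<^sub>R hardy_div u G x) =
      (LINT w|sphere_measure. 1 ^ (DIM('a) - 2) * (u (1 *\<^sub>R w))\<^sup>2 - 0 ^ (DIM('a) - 2) * (u (0 *\<^sub>R w))\<^sup>2)"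
    unfolding eq[symmetric]
    by (intro integral_radial_divergence u DERIV_power_dim) (auto intro!: continuous_intros)
  then show ?thesis
    using dim by (simp add: set_lebesgue_integral_def power_0_left)
qed

lemma integral_hardy_div_ext: "(LINT x:ext_domain|lborel. hardy_div u G x) =
    - (LINT w|sphere_measure. (u w)\<^sup>2)"
proof -
  note [measurable] = meas
  obtain M where M: "M > 1" "\<And>x. norm x > M \<Longrightarrow> u x = 0" using C1c_support[OF u] by metis
  \<comment> \<open>The outer radius is M + 1 because u is known to vanish only for |x| > M. The
    shell is open while \<open>ext_domain\<close> contains the unit sphere, hence the
    almost-everywhere comparison below.\<close>
  let ?I = "indicator {x. 1 < norm x \<and> norm x < M + 1} :: 'a \<Rightarrow> real"
  let ?D = "\<lambda>x. ((real DIM('a) - 2) * norm x ^ (DIM('a) - 3) * (u x)\<^sup>2 +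
      2 * norm x ^ (DIM('a) - 2) * u x * (G x \<bullet> sgn x)) / norm x ^ (DIM('a) - 1)"
  have int: "integrable lborel (\<lambda>x. ?I x * ?D x)"
    unfolding hardy_div_eq
      using integrable_mult_indicator[OF _ integrable_hardy_div, of "{x. 1 < norm x \<and> norm x < M + 1}"]
        by simp
  have "AE x in lborel. indicator ext_domain x *\<^sub>R hardy_div u G x = ?I x * ?D x"
    unfolding hardy_div_eq
    using AE_lborel_norm_neq[of 1]
    by eventually_elim (use M in \<open>auto split: split_indicator simp: ext_domain_def hardy_div_def\<close>)
  then have "(LINT x:ext_domain|lborel. hardy_div u G x) = (LINT x|lborel. ?I x * ?D x)"
    unfolding set_lebesgue_integral_def hardy_div_eq by (intro integral_cong_AE) (auto simp: ext_domain_def)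
  also have "\<dots> = (LINT w|sphere_measure. (M + 1) ^ (DIM('a) - 2) * (u ((M + 1) *\<^sub>R w))\<^sup>2 -
      1 ^ (DIM('a) - 2) * (u (1 *\<^sub>R w))\<^sup>2)"
    using M by (intro integral_radial_divergence u DERIV_power_dim int continuous_intros) auto
  also have "\<dots> = (LINT w|sphere_measure. - (u w)\<^sup>2)"
    using M by (intro Bochner_Integration.integral_cong) auto
  finally show ?thesis by simp
qed

lemma hardy_ball:
  "(LINT x:ball 0 1|lborel. (norm (pgrad u G x))\<^sup>2) = (LINT x:ball 0 1|lborel. (norm (G x))\<^sup>2)
     - ((real DIM('a) - 2) / 2)\<^sup>2 * (LINT x:ball 0 1|lborel. (u x / norm x)\<^sup>2)
         + (real DIM('a) - 2) / 2 * (LINT w|sphere_measure. (u w)\<^sup>2)"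
  unfolding norm_pgrad integral_hardy_div_ball[symmetric]
  by (simp add: set_integrable_lborel integrable_grad integrable_hardy
      integrable_hardy_div set_integral_add set_integral_diff)

text \<open>On the exterior the unit sphere is an inner boundary, so the divergence term changes
  sign and is absorbed by the subtracted trace. The numerator of \<open>epsilon0\<close> thereby
  becomes a sum of squares, which bounds the exterior Hardy integral.\<close>

lemma hardy_ext:
  "(LINT x:ext_domain|lborel. (norm (G x))\<^sup>2) - (real DIM('a) - 2) / 2 * (LINT w|sphere_measure. (u w)\<^sup>2)
   = (LINT x:ext_domain|lborel. (norm (pgrad u G x))\<^sup>2) +
       ((real DIM('a) - 2) / 2)\<^sup>2 * (LINT x:ext_domain|lborel. (u x / norm x)\<^sup>2)"
proof -
  have [simp]: "ext_domain \<in> sets (borel :: 'a measure)" by (simp add: ext_domain_def)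
  have *: "(LINT w|sphere_measure. (u w)\<^sup>2) = - (LINT x:ext_domain|lborel. hardy_div u G x)"
    by (simp add: integral_hardy_div_ext)
  show ?thesis
    unfolding norm_pgrad *
    by (simp add: set_integrable_lborel integrable_grad integrable_hardy
        integrable_hardy_div set_integral_add set_integral_diff)
qed

text \<open>By \<open>norm_le_pgrad\<close> and \<open>hardy_ext\<close> the exterior Dirichlet
  integral is at most twice the energy, and the subtracted trace is the difference of the
  two.\<close>

lemma hardy_trace:
  "(real DIM('a) - 2) / 2 * (LINT w|sphere_measure. (u w)\<^sup>2) \<le>
   (LINT x:ext_domain|lborel. (norm (G x))\<^sup>2) - (real DIM('a) - 2) / 2 * (LINT w|sphere_measure. (u w)\<^sup>2)"
proof -
  have [simp]: "ext_domain \<in> sets (borel :: 'a measure)" by (simp add: ext_domain_def)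
  have "(LINT x:ext_domain|lborel. (norm (G x))\<^sup>2) \<le>
    (LINT x:ext_domain|lborel. 2 * (norm (pgrad u G x))\<^sup>2 +
        2 * ((real DIM('a) - 2) / 2)\<^sup>2 * (u x / norm x)\<^sup>2)"
    by (intro set_integral_mono norm_le_pgrad set_integrable_lborel
        Bochner_Integration.integrable_add integrable_mult_right
        integrable_grad integrable_hardy integrable_pgrad) auto
  also have "\<dots> = 2 * ((LINT x:ext_domain|lborel. (norm (pgrad u G x))\<^sup>2) +
      ((real DIM('a) - 2) / 2)\<^sup>2 * (LINT x:ext_domain|lborel. (u x / norm x)\<^sup>2))"
    by (simp add: set_integrable_lborel integrable_pgrad integrable_hardy set_integral_add)
  finally show ?thesis
    unfolding hardy_ext[symmetric] by simp
qed

text \<open>Since X_1' = X_1^2/r, the choice \<beta>(r) = X_1(r) r^{N-2} in the divergence theorem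
  says that the integrals of (X_1 u/|x|)^2 and of X_1 times \<open>hardy_div\<close> over the ball
  add up to the trace. Integrating \<open>pgrad_log_ge\<close> with \<xi> = X_1 and eliminating the
  second integral gives the claim.\<close>

lemma log_hardy_ball:
  "(LINT x:ball 0 1|lborel. (X1 (norm x) * (u x / norm x))\<^sup>2) / 4 \<le>
   (LINT x:ball 0 1|lborel. (norm (pgrad u G x))\<^sup>2) + (LINT w|sphere_measure. (u w)\<^sup>2) / 2"
proof -
  note [measurable] = meas
  have X1: "0 \<le> X1 r \<and> X1 r \<le> 1" if "0 < r" "r < 1" for r
  proof -
    have "ln r < 0" using that by (subst ln_less_zero_iff) auto
    then show ?thesis by (auto simp: X1_def inverse_le_1_iff)
  qed
  have X10: "0 \<le> X1 (norm x) \<and> X1 (norm x) \<le> 1" if "norm x < 1" for x :: 'a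
    using X1[of "norm x"] that by (cases "x = 0") (auto simp: X1_def)
  have [measurable]: "X1 \<in> borel_measurable borel" unfolding X1_def[abs_def] by measurable
  have m: "(\<lambda>x. (X1 (norm x) * (u x / norm x))\<^sup>2) \<in> borel_measurable lborel"
    "(\<lambda>x. X1 (norm x) * hardy_div u G x) \<in> borel_measurable lborel"
    by (simp, measurable)+
  have i1: "integrable lborel (\<lambda>x. indicator (ball 0 1) x *\<^sub>R (X1 (norm x) * (u x / norm x))\<^sup>2)"
  proof (rule Bochner_Integration.integrable_bound[OF integrable_hardy])
    show "AE x in lborel. norm (indicator (ball 0 1) x *\<^sub>R (X1 (norm x) * (u x / norm x))\<^sup>2) \<le>
        norm ((u x / norm x)\<^sup>2)"
    proof (rule AE_I2)
      fix x :: 'a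
      have "(X1 (norm x))\<^sup>2 * (u x / norm x)\<^sup>2 \<le> 1 * (u x / norm x)\<^sup>2" if "norm x < 1"
        using X10[OF that] by (intro mult_right_mono power_le_one) auto
      then show "norm (indicator (ball 0 1) x *\<^sub>R (X1 (norm x) * (u x / norm x))\<^sup>2) \<le> norm ((u x / norm x)\<^sup>2)"
        unfolding power_mult_distrib by (auto split: split_indicator)
    qed
  qed (intro borel_measurable_scaleR borel_measurable_indicator m; simp)
  then have i1': "set_integrable lborel (ball 0 1) (\<lambda>x. (X1 (norm x) * (u x / norm x))\<^sup>2)"
    by (simp add: set_integrable_def)
  have i2: "integrable lborel (\<lambda>x. indicator (ball 0 1) x *\<^sub>R (X1 (norm x) * hardy_div u G x))"
  proof (rule Bochner_Integration.integrable_bound[OF integrable_hardy_div])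
    show "AE x in lborel. norm (indicator (ball 0 1) x *\<^sub>R (X1 (norm x) * hardy_div u G x)) \<le>
        norm (hardy_div u G x)"
      using X10 by (intro AE_I2) (auto split: split_indicator simp: abs_mult intro!: mult_left_le_one_le)
  qed (intro borel_measurable_scaleR borel_measurable_indicator m; simp)
  then have i2': "set_integrable lborel (ball 0 1) (\<lambda>x. X1 (norm x) * hardy_div u G x)"
    by (simp add: set_integrable_def)
  \<comment> \<open>Extension by 0 to r below 0 lets continuity at the left end point be stated as
    two-sided continuity.\<close>
  define \<beta> where "\<beta> r = (if r \<le> 0 then 0 else X1 r * r ^ (DIM('a) - 2))" for r
  define \<beta>' where "\<beta>' r = (X1 r)\<^sup>2 * r ^ (DIM('a) - 3) + X1 r * ((real DIM('a) - 2) * r ^ (DIM('a) - 3))"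
      for r
  \<comment> \<open>X_1 has its pole at r = exp 1, not at r = 1, so the derivative formula also
    yields continuity at the end point 1.\<close>
  have deriv: "(\<beta> has_real_derivative \<beta>' r) (at r)" if r: "0 < r" "r < exp 1" for r
  proof -
    have ln: "ln r < 1" using r ln_less_cancel_iff[of r "exp 1"] by simp
    have "(X1 has_real_derivative (X1 r)\<^sup>2 / r) (at r)"
      unfolding X1_def[abs_def] using r ln
      by (auto intro!: derivative_eq_intros simp: power2_eq_square field_simps)
    from DERIV_mult[OF this DERIV_power_dim[of r]]
    have "((\<lambda>r. X1 r * r ^ (DIM('a) - 2)) has_real_derivative \<beta>' r) (at r)"
    proof (rule DERIV_cong)
      have "DIM('a) - 2 = Suc (DIM('a) - 3)" using dim by simp
      then have "(X1 r)\<^sup>2 / r * r ^ (DIM('a) - 2) = (X1 r)\<^sup>2 * r ^ (DIM('a) - 3)" using r by simp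
      then show "(X1 r)\<^sup>2 / r * r ^ (DIM('a) - 2) + (real DIM('a) - 2) * r ^ (DIM('a) - 3) * X1 r = \<beta>' r"
        by (simp add: \<beta>'_def)
    qed
    then show ?thesis
      by (rule has_field_derivative_transform_within_open[where S="{0<..}"]) (use r in \<open>auto simp: \<beta>_def\<close>)
  qed
  have "(\<beta> \<longlongrightarrow> 0) (at 0)"
  proof (rule Lim_null_comparison)
    have "eventually (\<lambda>r::real. r < 1) (at 0)"
      by (rule order_tendstoD[OF tendsto_ident_at]) simp
    then show "\<forall>\<^sub>F r in at 0. norm (\<beta> r) \<le> \<bar>r\<bar> ^ (DIM('a) - 2)"
    proof eventually_elim
      case (elim r)
      then show ?case
        using X1[of r] by (auto simp: \<beta>_def abs_mult intro!: mult_left_le_one_le)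
    qed
    have "((\<lambda>r::real. \<bar>r\<bar> ^ (DIM('a) - 2)) \<longlongrightarrow> \<bar>0\<bar> ^ (DIM('a) - 2)) (at 0)"
      by (intro tendsto_intros)
    then show "((\<lambda>r::real. \<bar>r\<bar> ^ (DIM('a) - 2)) \<longlongrightarrow> 0) (at 0)"
      using dim by (simp add: power_0_left)
  qed
  then have "isCont \<beta> 0" by (simp add: isCont_def \<beta>_def)
  then have cont: "continuous_on {0..1} \<beta>"
  proof (intro continuous_at_imp_continuous_on ballI)
    fix r :: real assume "isCont \<beta> 0" and r: "r \<in> {0..1}"
    show "isCont \<beta> r"
    proof (cases "r = 0")
      case False
      have "r < exp 1" using r exp_gt_one[of "1::real"] unfolding atLeastAtMost_iff by linarith
      then show ?thesis using r False by (intro DERIV_isCont[OF deriv]) auto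
    qed (use \<open>isCont \<beta> 0\<close> in simp)
  qed
  have eq: "indicator {x. 0 < norm x \<and> norm x < 1} x *
     ((\<beta>' (norm x) * (u x)\<^sup>2 + 2 * \<beta> (norm x) * u x * (G x \<bullet> sgn x)) / norm x ^ (DIM('a) - 1))
     = indicator (ball 0 1) x *\<^sub>R (X1 (norm x) * (u x / norm x))\<^sup>2
         + indicator (ball 0 1) x *\<^sub>R (X1 (norm x) * hardy_div u G x)" for x
  proof (cases "x = 0")
    case False
    have "(\<beta>' (norm x) * (u x)\<^sup>2 + 2 * \<beta> (norm x) * u x * (G x \<bullet> sgn x)) / norm x ^ (DIM('a) - 1)
      = (X1 (norm x) * u x)\<^sup>2 * (norm x ^ (DIM('a) - 3) / norm x ^ (DIM('a) - 1)) +
        X1 (norm x) * (((real DIM('a) - 2) * norm x ^ (DIM('a) - 3) * (u x)\<^sup>2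
            + 2 * norm x ^ (DIM('a) - 2) * u x * (G x \<bullet> sgn x)) / norm x ^ (DIM('a) - 1))"
      unfolding times_divide_eq_right add_divide_distrib[symmetric]
      using False by (intro arg_cong2[where f="(/)"] refl)
          (simp add: \<beta>_def \<beta>'_def power_mult_distrib algebra_simps)
    also have "\<dots> = (X1 (norm x) * (u x / norm x))\<^sup>2 + X1 (norm x) * hardy_div u G x"
      using False unfolding hardy_div_eq by (subst power_identities) (auto simp: power_divide)
    finally show ?thesis using False by (auto split: split_indicator)
  qed (simp add: hardy_div_def)
  have "(LINT x|lborel. indicator (ball 0 1) x *\<^sub>R (X1 (norm x) * (u x / norm x))\<^sup>2 +
      indicator (ball 0 1) x *\<^sub>R (X1 (norm x) * hardy_div u G x))
    = (LINT w|sphere_measure. \<beta> 1 * (u (1 *\<^sub>R w))\<^sup>2 - \<beta> 0 * (u (0 *\<^sub>R w))\<^sup>2)"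
    unfolding eq[symmetric]
  proof (intro integral_radial_divergence u cont deriv)
    show "r < exp 1" if "r < 1" for r :: real using that exp_gt_one[of 1] by linarith
    show "integrable lborel (\<lambda>x. indicator {x. 0 < norm x \<and> norm x < 1} x *
     ((\<beta>' (norm x) * (u x)\<^sup>2 + 2 * \<beta> (norm x) * u x * (G x \<bullet> sgn x)) / norm x ^ (DIM('a) - 1)))"
      unfolding eq by (intro Bochner_Integration.integrable_add i1 i2)
  qed auto
  also have "\<dots> = (LINT w|sphere_measure. (u w)\<^sup>2)"
    by (simp add: \<beta>_def X1_def)
  finally have div: "(LINT x:ball 0 1|lborel. (X1 (norm x) * (u x / norm x))\<^sup>2) +
      (LINT x:ball 0 1|lborel. X1 (norm x) * hardy_div u G x)
     = (LINT w|sphere_measure. (u w)\<^sup>2)"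
    unfolding set_lebesgue_integral_def Bochner_Integration.integral_add[OF i1 i2] .
  \<comment> \<open>With H the logarithmic Hardy integral, P that of the squared
    \<open>pgrad\<close> and S the trace, this reads 0 \<le> P + (S - H)/2 + H/4.\<close>
  have "0 \<le> (LINT x:ball 0 1|lborel. (norm (pgrad u G x))\<^sup>2 +
      (1/2) * (X1 (norm x) * hardy_div u G x) + (1/4) * (X1 (norm x) * (u x / norm x))\<^sup>2)"
    unfolding set_lebesgue_integral_def
    using pgrad_log_ge[of u G]
      by (intro integral_nonneg_AE AE_I2 scaleR_nonneg_nonneg) (auto simp: mult.assoc)
  also have "\<dots> = (LINT x:ball 0 1|lborel. (norm (pgrad u G x))\<^sup>2) +
      (1/2) * (LINT x:ball 0 1|lborel. X1 (norm x) * hardy_div u G x) +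
     (1/4) * (LINT x:ball 0 1|lborel. (X1 (norm x) * (u x / norm x))\<^sup>2)"
    using i1' i2' set_integrable_lborel[OF integrable_pgrad, of "ball 0 1"]
    by (simp add: set_integral_add)
  finally show "(LINT x:ball 0 1|lborel. (X1 (norm x) * (u x / norm x))\<^sup>2) / 4 \<le>
   (LINT x:ball 0 1|lborel. (norm (pgrad u G x))\<^sup>2) + (LINT w|sphere_measure. (u w)\<^sup>2) / 2"
    using div by simp
qed

end

section \<open>The logarithmically weighted Sobolev inequality\<close>

text \<open>The cube is taken because the gradient of the transformed function contains the factor
  divided by r^2; a positive power of r must survive to make it continuous at the origin.\<close>

lemma exp_neg_inverse_le:
  fixes a r :: real
  assumes "a > 0" "r > 0"
  shows "exp (- a / r) \<le> (3 / a) ^ 3 * r ^ 3"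
proof -
  have "a / (3 * r) \<le> exp (a / (3 * r))"
    using exp_ge_add_one_self[of "a / (3 * r)"] by linarith
  then have "(a / (3 * r)) ^ 3 \<le> exp (a / (3 * r)) ^ 3"
    using assms by (intro power_mono) auto
  also have "exp (a / (3 * r)) ^ 3 = exp (a / r)"
    by (simp flip: exp_of_nat_mult)
  finally have "inverse (exp (a / r)) \<le> inverse ((a / (3 * r)) ^ 3)"
    using assms by (intro le_imp_inverse_le) auto
  also have "inverse ((a / (3 * r)) ^ 3) = (3 / a) ^ 3 * r ^ 3"
    using assms by (simp add: power_divide power_mult_distrib)
  finally show ?thesis by (simp add: exp_minus)
qed

text \<open>The radial map $y \mapsto e^{-1/|y|} y$ makes $X_1(|x|)$ comparable to $(1 + 1/|y|)^{-1}$, and its Jacobian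
  is $e^{-N/|y|} (1 + 1/|y|)$; the factor absorbs the weight and the Jacobian.
  At $y = 0$ the junk value of the division makes the factor zero.\<close>

definition sob_factor :: "real \<Rightarrow> real \<Rightarrow> real" where
  "sob_factor a r = sqrt (r / (1 + r)) * exp (- a / r)"

definition sob_map :: "'a::euclidean_space \<Rightarrow> 'a" where
  "sob_map y = exp (- 1 / norm y) *\<^sub>R y"

definition sob_trans :: "real \<Rightarrow> ('a::euclidean_space \<Rightarrow> real) \<Rightarrow> 'a \<Rightarrow> real" where
  "sob_trans a u y = sob_factor a (norm y) * u (sob_map y)"

text \<open>The product rule and the chain rule. The derivative of \<open>sob_map\<close> is a
  multiple of the identity plus a rank-one map along \<open>sgn y\<close>; it is symmetric, so its
  transpose acts on G by the same formula.\<close>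

definition sob_grad :: "real \<Rightarrow> ('a::euclidean_space \<Rightarrow> real) \<Rightarrow> ('a \<Rightarrow> 'a) \<Rightarrow> 'a \<Rightarrow> 'a" where
  "sob_grad a u G y =
    (sob_factor a (norm y) * (1 / (2 * norm y * (1 + norm y)) + a / (norm y)\<^sup>2) * u (sob_map y)) *\<^sub>R sgn y +
    (sob_factor a (norm y) * exp (- 1 / norm y)) *\<^sub>R
      (G (sob_map y) + (G (sob_map y) \<bullet> sgn y / norm y) *\<^sub>R sgn y)"

lemma sob_factor_bounds:
  assumes "a > 0" "r > 0"
  shows "0 < sob_factor a r" "sob_factor a r \<le> (3 / a) ^ 3 * r ^ 3"
proof -
  have "sqrt (r / (1 + r)) \<le> 1" using assms by simp
  then have "sob_factor a r \<le> 1 * exp (- a / r)"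
    unfolding sob_factor_def by (intro mult_right_mono) auto
  then show "sob_factor a r \<le> (3 / a) ^ 3 * r ^ 3"
    using exp_neg_inverse_le[OF assms] by linarith
  show "0 < sob_factor a r" using assms by (simp add: sob_factor_def)
qed

lemma DERIV_sob_factor:
  assumes "r > 0"
  shows "(sob_factor a has_real_derivative sob_factor a r * (1 / (2 * r * (1 + r)) + a / r\<^sup>2)) (at r)"
proof -
  let ?q = "r / (1 + r)"
  have q: "?q > 0" using assms by simp
  have "((\<lambda>r. r / (1 + r)) has_real_derivative 1 / (1 + r)\<^sup>2) (at r)"
    using assms by (auto intro!: derivative_eq_intros simp: field_simps power2_eq_square)
  from DERIV_chain2[where f=sqrt and g="\<lambda>r. r / (1 + r)", OF DERIV_real_sqrt[OF q] this]
  have 1: "((\<lambda>r. sqrt (r / (1 + r))) has_real_derivative (inverse (sqrt ?q) / 2) * (1 / (1 + r)\<^sup>2)) (at r)" .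
  have "inverse (sqrt ?q) = sqrt ?q / ?q"
  proof -
    define s where "s = sqrt ?q"
    have "?q = s * s" using q by (simp only: s_def real_sqrt_mult_self abs_of_pos)
    then show ?thesis unfolding s_def[symmetric] by (simp add: inverse_eq_divide)
  qed
  also have "\<dots> / 2 * (1 / (1 + r)\<^sup>2) = sqrt ?q * (1 / (2 * r * (1 + r)))"
    using assms by (simp add: power2_eq_square)
  finally have 2: "inverse (sqrt ?q) / 2 * (1 / (1 + r)\<^sup>2) = sqrt ?q * (1 / (2 * r * (1 + r)))" .
  have 3: "((\<lambda>r. exp (- a / r)) has_real_derivative exp (- a / r) * (a / r\<^sup>2)) (at r)"
    using assms by (auto intro!: derivative_eq_intros simp: power2_eq_square)
  show ?thesis
    unfolding sob_factor_def[abs_def]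
    by (rule DERIV_cong[OF DERIV_mult[OF 1[unfolded 2] 3]]) (simp add: algebra_simps)
qed

lemma has_derivative_sob_map:
  assumes "y \<noteq> 0"
  shows "(sob_map has_derivative (\<lambda>h. exp (- 1 / norm y) *\<^sub>R (h + (h \<bullet> sgn y / norm y) *\<^sub>R sgn y))) (at y)"
proof -
  have "((\<lambda>r. exp (- 1 / r)) has_real_derivative exp (- 1 / norm y) * (1 / (norm y)\<^sup>2)) (at (norm y))"
    using assms by (auto intro!: derivative_eq_intros simp: power2_eq_square)
  from DERIV_compose_FDERIV[OF this has_derivative_norm[OF assms]]
  have "((\<lambda>y. exp (- 1 / norm y)) has_derivative
      (\<lambda>h. h \<bullet> sgn y * (exp (- 1 / norm y) * (1 / (norm y)\<^sup>2)))) (at y)" .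
  from has_derivative_scaleR[OF this has_derivative_ident]
  have "(sob_map has_derivative (\<lambda>h. exp (- 1 / norm y) *\<^sub>R h +
      (h \<bullet> sgn y * (exp (- 1 / norm y) * (1 / (norm y)\<^sup>2))) *\<^sub>R y)) (at y)"
    unfolding sob_map_def[abs_def] .
  also have "(\<lambda>h. exp (- 1 / norm y) *\<^sub>R h + (h \<bullet> sgn y * (exp (- 1 / norm y) * (1 / (norm y)\<^sup>2))) *\<^sub>R y) =
    (\<lambda>h. exp (- 1 / norm y) *\<^sub>R (h + (h \<bullet> sgn y / norm y) *\<^sub>R sgn y))"
  proof
    fix h
    define e where "e = exp (- 1 / norm y)"
    have "y = norm y *\<^sub>R sgn y" by (simp add: norm_scaleR_sgn)
    then have "(h \<bullet> sgn y * (e * (1 / (norm y)\<^sup>2))) *\<^sub>R y =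
        (h \<bullet> sgn y * (e * (1 / (norm y)\<^sup>2)) * norm y) *\<^sub>R sgn y"
      by (metis scaleR_scaleR)
    also have "h \<bullet> sgn y * (e * (1 / (norm y)\<^sup>2)) * norm y = e * (h \<bullet> sgn y / norm y)"
      using assms by (simp add: power2_eq_square)
    finally show "exp (- 1 / norm y) *\<^sub>R h + (h \<bullet> sgn y * (exp (- 1 / norm y) * (1 / (norm y)\<^sup>2))) *\<^sub>R y =
      exp (- 1 / norm y) *\<^sub>R (h + (h \<bullet> sgn y / norm y) *\<^sub>R sgn y)"
      unfolding e_def by (simp add: scaleR_add_right)
  qed
  finally show ?thesis .
qed

text \<open>Away from the origin this is the chain rule. At the origin the factor is O(|y|^3) and u
  and G are bounded, so the derivative exists and is 0, and the gradient tends to 0.\<close>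

lemma C1c_sob_trans:
  fixes u :: "'a::euclidean_space \<Rightarrow> real"
  assumes u: "C1c u G" and a: "a > 0"
  shows "C1c (sob_trans a u) (sob_grad a u G)"
  unfolding C1c_def
proof (intro conjI allI)
  obtain B where B: "B > 0" "\<And>x. \<bar>u x\<bar> \<le> B" "\<And>x. norm (G x) \<le> B" using C1c_bound[OF u] by metis
  define K where "K = (3 / a) ^ 3"
  have K: "K > 0" using a by (simp add: K_def)
  show "(sob_trans a u has_derivative (\<lambda>h. sob_grad a u G y \<bullet> h)) (at y)" for y
  proof (cases "y = 0")
    case True
    have "sob_grad a u G y = 0" by (simp add: True sob_grad_def sob_factor_def)
    then have "(\<lambda>h. sob_grad a u G y \<bullet> h) = (\<lambda>h. 0)" by simp
    moreover have "(sob_trans a u has_derivative (\<lambda>h. 0)) (at 0)"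
    proof (rule has_derivativeI_sandwich[where e=1 and H="\<lambda>y. K * B * (norm y)\<^sup>2"])
      fix y :: 'a assume "y \<noteq> 0"
      then have "\<bar>sob_trans a u y\<bar> \<le> (K * norm y ^ 3) * B"
        unfolding sob_trans_def abs_mult K_def using sob_factor_bounds[OF a, of "norm y"] B K
        by (intro mult_mono) auto
      also have "\<dots> = K * B * (norm y)\<^sup>2 * norm y" by (simp add: power2_eq_square power3_eq_cube)
      finally have "\<bar>sob_trans a u y\<bar> / norm y \<le> K * B * (norm y)\<^sup>2"
        using \<open>y \<noteq> 0\<close> by (simp add: divide_le_eq)
      then show "norm (sob_trans a u y - sob_trans a u 0 - 0) / norm (y - 0) \<le> K * B * (norm y)\<^sup>2"
        by (simp add: sob_trans_def[of _ _ 0] sob_factor_def)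
    next
      have "((\<lambda>y::'a. K * B * (norm y)\<^sup>2) \<longlongrightarrow> K * B * (norm (0::'a))\<^sup>2) (at 0)"
        by (intro tendsto_intros)
      then show "((\<lambda>y::'a. K * B * (norm y)\<^sup>2) \<longlongrightarrow> 0) (at 0)" by simp
    qed auto
    ultimately show ?thesis using True by simp
  next
    case False
    then have pos: "norm y > 0" by simp
    have 1: "((\<lambda>y. sob_factor a (norm y)) has_derivative
       (\<lambda>h. h \<bullet> sgn y * (sob_factor a (norm y) * (1 / (2 * norm y * (1 + norm y)) + a / (norm y)\<^sup>2)))) (at y)"
      by (rule DERIV_compose_FDERIV[OF DERIV_sob_factor[OF pos] has_derivative_norm[OF False]])
    have 2: "((\<lambda>y. u (sob_map y)) has_derivative
       (\<lambda>h. G (sob_map y) \<bullet> (exp (- 1 / norm y) *\<^sub>R (h + (h \<bullet> sgn y / norm y) *\<^sub>R sgn y)))) (at y)"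
      by (rule has_derivative_compose[OF has_derivative_sob_map[OF False] C1c_has_derivative[OF u]])
    have "(\<lambda>h. sob_factor a
        (norm y) * (G (sob_map y) \<bullet> (exp (- 1 / norm y) *\<^sub>R (h + (h \<bullet> sgn y / norm y) *\<^sub>R sgn y))) +
      h \<bullet> sgn y * (sob_factor a (norm y) * (1 / (2 * norm y * (1 + norm y)) + a / (norm y)\<^sup>2)) * u
          (sob_map y)) =
      (\<lambda>h. sob_grad a u G y \<bullet> h)"
      unfolding sob_grad_def inner_add_left inner_add_right inner_scaleR_left inner_scaleR_right
      by (simp add: fun_eq_iff inner_commute mult_ac distrib_left)
    then show ?thesis
      using has_derivative_mult[OF 1 2] unfolding sob_trans_def[abs_def] by simp
  qed
  have cont_map: "continuous_on (- {0}) (sob_map :: 'a \<Rightarrow> 'a)"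
    unfolding sob_map_def[abs_def] by (intro continuous_intros) auto
  have cont_u: "continuous_on (- {0}) (\<lambda>y. u (sob_map y))"
    by (rule continuous_on_compose2[OF C1c_continuous[OF u] cont_map]) simp
  have cont_G: "continuous_on (- {0}) (\<lambda>y. G (sob_map y))"
    by (rule continuous_on_compose2[OF C1c_continuous_grad[OF u] cont_map]) simp
  have nz: "1 + norm y \<noteq> 0" for y :: 'a using norm_ge_zero[of y] by linarith
  have cont: "continuous_on (- {0}) (sob_grad a u G)"
    unfolding sob_grad_def[abs_def] sob_factor_def sgn_div_norm
    using nz by (intro continuous_intros cont_u cont_G) auto
  have cont0: "isCont (sob_grad a u G) 0"
  proof -
    have "(sob_grad a u G \<longlongrightarrow> 0) (at 0)"
    proof (rule Lim_null_comparison)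
      show "\<forall>\<^sub>F y in at 0. norm (sob_grad a u G y) \<le> K * B * (2 * (norm y)\<^sup>2 + a * norm y + norm y ^ 3)"
        unfolding eventually_at_filter
      proof (intro always_eventually allI impI)
        fix y :: 'a assume "y \<noteq> 0"
        then have pos: "norm y > 0" by simp
        define g where "g = sob_factor a (norm y)"
        have g: "0 < g" "g \<le> K * norm y ^ 3" using sob_factor_bounds[OF a pos] by (auto simp: g_def K_def)
        have e: "exp (- 1 / norm y) \<le> 1" by simp
        let ?A = "(g * (1 / (2 * norm y * (1 + norm y)) + a / (norm y)\<^sup>2) * u (sob_map y)) *\<^sub>R sgn y"
        let ?C = "G (sob_map y) + (G (sob_map y) \<bullet> sgn y / norm y) *\<^sub>R sgn y"
        have "1 / (2 * norm y * (1 + norm y)) \<le> 1 / norm y"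
          using pos by (simp add: divide_simps)
        then have "norm ?A \<le> (K * norm y ^ 3) * (1 / norm y + a / (norm y)\<^sup>2) * B"
          using g pos a B K \<open>y \<noteq> 0\<close> by (auto simp: norm_sgn abs_mult intro!: mult_mono add_nonneg_nonneg)
        also have "\<dots> = K * B * ((norm y)\<^sup>2 + a * norm y)"
          using pos by (simp add: field_simps power2_eq_square power3_eq_cube)
        finally have A: "norm ?A \<le> K * B * ((norm y)\<^sup>2 + a * norm y)" .
        have "\<bar>G (sob_map y) \<bullet> sgn y\<bar> \<le> B"
          using Cauchy_Schwarz_ineq2[of "G (sob_map y)" "sgn y"] B(3)[of "sob_map y"] \<open>y \<noteq> 0\<close>
            by (simp add: norm_sgn)
        then have "\<bar>G (sob_map y) \<bullet> sgn y / norm y\<bar> * norm (sgn y) \<le> B / norm y"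
          using pos \<open>y \<noteq> 0\<close> by (simp add: norm_sgn divide_right_mono)
        then have C: "norm ?C \<le> B + B / norm y"
          using B(3)[of "sob_map y"] by (intro norm_triangle_le) simp
        have "\<bar>g * exp (- 1 / norm y)\<bar> \<le> K * norm y ^ 3 * 1"
          unfolding abs_mult using g e K by (intro mult_mono) auto
        then have "norm ((g * exp (- 1 / norm y)) *\<^sub>R ?C) \<le> (K * norm y ^ 3 * 1) * (B + B / norm y)"
          unfolding norm_scaleR using C K pos by (intro mult_mono) auto
        also have "\<dots> = K * B * ((norm y)\<^sup>2 + norm y ^ 3)"
          using pos by (simp add: field_simps power2_eq_square power3_eq_cube)
        finally have "norm ?A + norm ((g * exp (- 1 / norm y)) *\<^sub>R ?C) \<le>
            K * B * ((norm y)\<^sup>2 + a * norm y) + K * B * ((norm y)\<^sup>2 + norm y ^ 3)"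
          using A by linarith
        moreover have "sob_grad a u G y = ?A + (g * exp (- 1 / norm y)) *\<^sub>R ?C"
          unfolding sob_grad_def g_def ..
        ultimately show "norm (sob_grad a u G y) \<le> K * B * (2 * (norm y)\<^sup>2 + a * norm y + norm y ^ 3)"
          using norm_triangle_ineq[of ?A "(g * exp (- 1 / norm y)) *\<^sub>R ?C"] by (simp only: distrib_left)
      qed
      have "((\<lambda>y::'a. K * B * (2 * (norm y)\<^sup>2 + a * norm y + norm y ^ 3))
          \<longlongrightarrow> K * B * (2 * (norm (0::'a))\<^sup>2 + a * norm (0::'a) + norm (0::'a) ^ 3)) (at 0)"
        by (intro tendsto_intros)
      then show "((\<lambda>y::'a. K * B * (2 * (norm y)\<^sup>2 + a * norm y + norm y ^ 3)) \<longlongrightarrow> 0) (at 0)" by simp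
    qed
    moreover have "sob_grad a u G 0 = 0" by (simp add: sob_grad_def sob_factor_def)
    ultimately show ?thesis by (simp add: isCont_def)
  qed
  show "continuous_on UNIV (sob_grad a u G)"
  proof (intro continuous_at_imp_continuous_on ballI)
    fix y :: 'a
    show "isCont (sob_grad a u G) y"
    proof (cases "y = 0")
      case False
      have "open (- {0::'a})" by (simp add: open_Compl)
      then show ?thesis using cont False by (simp add: continuous_on_eq_continuous_at)
    qed (use cont0 in simp)
  qed
  obtain M where M: "M > 1" "\<And>x. norm x > M \<Longrightarrow> u x = 0" using C1c_support[OF u] by metis
  show "\<exists>M. \<forall>y. M < norm y \<longrightarrow> sob_trans a u y = 0"
  proof (intro exI allI impI)
    \<comment> \<open>For |y| > 1 the map shrinks norms by a factor of at most e, so the support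
      radius grows at most from M to M e.\<close>
    fix y :: 'a assume y: "M * exp 1 < norm y"
    have "M * 1 \<le> M * exp 1" using M by (intro mult_left_mono) auto
    then have "norm y > 1" using y M by linarith
    then have "exp (-1) \<le> exp (- 1 / norm y)" by (simp add: divide_le_eq)
    have "M = M * exp 1 * exp (-1)" by (simp flip: exp_add)
    also have "\<dots> < norm y * exp (-1)" using y by simp
    also have "\<dots> \<le> norm y * exp (- 1 / norm y)"
      by (intro mult_left_mono \<open>exp (-1) \<le> exp (- 1 / norm y)\<close>) auto
    also have "\<dots> = norm (sob_map y)" by (simp add: sob_map_def)
    finally show "sob_trans a u y = 0" by (simp add: sob_trans_def M)
  qed
qed

text \<open>If r < 1 then 1/X_1(r) = L = 1 - ln \<rho> + 1/\<rho>. From -ln \<rho> \<le> 1/\<rho> -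
  1 follows L \<le> 2 \<tau>. Conversely \<tau> \<le> L if \<rho> \<le> 1, while \<tau> \<le> 2 and
  L > 1 otherwise. If r \<ge> 1 then \<rho> \<ge> 1, and both quantities lie within a factor 2 of
  1.\<close>

lemma X1_tilde_sob_map:
  fixes \<rho> :: real
  assumes "\<rho> > 0"
  defines "r \<equiv> \<rho> * exp (- 1 / \<rho>)" and "\<tau> \<equiv> 1 + 1 / \<rho>"
  shows "1 / \<tau> \<le> 2 * X1_tilde r" "X1_tilde r \<le> 2 / \<tau>" "X1_tilde r > 0"
proof -
  have \<tau>: "\<tau> > 1" using assms by simp
  have r: "r > 0" using assms by simp
  have "1 / \<tau> \<le> 2 * X1_tilde r \<and> X1_tilde r \<le> 2 / \<tau> \<and> X1_tilde r > 0"
  proof (cases "r < 1")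
    case True
    define L where "L = 1 - ln r"
    have L: "L = 1 - ln \<rho> + 1 / \<rho>"
      using assms(1) by (simp add: L_def r_def ln_mult)
    have "L > 1" using True r by (simp add: L_def)
    have X: "X1_tilde r = 1 / L" using True by (simp add: X1_tilde_def X1_def L_def inverse_eq_divide)
    have "- ln \<rho> \<le> 1 / \<rho> - 1"
      using ln_le_minus_one[of "1 / \<rho>"] assms(1) by (simp add: ln_div)
    moreover have "1 / \<rho> > 0" using assms(1) by simp
    ultimately have "L \<le> 2 * \<tau>" unfolding L \<tau>_def distrib_left by linarith
    moreover have "\<tau> \<le> 2 * L"
    proof (cases "\<rho> \<le> 1")
      case True
      then have "ln \<rho> \<le> 0" using assms(1) by simp
      then have "\<tau> \<le> L" unfolding L \<tau>_def by simp
      then show ?thesis using \<open>L > 1\<close> by simp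
    next
      case False
      then have "\<tau> \<le> 2" by (simp add: \<tau>_def)
      then show ?thesis using \<open>L > 1\<close> by simp
    qed
    ultimately show ?thesis
      using \<tau> \<open>L > 1\<close> by (simp add: X field_simps)
  next
    case False
    have "r \<le> \<rho> * 1" unfolding r_def using assms(1) by (intro mult_left_mono) auto
    then have "\<tau> \<le> 2" using False by (simp add: \<tau>_def)
    then show ?thesis using False \<tau> by (simp add: X1_tilde_def field_simps)
  qed
  then show "1 / \<tau> \<le> 2 * X1_tilde r" "X1_tilde r \<le> 2 / \<tau>" "X1_tilde r > 0" by auto
qed

text \<open>The exponential in the factor is the ground state in the new variable: (|x|/|y|)^a =
  e^{-a/|y|}. Rewriting G through \<open>pgrad\<close> therefore cancels the strongest singularity,
  and what remains of the derivative of the factor is of order 1/|y|. This remainder is what the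
  term with X_1 has to dominate.\<close>

lemma norm_sob_grad_le:
  fixes u :: "'a::euclidean_space \<Rightarrow> real"
  assumes dim: "DIM('a) \<ge> 3" and y: "y \<noteq> 0"
  defines "a \<equiv> (real DIM('a) - 2) / 2"
  shows "(norm (sob_grad a u G y))\<^sup>2 \<le>
    exp (- real DIM('a) / norm y) * (1 + 1 / norm y) *
      (2 * (norm (pgrad u G (sob_map y)))\<^sup>2 +
       8 * (a + 1/2)\<^sup>2 * (X1_tilde (norm (sob_map y)) * (u (sob_map y) / norm (sob_map y)))\<^sup>2)"
proof -
  define \<rho> x s P where "\<rho> = norm y" and "x = sob_map y" and "s = sgn y" and "P = pgrad u G (sob_map y)"
  define E g \<tau> where "E = exp (- 1 / \<rho>)" and "g = sob_factor a \<rho>" and "\<tau> = 1 + 1 / \<rho>"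
  have \<rho>: "\<rho> > 0" using y by (simp add: \<rho>_def)
  have E: "E > 0" by (simp add: E_def)
  have a: "a > 0" using dim by (simp add: a_def)
  have s: "norm s = 1" "s \<bullet> s = 1" using y by (simp_all add: s_def norm_sgn sgn_inner_sgn)
  have nx: "norm x = E * \<rho>" by (simp add: x_def sob_map_def \<rho>_def E_def)
  have sx: "sgn x = s" by (simp add: x_def sob_map_def sgn_scaleR s_def)
  have \<tau>: "\<tau> > 1" using \<rho> by (simp add: \<tau>_def)
  have g0: "g > 0" using sob_factor_bounds[OF a \<rho>] by (simp add: g_def)
  have g2: "g\<^sup>2 = exp (- 2 * a / \<rho>) / \<tau>"
  proof -
    have "\<rho> / (1 + \<rho>) = 1 / \<tau>" using \<rho> by (simp add: \<tau>_def field_simps)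
    moreover have "(exp (- a / \<rho>))\<^sup>2 = exp (- 2 * a / \<rho>)" by (simp add: power2_eq_square flip: exp_add)
    ultimately show ?thesis
      using \<tau> \<rho> unfolding g_def sob_factor_def power_mult_distrib by simp
  qed
  have E2: "E\<^sup>2 * exp (- 2 * a / \<rho>) = exp (- real DIM('a) / \<rho>)"
  proof -
    have "E\<^sup>2 = exp (- 2 / \<rho>)" by (simp add: E_def power2_eq_square flip: exp_add)
    then have "E\<^sup>2 * exp (- 2 * a / \<rho>) = exp (- 2 / \<rho> + - 2 * a / \<rho>)" by (simp only: exp_add)
    also have "- 2 / \<rho> + - 2 * a / \<rho> = - real DIM('a) / \<rho>"
      using \<rho> by (simp add: a_def field_simps)
    finally show ?thesis .
  qed
  define U where "U = u x"
  have G: "G x = P + (- (a * U / (E * \<rho>))) *\<^sub>R s"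
    unfolding P_def pgrad_def x_def[symmetric] sx nx U_def[symmetric] a_def by simp
  define V where "V = (g * E) *\<^sub>R (P + (P \<bullet> s / \<rho>) *\<^sub>R s)"
  define c where "c = g * U * (1 / (2 * \<rho> * (1 + \<rho>)) - a / \<rho>)"
  have "sob_grad a u G y = (g * (1 / (2 * \<rho> * (1 + \<rho>)) + a / \<rho>\<^sup>2) * U) *\<^sub>R s +
      (g * E) *\<^sub>R (G x + (G x \<bullet> s / \<rho>) *\<^sub>R s)"
    unfolding sob_grad_def \<rho>_def x_def s_def g_def E_def U_def ..
  also have "G x + (G x \<bullet> s / \<rho>) *\<^sub>R s = P + (P \<bullet> s / \<rho>) *\<^sub>R s + (- (a * U / (E * \<rho>)) * \<tau>) *\<^sub>R s"
  proof -
    have "G x \<bullet> s = P \<bullet> s + - (a * U / (E * \<rho>))"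
      unfolding G inner_add_left inner_scaleR_left s(2) by simp
    then have "(G x \<bullet> s / \<rho>) *\<^sub>R s = (P \<bullet> s / \<rho>) *\<^sub>R s + (- (a * U / (E * \<rho>)) / \<rho>) *\<^sub>R s"
      by (simp only: add_divide_distrib scaleR_add_left)
    moreover have "(- (a * U / (E * \<rho>)) * \<tau>) *\<^sub>R s = (- (a * U / (E * \<rho>))) *\<^sub>R s +
        (- (a * U / (E * \<rho>)) / \<rho>) *\<^sub>R s"
      unfolding scaleR_add_left[symmetric] \<tau>_def by (simp add: distrib_left)
    ultimately show ?thesis unfolding G by simp
  qed
  also have "(g * E) *\<^sub>R \<dots> = V + ((g * E) * (- (a * U / (E * \<rho>)) * \<tau>)) *\<^sub>R s"
    unfolding V_def scaleR_add_right[of "g * E"] by simp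
  also have "(g * (1 / (2 * \<rho> * (1 + \<rho>)) + a / \<rho>\<^sup>2) * U) *\<^sub>R s +
      (V + ((g * E) * (- (a * U / (E * \<rho>)) * \<tau>)) *\<^sub>R s)
     = V + (g * (1 / (2 * \<rho> * (1 + \<rho>)) + a / \<rho>\<^sup>2) * U + (g * E) * (- (a * U / (E * \<rho>)) * \<tau>)) *\<^sub>R s"
    unfolding scaleR_add_left by (rule add.left_commute)
  \<comment> \<open>The derivative of e^{-a/\<rho>} contributes a/\<rho>^2, the ground-state part of
    G contributes -(a/\<rho> + a/\<rho>^2); the terms in 1/\<rho>^2 cancel.\<close>
  also have "g * (1 / (2 * \<rho> * (1 + \<rho>)) + a / \<rho>\<^sup>2) * U + (g * E) * (- (a * U / (E * \<rho>)) * \<tau>) = c"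
  proof -
    have "(g * E) * (- (a * U / (E * \<rho>)) * \<tau>) = - (g * U * (a / \<rho> + a / \<rho>\<^sup>2))"
      using E \<rho> by (simp add: \<tau>_def field_simps power2_eq_square)
    then show ?thesis by (simp add: c_def algebra_simps)
  qed
  finally have grad: "sob_grad a u G y = V + c *\<^sub>R s" .
  have V: "norm V \<le> g * E * \<tau> * norm P"
  proof -
    have "\<bar>P \<bullet> s\<bar> \<le> norm P" using Cauchy_Schwarz_ineq2[of P s] s by simp
    then have "norm ((P \<bullet> s / \<rho>) *\<^sub>R s) \<le> norm P / \<rho>"
      using \<rho> s by (simp add: divide_right_mono)
    then have "norm (P + (P \<bullet> s / \<rho>) *\<^sub>R s) \<le> norm P + norm P / \<rho>"
      by (intro norm_triangle_le) simp
    also have "\<dots> = \<tau> * norm P" by (simp add: \<tau>_def distrib_right)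
    finally have "g * E * norm (P + (P \<bullet> s / \<rho>) *\<^sub>R s) \<le> g * E * (\<tau> * norm P)"
      using g0 E by (intro mult_left_mono) auto
    then show ?thesis using g0 E by (simp add: V_def mult.assoc)
  qed
  have c: "\<bar>c\<bar> \<le> g * \<bar>U\<bar> * ((a + 1/2) / \<rho>)"
  proof -
    have "0 \<le> 1 / (2 * \<rho> * (1 + \<rho>))" "1 / (2 * \<rho> * (1 + \<rho>)) \<le> 1 / 2 / \<rho>" "a / \<rho> > 0"
      using \<rho> a by (simp_all add: divide_simps)
    then have "\<bar>1 / (2 * \<rho> * (1 + \<rho>)) - a / \<rho>\<bar> \<le> (a + 1/2) / \<rho>"
      unfolding add_divide_distrib by linarith
    then show ?thesis
      unfolding c_def abs_mult using g0 by (intro mult_mono) auto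
  qed
  have "norm (sob_grad a u G y) \<le> g * E * \<tau> * norm P + g * \<bar>U\<bar> * ((a + 1/2) / \<rho>)"
    unfolding grad using V c s by (intro norm_triangle_le) simp
  then have "(norm (sob_grad a u G y))\<^sup>2 \<le> (g * E * \<tau> * norm P + g * \<bar>U\<bar> * ((a + 1/2) / \<rho>))\<^sup>2"
    by (intro power_mono) auto
  also have "\<dots> \<le> 2 * (g * E * \<tau> * norm P)\<^sup>2 + 2 * (g * \<bar>U\<bar> * ((a + 1/2) / \<rho>))\<^sup>2"
    using sum_squares_bound[of "g * E * \<tau> * norm P" "g * \<bar>U\<bar> * ((a + 1/2) / \<rho>)"]
      unfolding power2_sum by linarith
  also have "(g * E * \<tau> * norm P)\<^sup>2 = (E\<^sup>2 * exp (- 2 * a / \<rho>)) * \<tau> * (norm P)\<^sup>2"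
    unfolding power_mult_distrib g2 using \<tau> by (simp add: power2_eq_square)
  \<comment> \<open>Both terms carry the same Jacobian: g^2 = e^{-2a/\<rho>}/\<tau>, and E^2
    e^{-2a/\<rho>} = e^{-N/\<rho>} because 2 + 2a = N. The factor (1/\<tau>)^2 left over is
    comparable to X_1^2.\<close>
  also have "(g * \<bar>U\<bar> * ((a + 1/2) / \<rho>))\<^sup>2 =
      (E\<^sup>2 * exp (- 2 * a / \<rho>)) * \<tau> * ((a + 1/2)\<^sup>2 * (1 / \<tau> * (U / (E * \<rho>)))\<^sup>2)"
    unfolding power_mult_distrib power_divide g2 using \<tau> E \<rho> by (simp add: power2_eq_square)
  also have "(1 / \<tau> * (U / (E * \<rho>)))\<^sup>2 \<le> (2 * X1_tilde (norm x) * (U / (E * \<rho>)))\<^sup>2"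
  proof -
    have "1 / \<tau> \<le> 2 * X1_tilde (norm x)"
      using X1_tilde_sob_map(1)[OF \<rho>] by (simp add: nx E_def \<tau>_def mult.commute)
    then have "(1 / \<tau>)\<^sup>2 \<le> (2 * X1_tilde (norm x))\<^sup>2"
      using \<tau> by (intro power_mono) auto
    then show ?thesis unfolding power_mult_distrib[of "1 / \<tau>"] power_mult_distrib[of "2 * X1_tilde (norm x)"]
      by (rule mult_right_mono) simp
  qed
  finally have "(norm (sob_grad a u G y))\<^sup>2 \<le> 2 * (exp (- real DIM('a) / \<rho>) * \<tau> * (norm P)\<^sup>2) +
     2 * (exp (- real DIM('a) / \<rho>) * \<tau> * ((a + 1/2)\<^sup>2 * (2 * X1_tilde (norm x) * (U / (E * \<rho>)))\<^sup>2))"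
    unfolding E2 using \<tau> by (simp add: mult_left_mono)
  also have "\<dots> = exp (- real DIM('a) / \<rho>) * \<tau> * (2 * (norm P)\<^sup>2 +
      8 * (a + 1/2)\<^sup>2 * (X1_tilde (norm x) * (U / (E * \<rho>)))\<^sup>2)"
    unfolding mult.assoc[of 2 "X1_tilde (norm x)"] power_mult_distrib[of 2] by (simp add: algebra_simps)
  finally show ?thesis
    unfolding nx[symmetric] unfolding U_def x_def P_def \<rho>_def \<tau>_def .
qed

text \<open>The exponents match exactly: (N-2)/2 times q is N, so the q-th power of the exponential
  factor is e^{-N/\<rho>}; and m = 1 + q/2, so X_1^m times \<tau> is at most a constant times
  \<tau>^{-q/2}, the q-th power of the square-root factor.\<close>

lemma sob_trans_powr_ge:
  fixes u :: "'a::euclidean_space \<Rightarrow> real"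
  assumes dim: "DIM('a) \<ge> 3" and y: "y \<noteq> 0"
  defines "q \<equiv> 2 * real DIM('a) / (real DIM('a) - 2)" and "m \<equiv> (2 * real DIM('a) - 2) / (real DIM('a) - 2)"
  shows "\<bar>u (sob_map y)\<bar> powr q * X1_tilde (norm (sob_map y))
      powr m * (exp (- real DIM('a) / norm y) * (1 + 1 / norm y))
    \<le> 2 powr m * \<bar>sob_trans ((real DIM('a) - 2) / 2) u y\<bar> powr q"
proof -
  define n where "n = real DIM('a)"
  have n: "n \<ge> 3" using dim by (simp add: n_def)
  define \<rho> x \<tau> where "\<rho> = norm y" and "x = sob_map y" and "\<tau> = 1 + 1 / \<rho>"
  have \<rho>: "\<rho> > 0" using y by (simp add: \<rho>_def)
  have \<tau>: "\<tau> > 1" using \<rho> by (simp add: \<tau>_def)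
  have nx: "norm x = \<rho> * exp (- 1 / \<rho>)" by (simp add: x_def sob_map_def \<rho>_def)
  have qm: "m = 1 + q / 2" "(n - 2) / 2 * q = n" "m > 0"
    using n by (simp_all add: q_def m_def n_def[symmetric] field_simps)
  have g: "sob_factor ((n - 2) / 2) \<rho> powr q = \<tau> powr (- q / 2) * exp (- n / \<rho>)"
  proof -
    have "\<rho> / (1 + \<rho>) = 1 / \<tau>" using \<rho> by (simp add: \<tau>_def field_simps)
    then have "sqrt (\<rho> / (1 + \<rho>)) = inverse (sqrt \<tau>)"
      by (simp add: real_sqrt_divide inverse_eq_divide)
    also have "\<dots> = \<tau> powr (- (1 / 2))"
      unfolding powr_minus using \<tau> by (subst powr_half_sqrt) auto
    finally have "sob_factor ((n - 2) / 2) \<rho> powr q =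
        (\<tau> powr (- (1 / 2))) powr q * exp (- ((n - 2) / 2) / \<rho>) powr q"
      unfolding sob_factor_def by (simp add: powr_mult)
    also have "(\<tau> powr (- (1 / 2))) powr q = \<tau> powr (- q / 2)"
      by (simp add: powr_powr)
    also have "exp (- ((n - 2) / 2) / \<rho>) powr q = exp (- ((n - 2) / 2 * q) / \<rho>)"
      by (simp add: powr_def mult.commute)
    finally show ?thesis unfolding qm(2) .
  qed
  have "X1_tilde (norm x) powr m \<le> (2 / \<tau>) powr m"
    using X1_tilde_sob_map(2,3)[OF \<rho>] qm(3) by (intro powr_mono2) (auto simp: nx \<tau>_def)
  also have "\<dots> = 2 powr m * \<tau> powr (- m)"
    using \<tau> by (subst powr_divide) (auto simp: powr_minus divide_inverse)
  finally have "X1_tilde (norm x) powr m * \<tau> \<le> 2 powr m * \<tau> powr (- m) * \<tau>"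
    using \<tau> by (intro mult_right_mono) auto
  also have "2 powr m * \<tau> powr (- m) * \<tau> = 2 powr m * \<tau> powr (- q / 2)"
  proof -
    have "\<tau> powr (- m) * \<tau> powr 1 = \<tau> powr (- m + 1)" by (rule powr_add[symmetric])
    then show ?thesis using \<tau> by (simp add: qm(1) mult.assoc)
  qed
  finally have X: "X1_tilde (norm x) powr m * \<tau> \<le> 2 powr m * \<tau> powr (- q / 2)" .
  have "\<bar>u x\<bar> powr q * X1_tilde (norm x) powr m * (exp (- n / \<rho>) * \<tau>) =
      (\<bar>u x\<bar> powr q * exp (- n / \<rho>)) * (X1_tilde (norm x) powr m * \<tau>)"
    by simp
  also have "\<dots> \<le> (\<bar>u x\<bar> powr q * exp (- n / \<rho>)) * (2 powr m * \<tau> powr (- q / 2))"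
    by (intro mult_left_mono X) auto
  also have "\<dots> = 2 powr m * (sob_factor ((n - 2) / 2) \<rho> powr q * \<bar>u x\<bar> powr q)"
    unfolding g by simp
  also have "sob_factor ((n - 2) / 2) \<rho> powr q * \<bar>u x\<bar> powr q = \<bar>sob_trans ((n - 2) / 2) u y\<bar> powr q"
    using sob_factor_bounds(1)[of "(n - 2) / 2" \<rho>] n \<rho>
    by (simp add: sob_trans_def abs_mult powr_mult x_def \<rho>_def)
  finally show ?thesis by (simp only: n_def \<rho>_def x_def \<tau>_def)
qed

section \<open>Transfer of the Sobolev inequality to the weighted one\<close>

lemma measurable_X1_tilde [measurable]: "X1_tilde \<in> borel_measurable borel"
  unfolding X1_tilde_def[abs_def] X1_def by measurable

lemma X1_tilde_bounds: "0 \<le> X1_tilde (norm x)" "X1_tilde (norm x) \<le> 1"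
proof -
  have "0 \<le> X1_tilde (norm x) \<and> X1_tilde (norm x) \<le> 1"
  proof (cases "x = 0 \<or> norm x \<ge> 1")
    case False
    then have "ln (norm x) < 0" by (subst ln_less_zero_iff) auto
    then show ?thesis by (auto simp: X1_tilde_def X1_def inverse_le_1_iff)
  qed (auto simp: X1_tilde_def X1_def)
  then show "0 \<le> X1_tilde (norm x)" "X1_tilde (norm x) \<le> 1" by auto
qed

lemma integrable_X1_tilde_hardy:
  fixes u :: "'a::euclidean_space \<Rightarrow> real"
  assumes dim: "DIM('a) \<ge> 3" and u: "C1c u G"
  shows "integrable lborel (\<lambda>x. (X1_tilde (norm x) * (u x / norm x))\<^sup>2)"
proof (rule Bochner_Integration.integrable_bound[OF integrable_hardy[OF dim u]])
  note [measurable] = C1c_measurable[OF u]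
  show "(\<lambda>x. (X1_tilde (norm x) * (u x / norm x))\<^sup>2) \<in> borel_measurable lborel" by measurable
  show "AE x in lborel. norm ((X1_tilde (norm x) * (u x / norm x))\<^sup>2) \<le> norm ((u x / norm x)\<^sup>2)"
  proof (rule AE_I2)
    fix x :: 'a
    have "(X1_tilde (norm x))\<^sup>2 * (u x / norm x)\<^sup>2 \<le> 1 * (u x / norm x)\<^sup>2"
      using X1_tilde_bounds[of x] by (intro mult_right_mono power_le_one) auto
    then show "norm ((X1_tilde (norm x) * (u x / norm x))\<^sup>2) \<le> norm ((u x / norm x)\<^sup>2)"
      unfolding power_mult_distrib by simp
  qed
qed

text \<open>The plain Sobolev inequality for the transformed function, with both sides carried back
  by the radial substitution. The changes of variables use nonnegative integrals, so finiteness is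
  inherited from the majorant. The pointwise bounds hold for y different from 0, hence almost
  everywhere.\<close>

theorem weighted_Sobolev_inequality:
  assumes dim: "DIM('a::euclidean_space) \<ge> 3"
  defines "q \<equiv> 2 * real DIM('a) / (real DIM('a) - 2)" and "m \<equiv> (2 * real DIM('a) - 2) / (real DIM('a) - 2)"
  shows "\<exists>C>0. \<forall>(u :: 'a \<Rightarrow> real) G. C1c u G \<longrightarrow>
    (LINT x|lborel. \<bar>u x\<bar> powr q * X1_tilde (norm x) powr m) powr ((real DIM('a) - 2) / real DIM('a)) \<le>
    C * ((LINT x|lborel. (norm (pgrad u G x))\<^sup>2) + (LINT x|lborel. (X1_tilde (norm x) * (u x / norm x))\<^sup>2))"
proof -
  define n where "n = real DIM('a)"
  have n: "n \<ge> 3" using dim by (simp add: n_def)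
  define a where "a = (n - 2) / 2"
  have a: "a > 0" using n by (simp add: a_def)
  define S where "S = (2 * (n - 1) / (n - 2))\<^sup>2"
  define A where "A = 2 + 8 * (a + 1/2)\<^sup>2"
  define C where "C = (2 powr m) powr ((n - 2) / n) * (S * A)"
  have S: "S > 0" using n by (simp add: S_def)
  have A: "A > 0" "A \<ge> 2" "A \<ge> 8 * (a + 1/2)\<^sup>2" by (simp_all add: A_def add_pos_nonneg)
  have "C > 0" using S A by (simp add: C_def)
  moreover have "(LINT x|lborel. \<bar>u x\<bar> powr q * X1_tilde (norm x) powr m) powr ((n - 2) / n) \<le>
    C * ((LINT x|lborel. (norm (pgrad u G x))\<^sup>2) + (LINT x|lborel. (X1_tilde (norm x) * (u x / norm x))\<^sup>2))"
    if u: "C1c u G" for u :: "'a \<Rightarrow> real" and G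
  proof -
    define W where "W = sob_trans a u"
    define D where "D = sob_grad a u G"
    have W: "C1c W D" unfolding W_def D_def by (rule C1c_sob_trans[OF u a])
    note [measurable] = C1c_measurable[OF u] C1c_measurable[OF W] measurable_pgrad[OF u]
    let ?J = "\<lambda>y::'a. exp (- real DIM('a) / norm y) * (1 + 1 / norm y)"
    let ?H = "\<lambda>x. (norm (pgrad u G x))\<^sup>2 + (X1_tilde (norm x) * (u x / norm x))\<^sup>2"
    let ?k = "\<lambda>x. \<bar>u x\<bar> powr q * X1_tilde (norm x) powr m"
    have [measurable]: "?H \<in> borel_measurable borel" "?k \<in> borel_measurable borel" by measurable
    have J: "?J y \<ge> 0" for y by simp
    have AE0: "AE y in lborel. y \<noteq> (0::'a)" by (rule AE_lborel_singleton)
    have intH: "integrable lborel ?H"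
      by (intro Bochner_Integration.integrable_add integrable_pgrad[OF dim u]
          integrable_X1_tilde_hardy[OF dim u])
    have H_split: "(LINT x|lborel. ?H x) = (LINT x|lborel. (norm (pgrad u G x))\<^sup>2) +
        (LINT x|lborel. (X1_tilde (norm x) * (u x / norm x))\<^sup>2)"
      by (intro Bochner_Integration.integral_add integrable_pgrad[OF dim u]
          integrable_X1_tilde_hardy[OF dim u])
    have "ennreal (LINT y|lborel. (norm (D y))\<^sup>2) = (\<integral>\<^sup>+y. ennreal ((norm (D y))\<^sup>2) \<partial>lborel)"
      by (rule nn_integral_eq_integral[symmetric, OF integrable_grad[OF dim W]]) simp
    also have "\<dots> \<le> (\<integral>\<^sup>+y. ennreal (A * ?H (sob_map y)) * ennreal (?J y) \<partial>lborel)"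
    proof (rule nn_integral_mono_AE)
      show "AE y in lborel. ennreal ((norm (D y))\<^sup>2) \<le> ennreal (A * ?H (sob_map y)) * ennreal (?J y)"
        using AE0
      proof eventually_elim
        fix y :: 'a assume "y \<noteq> 0"
        from norm_sob_grad_le[OF dim this, of u G]
        have "(norm (D y))\<^sup>2 \<le> ?J y * (2 * (norm (pgrad u G (sob_map y)))\<^sup>2 +
          8 * (a + 1/2)\<^sup>2 * (X1_tilde (norm (sob_map y)) * (u (sob_map y) / norm (sob_map y)))\<^sup>2)"
          unfolding D_def a_def n_def .
        also have "\<dots> \<le> ?J y * (A * (norm (pgrad u G (sob_map y)))\<^sup>2 +
          A * (X1_tilde (norm (sob_map y)) * (u (sob_map y) / norm (sob_map y)))\<^sup>2)"
          using A by (intro mult_left_mono J add_mono mult_right_mono) auto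
        finally have "(norm (D y))\<^sup>2 \<le> (A * ?H (sob_map y)) * ?J y"
          by (simp only: distrib_left mult_ac)
        then show "ennreal ((norm (D y))\<^sup>2) \<le> ennreal (A * ?H (sob_map y)) * ennreal (?J y)"
          by (subst ennreal_mult[symmetric]) (use A J[of y] in \<open>auto intro: ennreal_leI\<close>)
      qed
    qed
    also have "\<dots> = (\<integral>\<^sup>+x. ennreal (A * ?H x) \<partial>lborel)"
      by (subst nn_integral_radial_substitution) (auto simp: sob_map_def)
    also have "\<dots> = ennreal (LINT x|lborel. A * ?H x)"
      using A intH by (intro nn_integral_eq_integral integrable_mult_right AE_I2) auto
    also have "\<dots> = ennreal (A * (LINT x|lborel. ?H x))" by simp
    finally have grad: "(LINT y|lborel. (norm (D y))\<^sup>2) \<le> A * (LINT x|lborel. ?H x)"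
      using A by (subst (asm) ennreal_le_iff) (auto intro!: mult_nonneg_nonneg integral_nonneg)
    have intW: "integrable lborel (\<lambda>y. \<bar>W y\<bar> powr q)"
    proof -
      obtain M where "M > 1" "\<And>x. norm x > M \<Longrightarrow> W x = 0" using C1c_support[OF W] by metis
      then show ?thesis
        using n by (intro integrable_continuous_bounded_support[of _ M]
            continuous_on_powr' continuous_intros C1c_continuous[OF W])
          (auto simp: q_def n_def)
    qed
    have "(\<integral>\<^sup>+x. ennreal (?k x) \<partial>lborel) = (\<integral>\<^sup>+y. ennreal (?k (sob_map y)) * ennreal (?J y) \<partial>lborel)"
      by (subst nn_integral_radial_substitution) (auto simp: sob_map_def)
    also have "\<dots> \<le> (\<integral>\<^sup>+y. ennreal (2 powr m * \<bar>W y\<bar> powr q) \<partial>lborel)"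
    proof (rule nn_integral_mono_AE)
      show "AE y in lborel. ennreal (?k (sob_map y)) * ennreal (?J y) \<le> ennreal (2 powr m * \<bar>W y\<bar> powr q)"
        using AE0
      proof eventually_elim
        fix y :: 'a assume "y \<noteq> 0"
        from sob_trans_powr_ge[OF dim this, of u]
        have "?k (sob_map y) * ?J y \<le> 2 powr m * \<bar>W y\<bar> powr q"
          unfolding W_def a_def n_def q_def m_def .
        then show "ennreal (?k (sob_map y)) * ennreal (?J y) \<le> ennreal (2 powr m * \<bar>W y\<bar> powr q)"
          by (subst ennreal_mult[symmetric]) (use J[of y] in \<open>auto intro: ennreal_leI\<close>)
      qed
    qed
    also have "\<dots> = ennreal (LINT y|lborel. 2 powr m * \<bar>W y\<bar> powr q)"
      using intW by (intro nn_integral_eq_integral integrable_mult_right AE_I2) auto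
    also have "\<dots> = ennreal (2 powr m * (LINT y|lborel. \<bar>W y\<bar> powr q))" by simp
    finally have "enn2real (\<integral>\<^sup>+x. ennreal (?k x) \<partial>lborel) \<le> 2 powr m * (LINT y|lborel. \<bar>W y\<bar> powr q)"
      by (intro enn2real_leI) (auto intro!: mult_nonneg_nonneg integral_nonneg)
    then have "(LINT x|lborel. ?k x) \<le> 2 powr m * (LINT y|lborel. \<bar>W y\<bar> powr q)"
      by (subst integral_eq_nn_integral) auto
    then have "(LINT x|lborel. ?k x) powr ((n - 2) / n) \<le>
        (2 powr m * (LINT y|lborel. \<bar>W y\<bar> powr q)) powr ((n - 2) / n)"
      using n by (intro powr_mono2 integral_nonneg) auto
    also have "\<dots> = (2 powr m) powr ((n - 2) / n) * (LINT y|lborel. \<bar>W y\<bar> powr q) powr ((n - 2) / n)"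
      by (intro powr_mult)
    also have "\<dots> \<le> (2 powr m) powr ((n - 2) / n) * (S * (LINT y|lborel. (norm (D y))\<^sup>2))"
      using Sobolev_inequality[OF dim W] unfolding q_def S_def n_def by (intro mult_left_mono) auto
    also have "\<dots> \<le> (2 powr m) powr ((n - 2) / n) * (S * (A * (LINT x|lborel. ?H x)))"
      using S by (intro mult_left_mono grad) auto
    also have "\<dots> = C * (LINT x|lborel. ?H x)" by (simp add: C_def)
    finally show ?thesis unfolding H_split .
  qed
  ultimately show ?thesis unfolding n_def by blast
qed

section \<open>Smooth functions on open sets\<close>

text \<open>A localisation of \<open>C_k\<close> to a set. The competitor for the critical case is
  assembled from powers of |x|, which are smooth only away from the origin, and is then glued with
  the zero function near the origin.\<close>

primrec Ck_on :: "'a::euclidean_space set \<Rightarrow> nat \<Rightarrow> ('a \<Rightarrow> real) \<Rightarrow> bool" where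
  "Ck_on S 0 u \<longleftrightarrow> continuous_on S u"
| "Ck_on S (Suc k) u \<longleftrightarrow> (\<forall>x\<in>S. u differentiable (at x)) \<and>
     (\<forall>b\<in>Basis. Ck_on S k (\<lambda>x. frechet_derivative u (at x) b))"

lemma C_k_iff_Ck_on: "C_k k u \<longleftrightarrow> Ck_on UNIV k u"
  by (induction k arbitrary: u) auto

lemma Ck_on_cong:
  assumes "open S" "\<And>x. x \<in> S \<Longrightarrow> u x = v x" "Ck_on S k u"
  shows "Ck_on S k v"
  using assms(2,3)
proof (induction k arbitrary: u v)
  case 0
  then show ?case using continuous_on_cong[of S S u v] by simp
next
  case (Suc k)
  have "(v has_derivative frechet_derivative u (at x)) (at x)" if "x \<in> S" for x
  proof -
    have "(u has_derivative frechet_derivative u (at x)) (at x)"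
      using Suc.prems(2) that by (simp flip: frechet_derivative_works)
    then show ?thesis
      by (rule has_derivative_transform_within_open[OF _ assms(1) that]) (use Suc.prems in auto)
  qed
  then have d: "v differentiable (at x)" "frechet_derivative u (at x) = frechet_derivative v (at x)"
      if "x \<in> S" for x
    using that frechet_derivative_at[of v] by (auto simp: differentiable_def)
  show ?case
    unfolding Ck_on.simps
  proof (intro conjI ballI)
    show "Ck_on S k (\<lambda>x. frechet_derivative v (at x) b)" if "b \<in> Basis" for b
    proof (rule Suc.IH[of "\<lambda>x. frechet_derivative u (at x) b"])
      show "frechet_derivative u (at x) b = frechet_derivative v (at x) b" if "x \<in> S" for x
        by (simp only: d(2)[OF that])
      show "Ck_on S k (\<lambda>x. frechet_derivative u (at x) b)"
        using Suc.prems(2) that by simp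
    qed
  qed (rule d(1))
qed

lemma Ck_on_Suc_I:
  assumes "open S" "\<And>x. x \<in> S \<Longrightarrow> (u has_derivative D x) (at x)"
    and "\<And>b. b \<in> Basis \<Longrightarrow> Ck_on S k (\<lambda>x. D x b)"
  shows "Ck_on S (Suc k) u"
  unfolding Ck_on.simps
proof (intro conjI ballI)
  show "u differentiable (at x)" if "x \<in> S" for x
    using assms(2)[OF that] by (rule differentiableI)
  show "Ck_on S k (\<lambda>x. frechet_derivative u (at x) b)" if "b \<in> Basis" for b
  proof (rule Ck_on_cong[OF assms(1) _ assms(3)[OF that]])
    show "D x b = frechet_derivative u (at x) b" if "x \<in> S" for x
      by (simp only: frechet_derivative_at[OF assms(2)[OF that]])
  qed
qed

lemma Ck_on_has_derivative:
  "Ck_on S (Suc k) u \<Longrightarrow> x \<in> S \<Longrightarrow> (u has_derivative frechet_derivative u (at x)) (at x)"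
  by (simp flip: frechet_derivative_works)

lemma Ck_on_lower: "Ck_on S (Suc k) u \<Longrightarrow> Ck_on S k u"
proof (induction k arbitrary: u)
  case 0
  then show ?case
    by (auto intro!: continuous_at_imp_continuous_on differentiable_imp_continuous_within)
next
  case (Suc k)
  then show ?case
    by (metis Ck_on.simps(2))
qed

lemma Ck_on_const: "open S \<Longrightarrow> Ck_on S k (\<lambda>x. c)"
proof (induction k arbitrary: c)
  case (Suc k)
  then show ?case by (intro Ck_on_Suc_I[where D="\<lambda>x h. 0"]) auto
qed simp

lemma Ck_on_add:
  assumes "open S"
  shows "Ck_on S k u \<Longrightarrow> Ck_on S k v \<Longrightarrow> Ck_on S k (\<lambda>x. u x + v x)"
proof (induction k arbitrary: u v)
  case (Suc k)
  then show ?case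
    using assms
    by (intro Ck_on_Suc_I[where D="\<lambda>x h. frechet_derivative u (at x) h + frechet_derivative v (at x) h"])
      (auto intro!: has_derivative_add Ck_on_has_derivative)
qed (simp_all add: continuous_on_add continuous_on_mult continuous_on_inner)

lemma Ck_on_mult:
  assumes "open S"
  shows "Ck_on S k u \<Longrightarrow> Ck_on S k v \<Longrightarrow> Ck_on S k (\<lambda>x. u x * v x)"
proof (induction k arbitrary: u v)
  case (Suc k)
  show ?case
  proof (rule Ck_on_Suc_I[OF assms])
    show "((\<lambda>x. u x * v x) has_derivative
        (\<lambda>h. u x * frechet_derivative v (at x) h + frechet_derivative u (at x) h * v x)) (at x)"
      if "x \<in> S" for x
      using Suc.prems that by (intro has_derivative_mult Ck_on_has_derivative)
    show "Ck_on S k (\<lambda>x. u x * frechet_derivative v (at x) b + frechet_derivative u (at x) b * v x)"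
        if "b \<in> Basis" for b
      using Suc.prems that Ck_on_lower[OF Suc.prems(1)] Ck_on_lower[OF Suc.prems(2)]
      by (intro Ck_on_add[OF assms] Suc.IH) simp_all
  qed
qed (simp_all add: continuous_on_add continuous_on_mult continuous_on_inner)

lemma Ck_on_sum:
  assumes "open S" "finite I" "\<And>i. i \<in> I \<Longrightarrow> Ck_on S k (u i)"
  shows "Ck_on S k (\<lambda>x. \<Sum>i\<in>I. u i x)"
  using assms(2,3) by (induction I) (simp_all add: Ck_on_const Ck_on_add assms(1))

lemma Ck_on_real_Suc_I:
  fixes g g' :: "real \<Rightarrow> real"
  assumes "open S" "\<And>x. x \<in> S \<Longrightarrow> (g has_real_derivative g' x) (at x)" "Ck_on S k g'"
  shows "Ck_on S (Suc k) g"
  using assms by (intro Ck_on_Suc_I[where D="\<lambda>x h. g' x * h"]) (auto simp: has_field_derivative_def)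

lemma Ck_on_real_D:
  fixes g :: "real \<Rightarrow> real"
  assumes "Ck_on S (Suc k) g"
  obtains g' where "\<And>x. x \<in> S \<Longrightarrow> (g has_real_derivative g' x) (at x)" "Ck_on S k g'"
proof
  show "Ck_on S k (\<lambda>x. frechet_derivative g (at x) 1)" using assms by simp
  fix x assume "x \<in> S"
  then have *: "(g has_derivative frechet_derivative g (at x)) (at x)"
    using assms by (rule Ck_on_has_derivative[rotated])
  have "frechet_derivative g (at x) = (\<lambda>h. h * frechet_derivative g (at x) 1)"
  proof
    show "frechet_derivative g (at x) h = h * frechet_derivative g (at x) 1" for h
      using linear_scale[OF has_derivative_linear[OF *], of h 1] by simp
  qed
  with * show "(g has_real_derivative frechet_derivative g (at x) 1) (at x)"
    by (simp add: has_field_derivative_def mult_commute_abs)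
qed

lemma Ck_on_compose_real:
  fixes g :: "real \<Rightarrow> real" and u :: "'a::euclidean_space \<Rightarrow> real"
  assumes "open S" "u ` S \<subseteq> T"
  shows "Ck_on T k g \<Longrightarrow> Ck_on S k u \<Longrightarrow> Ck_on S k (\<lambda>x. g (u x))"
proof (induction k arbitrary: g)
  case 0
  then show ?case using assms continuous_on_compose2[of T g S u] by simp
next
  case (Suc k)
  obtain g' where g': "\<And>x. x \<in> T \<Longrightarrow> (g has_real_derivative g' x) (at x)" "Ck_on T k g'"
    using Ck_on_real_D[OF Suc.prems(1)] by metis
  show ?case
  proof (rule Ck_on_Suc_I[OF assms(1)])
    show "((\<lambda>x. g (u x)) has_derivative (\<lambda>h. frechet_derivative u (at x) h * g' (u x))) (at x)"
        if "x \<in> S" for x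
      using that assms(2)
        by (intro DERIV_compose_FDERIV[OF g'(1) Ck_on_has_derivative[OF Suc.prems(2) that]]) auto
    show "Ck_on S k (\<lambda>x. frechet_derivative u (at x) b * g' (u x))" if "b \<in> Basis" for b
    proof (rule Ck_on_mult[OF assms(1)])
      show "Ck_on S k (\<lambda>x. frechet_derivative u (at x) b)"
        using Suc.prems(2) that by simp
      show "Ck_on S k (\<lambda>x. g' (u x))"
        by (rule Suc.IH[OF g'(2) Ck_on_lower[OF Suc.prems(2)]])
    qed
  qed
qed

lemma Ck_on_union:
  assumes "open S" "open T"
  shows "Ck_on S k u \<Longrightarrow> Ck_on T k u \<Longrightarrow> Ck_on (S \<union> T) k u"
proof (induction k arbitrary: u)
  case 0
  then show ?case using continuous_on_open_Un[OF assms] by simp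
qed auto

lemma Ck_on_subset: "Ck_on S k u \<Longrightarrow> T \<subseteq> S \<Longrightarrow> Ck_on T k u"
proof (induction k arbitrary: u)
  case 0
  then show ?case using continuous_on_subset[of S u T] by simp
qed auto

lemma Ck_on_inner: "open S \<Longrightarrow> Ck_on S k (\<lambda>x. x \<bullet> c)"
proof (cases k)
  case (Suc k')
  assume "open S"
  then show ?thesis unfolding Suc
    by (intro Ck_on_Suc_I[where D="\<lambda>x h. h \<bullet> c"] Ck_on_const) (auto intro!: derivative_eq_intros)
qed (simp_all add: continuous_on_add continuous_on_mult continuous_on_inner)

lemma Ck_on_ident: "open S \<Longrightarrow> Ck_on S k (\<lambda>x::real. x)"
  using Ck_on_inner[of S k 1] by simp

lemma Ck_on_inverse: "Ck_on {0::real<..} k inverse"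
proof (induction k)
  case 0
  then show ?case by (auto intro!: continuous_intros)
next
  case (Suc k)
  have "Ck_on {0::real<..} k (\<lambda>x. (- 1) * (inverse x * inverse x))"
    by (intro Ck_on_mult Ck_on_const Suc) auto
  then show ?case
    by (intro Ck_on_real_Suc_I[where g'="\<lambda>x. (- 1) * (inverse x * inverse x)"])
        (auto intro!: derivative_eq_intros)
qed

lemma Ck_on_ln: "Ck_on {0::real<..} k ln"
proof (cases k)
  case 0
  then show ?thesis by (auto intro!: continuous_intros)
next
  case (Suc k')
  show ?thesis unfolding Suc
    by (intro Ck_on_real_Suc_I[where g'=inverse] Ck_on_inverse)
        (auto intro!: derivative_eq_intros simp: divide_inverse)
qed

lemma Ck_on_powr: "Ck_on {0::real<..} k (\<lambda>x. x powr p)"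
proof (induction k)
  case 0
  then show ?case by (auto intro!: continuous_intros)
next
  case (Suc k)
  have "Ck_on {0::real<..} k (\<lambda>x. p * (x powr p * inverse x))"
    by (intro Ck_on_mult Ck_on_const Suc Ck_on_inverse) auto
  then show ?case
    by (intro Ck_on_real_Suc_I[where g'="\<lambda>x. p * (x powr p * inverse x)"])
      (auto intro!: derivative_eq_intros simp: powr_diff divide_inverse)
qed

lemma Ck_on_norm: "Ck_on (- {0::'a::euclidean_space}) k norm"
proof -
  have "Ck_on (- {0::'a}) k (\<lambda>x. \<Sum>b\<in>Basis. (x \<bullet> b) * (x \<bullet> b))"
    by (intro Ck_on_sum Ck_on_mult Ck_on_inner) auto
  then have *: "Ck_on (- {0::'a}) k (\<lambda>x. x \<bullet> x)"
    by (rule Ck_on_cong[rotated 2]) (auto simp: euclidean_inner[symmetric])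
  have "Ck_on (- {0::'a}) k (\<lambda>x. (x \<bullet> x) powr (1/2))"
    by (rule Ck_on_compose_real[OF _ _ Ck_on_powr *]) auto
  then show ?thesis
    by (rule Ck_on_cong[rotated 2]) (auto simp: powr_half_sqrt norm_eq_sqrt_inner)
qed

text \<open>The derivative along a ray is a fixed linear combination of the partial derivatives
  along the same ray, so the induction hypothesis applies to each of them. This provides smoothness
  of the radial profile of a test function.\<close>

lemma Ck_on_line:
  fixes u :: "'a::euclidean_space \<Rightarrow> real"
  shows "Ck_on UNIV k u \<Longrightarrow> Ck_on UNIV k (\<lambda>r::real. u (r *\<^sub>R w))"
proof (induction k arbitrary: u)
  case 0
  then show ?case
    using continuous_on_compose2[of UNIV u UNIV "\<lambda>r::real. r *\<^sub>R w"] by (simp add: continuous_intros)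
next
  case (Suc k)
  show ?case
  proof (rule Ck_on_real_Suc_I)
    fix r :: real
    have u': "(u has_derivative frechet_derivative u (at (r *\<^sub>R w))) (at (r *\<^sub>R w))"
      using Suc.prems by (intro Ck_on_has_derivative) auto
    have "((\<lambda>r. u (r *\<^sub>R w)) has_derivative (\<lambda>h. frechet_derivative u (at (r *\<^sub>R w)) (h *\<^sub>R w))) (at r)"
      by (rule has_derivative_compose[of "\<lambda>r. r *\<^sub>R w" "\<lambda>h. h *\<^sub>R w" r UNIV u, OF _ u'])
          (auto intro!: derivative_eq_intros)
    moreover have "frechet_derivative u (at (r *\<^sub>R w)) (h *\<^sub>R w) =
       (\<Sum>b\<in>Basis. (w \<bullet> b) * frechet_derivative u (at (r *\<^sub>R w)) b) * h" for h
    proof -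
      interpret bounded_linear "frechet_derivative u (at (r *\<^sub>R w))"
        by (rule has_derivative_bounded_linear[OF u'])
      have "frechet_derivative u (at (r *\<^sub>R w)) w =
          frechet_derivative u (at (r *\<^sub>R w)) (\<Sum>b\<in>Basis. (w \<bullet> b) *\<^sub>R b)"
        by (simp add: euclidean_representation)
      then show ?thesis by (simp add: sum scaleR mult.commute)
    qed
    ultimately show "((\<lambda>r. u (r *\<^sub>R w)) has_real_derivative
        (\<Sum>b\<in>Basis. (w \<bullet> b) * frechet_derivative u (at (r *\<^sub>R w)) b)) (at r)"
      by (simp add: has_field_derivative_def)
  next
    show "Ck_on UNIV k (\<lambda>r. \<Sum>b\<in>Basis. (w \<bullet> b) * frechet_derivative u (at (r *\<^sub>R w)) b)"
      using Suc.prems by (intro Ck_on_sum Ck_on_mult Ck_on_const Suc.IH) auto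
  qed simp
qed

text \<open>The polynomial parameter makes the family closed under differentiation: every derivative of $\exp(-1/x)$ has the form $P(1/x)\exp(-1/x)$ with a polynomial $P$.\<close>

definition flat_exp :: "real poly \<Rightarrow> real \<Rightarrow> real" where
  "flat_exp P x = (if x \<le> 0 then 0 else poly P (inverse x) * exp (- inverse x))"

lemma flat_exp_tendsto:
  fixes P :: "real poly"
  shows "((\<lambda>x. poly P (inverse x) * exp (- inverse x)) \<longlongrightarrow> 0) (at_right 0)"
proof -
  have "((\<lambda>y. \<Sum>i\<le>degree P. coeff P i * (y ^ i / exp y)) \<longlongrightarrow> (\<Sum>i\<le>degree P. coeff P i * 0)) at_top"
    by (intro tendsto_sum tendsto_mult tendsto_const) (rule tendsto_power_div_exp_0)
  then have "((\<lambda>y. poly P y * exp (- y)) \<longlongrightarrow> 0) at_top"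
    by (simp add: poly_altdef sum_distrib_right exp_minus divide_inverse mult.assoc)
  then show ?thesis
    by (rule filterlim_compose[OF _ filterlim_inverse_at_top_right])
qed

text \<open>For x > 0 differentiation gives the polynomial X^2 (P - P') evaluated at 1/x. At 0 the
  difference quotient from the right is the same kind of function with polynomial X P, which tends
  to 0.\<close>

lemma DERIV_flat_exp:
  "(flat_exp P has_real_derivative flat_exp ([:0, 0, 1:] * (P - pderiv P)) x) (at x)"
proof -
  consider "x > 0" | "x < 0" | "x = 0" by linarith
  then show ?thesis
  proof cases
    case 1
    have "((\<lambda>x. poly P (inverse x) * exp (- inverse x)) has_real_derivative
        flat_exp ([:0, 0, 1:] * (P - pderiv P)) x) (at x)"
      using 1 by (auto intro!: derivative_eq_intros simp: flat_exp_def algebra_simps power2_eq_square)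
    then show ?thesis
      by (rule has_field_derivative_transform_within_open[where S="{0<..}"])
          (use 1 in \<open>auto simp: flat_exp_def\<close>)
  next
    case 2
    have "((\<lambda>x. 0) has_real_derivative flat_exp ([:0, 0, 1:] * (P - pderiv P)) x) (at x)"
      using 2 by (auto simp: flat_exp_def)
    then show ?thesis
      by (rule has_field_derivative_transform_within_open[where S="{..<0}"])
          (use 2 in \<open>auto simp: flat_exp_def\<close>)
  next
    case 3
    have "((\<lambda>h. poly ([:0, 1:] * P) (inverse h) * exp (- inverse h)) \<longlongrightarrow> 0) (at_right 0)"
      by (rule flat_exp_tendsto)
    then have "((\<lambda>h. flat_exp P h / h) \<longlongrightarrow> 0) (at_right 0)"
      by (rule Lim_transform_eventually) (auto simp: eventually_at_filter flat_exp_def divide_inverse)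
    moreover have "((\<lambda>h. flat_exp P h / h) \<longlongrightarrow> 0) (at_left 0)"
      by (rule tendsto_eventually) (auto simp: eventually_at_filter flat_exp_def)
    ultimately have "((\<lambda>h. flat_exp P h / h) \<longlongrightarrow> 0) (at 0)"
      by (rule filterlim_split_at[rotated])
    then show ?thesis using 3 by (simp add: DERIV_def flat_exp_def)
  qed
qed

lemma Ck_on_flat_exp: "Ck_on UNIV k (flat_exp P)"
proof (induction k arbitrary: P)
  case 0
  then show ?case
    by (auto intro!: continuous_at_imp_continuous_on DERIV_isCont DERIV_flat_exp)
next
  case (Suc k)
  show ?case by (rule Ck_on_real_Suc_I[OF _ DERIV_flat_exp Suc]) simp
qed

section \<open>A smooth step from 0 to 1\<close>

definition smooth_step :: "real \<Rightarrow> real" where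
  "smooth_step x = flat_exp 1 x / (flat_exp 1 x + flat_exp 1 (1 - x))"

lemma flat_exp_nonneg: "flat_exp 1 x \<ge> 0" "flat_exp 1 x > 0 \<longleftrightarrow> x > 0"
  by (auto simp: flat_exp_def)

text \<open>At least one of x and 1 - x is positive.\<close>

lemma smooth_step_denom: "flat_exp 1 x + flat_exp 1 (1 - x) > 0"
  using flat_exp_nonneg[of x] flat_exp_nonneg[of "1 - x"]
  by (cases "x > 0") (auto intro: add_pos_nonneg add_nonneg_pos)

lemma smooth_step_0: "x \<le> 0 \<Longrightarrow> smooth_step x = 0"
  and smooth_step_1: "x \<ge> 1 \<Longrightarrow> smooth_step x = 1"
  using smooth_step_denom[of x] by (auto simp: smooth_step_def flat_exp_def)

lemma smooth_step_pos: "x > 0 \<Longrightarrow> smooth_step x > 0"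
  using smooth_step_denom[of x] flat_exp_nonneg[of x] by (simp add: smooth_step_def)

lemma smooth_step_bounds: "0 \<le> smooth_step x" "smooth_step x \<le> 1"
  using smooth_step_denom[of x] flat_exp_nonneg[of x] flat_exp_nonneg[of "1 - x"]
    by (auto simp: smooth_step_def)

lemma Ck_on_smooth_step: "Ck_on UNIV k smooth_step"
proof -
  have 1: "Ck_on UNIV k (\<lambda>x. flat_exp 1 (1 + (-1) * x))"
    by (intro Ck_on_compose_real[OF _ _ Ck_on_flat_exp] Ck_on_add Ck_on_mult Ck_on_const Ck_on_ident) auto
  have "Ck_on UNIV k (\<lambda>x. flat_exp 1 x * inverse (flat_exp 1 x + flat_exp 1 (1 + (-1) * x)))"
    using smooth_step_denom
    by (intro Ck_on_mult Ck_on_flat_exp Ck_on_compose_real[OF _ _ Ck_on_inverse] Ck_on_add 1) auto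
  then show ?thesis
    by (rule Ck_on_cong[rotated 2]) (auto simp: smooth_step_def divide_inverse)
qed

section \<open>Test functions as C^1 data, and convergence of norms\<close>

lemma Cc_infinity_C1c:
  fixes u :: "'a::euclidean_space \<Rightarrow> real"
  assumes "u \<in> Cc_infinity"
  shows "C1c u (grad u)"
  unfolding C1c_def
proof (intro conjI allI)
  have "C_k (Suc 0) u" using assms unfolding Cc_infinity_def by blast
  then have diff: "u differentiable (at x)" and cont: "b \<in> Basis \<Longrightarrow>
      continuous_on UNIV (\<lambda>x. frechet_derivative u (at x) b)" for x b
    by auto
  show "(u has_derivative (\<lambda>h. grad u x \<bullet> h)) (at x)" for x
  proof -
    have d: "(u has_derivative frechet_derivative u (at x)) (at x)"
      using diff by (simp flip: frechet_derivative_works)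
    interpret bounded_linear "frechet_derivative u (at x)" by (rule has_derivative_bounded_linear[OF d])
    have "frechet_derivative u (at x) h = grad u x \<bullet> h" for h
    proof -
      have "frechet_derivative u (at x) h = frechet_derivative u (at x) (\<Sum>b\<in>Basis. (h \<bullet> b) *\<^sub>R b)"
        by (simp add: euclidean_representation)
      then show ?thesis
        by (simp add: grad_def inner_sum_right sum scaleR inner_commute mult.commute)
    qed
    then have "frechet_derivative u (at x) = (\<lambda>h. grad u x \<bullet> h)" by (rule ext)
    with d show ?thesis by simp
  qed
  show "continuous_on UNIV (grad u)"
    unfolding grad_def[abs_def] by (intro continuous_intros cont)
  have "bounded (closure {x. u x \<noteq> 0})"
    using assms by (auto simp: Cc_infinity_def intro: compact_imp_bounded)
  then obtain M where M: "\<forall>x\<in>closure {x. u x \<noteq> 0}. norm x \<le> M"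
    by (auto simp: bounded_iff)
  show "\<exists>M. \<forall>x. M < norm x \<longrightarrow> u x = 0"
  proof (intro exI allI impI)
    fix x :: 'a assume "M < norm x"
    then show "u x = 0" using M closure_subset[of "{x. u x \<noteq> 0}"] by force
  qed
qed

text \<open>Young's inequality bounds the difference of the squared norms pointwise by (1 +
  1/\<eta>) |v - w|^2 + \<eta> |w|^2. The statement is general in measure and codomain because it
  serves for gradients, for traces and for the mass.\<close>

lemma L2_norm_convergence:
  fixes v :: "nat \<Rightarrow> 'b \<Rightarrow> 'c::{second_countable_topology, real_normed_vector}"
  assumes [measurable]: "\<And>k. v k \<in> borel_measurable M" "w \<in> borel_measurable M"
    and int: "\<And>k. integrable M (\<lambda>x. (norm (v k x))\<^sup>2)"
    and lim: "(\<lambda>k. \<integral>\<^sup>+x. ennreal ((norm (v k x - w x))\<^sup>2) \<partial>M) \<longlonglongrightarrow> 0"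
  shows "integrable M (\<lambda>x. (norm (w x))\<^sup>2)"
    and "(\<lambda>k. LINT x|M. (norm (v k x))\<^sup>2) \<longlonglongrightarrow> (LINT x|M. (norm (w x))\<^sup>2)"
proof -
  define d where "d k x = (norm (v k x - w x))\<^sup>2" for k x
  have [measurable]: "d k \<in> borel_measurable M" for k unfolding d_def[abs_def] by measurable
  have d0: "d k x \<ge> 0" for k x by (simp add: d_def)
  have fin: "\<forall>\<^sub>F k in sequentially. integrable M (d k)"
  proof -
    have "\<forall>\<^sub>F k in sequentially. (\<integral>\<^sup>+x. ennreal (d k x) \<partial>M) < 1"
      using order_tendstoD(2)[OF lim, of 1] by (simp add: d_def)
    then show ?thesis
    proof eventually_elim
      case (elim k)
      then have "(\<integral>\<^sup>+x. ennreal (d k x) \<partial>M) < \<infinity>"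
        by (rule order.strict_trans) simp
      then show ?case using d0 by (intro integrableI_nonneg) auto
    qed
  qed
  have lim_d: "(\<lambda>k. LINT x|M. d k x) \<longlonglongrightarrow> 0"
  proof -
    have "(\<lambda>k. enn2real (\<integral>\<^sup>+x. ennreal (d k x) \<partial>M)) \<longlonglongrightarrow> enn2real 0"
      using lim unfolding d_def by (intro tendsto_enn2real) auto
    then show ?thesis by (simp add: integral_eq_nn_integral d0)
  qed
  from fin obtain k0 where k0: "integrable M (d k0)" by (auto simp: eventually_sequentially)
  have w_le: "(norm (w x))\<^sup>2 \<le> 2 * (norm (v k0 x))\<^sup>2 + 2 * d k0 x" for x
  proof -
    have "norm (w x) \<le> norm (v k0 x) + norm (v k0 x - w x)"
      using norm_triangle_ineq4[of "v k0 x" "v k0 x - w x"] by simp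
    then have "(norm (w x))\<^sup>2 \<le> (norm (v k0 x) + norm (v k0 x - w x))\<^sup>2"
      by (intro power_mono) auto
    also have "\<dots> \<le> 2 * (norm (v k0 x))\<^sup>2 + 2 * d k0 x"
      using sum_squares_bound[of "norm (v k0 x)" "norm (v k0 x - w x)"] unfolding power2_sum d_def by linarith
    finally show ?thesis .
  qed
  have "integrable M (\<lambda>x. 2 * (norm (v k0 x))\<^sup>2 + 2 * d k0 x)"
    by (intro Bochner_Integration.integrable_add integrable_mult_right int k0)
  then show int_w: "integrable M (\<lambda>x. (norm (w x))\<^sup>2)"
    by (rule Bochner_Integration.integrable_bound) (use w_le in \<open>auto intro!: AE_I2 order_trans[OF w_le]\<close>)
  define W where "W = (LINT x|M. (norm (w x))\<^sup>2)"
  have W: "W \<ge> 0" by (simp add: W_def)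
  show "(\<lambda>k. LINT x|M. (norm (v k x))\<^sup>2) \<longlonglongrightarrow> (LINT x|M. (norm (w x))\<^sup>2)"
  proof (rule tendstoI)
    fix e :: real assume e: "e > 0"
    \<comment> \<open>\<eta> makes \<eta> W at most e/2; adding 1 to W covers the case W =
      0.\<close>
    define \<eta> where "\<eta> = e / (2 * (W + 1))"
    have \<eta>: "\<eta> > 0" using e W by (simp add: \<eta>_def)
    have \<eta>W: "\<eta> * W \<le> e / 2"
    proof -
      have "\<eta> * W \<le> \<eta> * (W + 1)" using \<eta> by simp
      also have "\<dots> = e / 2" using W by (simp add: \<eta>_def field_simps)
      finally show ?thesis .
    qed
    have "(\<lambda>k. (1 + 1 / \<eta>) * (LINT x|M. d k x)) \<longlonglongrightarrow> (1 + 1 / \<eta>) * 0"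
      by (intro tendsto_intros lim_d)
    then have "\<forall>\<^sub>F k in sequentially. (1 + 1 / \<eta>) * (LINT x|M. d k x) < e / 2"
      using e by (intro order_tendstoD(2)) auto
    with fin show "\<forall>\<^sub>F k in sequentially. dist (LINT x|M. (norm (v k x))\<^sup>2) (LINT x|M. (norm (w x))\<^sup>2) < e"
    proof eventually_elim
      case (elim k)
      have pw: "\<bar>(norm (v k x))\<^sup>2 - (norm (w x))\<^sup>2\<bar> \<le> (1 + 1 / \<eta>) * d k x + \<eta> * (norm (w x))\<^sup>2" for x
      proof -
        define s D b where "s = norm (v k x) - norm (w x)" and "D = norm (v k x - w x)" and "b = norm (w x)"
        have s: "\<bar>s\<bar> \<le> D" unfolding s_def D_def by (rule norm_triangle_ineq3)
        have b: "b \<ge> 0" by (simp add: b_def)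
        have eq: "(norm (v k x))\<^sup>2 - (norm (w x))\<^sup>2 = 2 * b * s + s\<^sup>2"
          unfolding s_def b_def by (simp add: power2_eq_square algebra_simps)
        have "\<bar>(norm (v k x))\<^sup>2 - (norm (w x))\<^sup>2\<bar> \<le> \<bar>2 * b * s\<bar> + \<bar>s\<^sup>2\<bar>"
          unfolding eq by (rule abs_triangle_ineq)
        also have "\<bar>2 * b * s\<bar> = 2 * b * \<bar>s\<bar>" using b by (simp add: abs_mult)
        also have "2 * b * \<bar>s\<bar> \<le> 2 * b * D" using b s by (intro mult_left_mono) auto
        also have "\<bar>s\<^sup>2\<bar> \<le> D\<^sup>2" using power_mono[OF s, of 2] by simp
        also have "2 * b * D \<le> \<eta> * b\<^sup>2 + D\<^sup>2 / \<eta>"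
        proof -
          have "0 \<le> (\<eta> * b - D)\<^sup>2 / \<eta>" using \<eta> by simp
          also have "\<dots> = \<eta> * b\<^sup>2 - 2 * b * D + D\<^sup>2 / \<eta>"
          proof -
            have "(\<eta> * b - D)\<^sup>2 = \<eta> * (\<eta> * b\<^sup>2 - 2 * b * D) + D\<^sup>2"
              by (simp add: power2_eq_square algebra_simps)
            then show ?thesis using \<eta> by (simp add: add_divide_distrib)
          qed
          finally show ?thesis by simp
        qed
        finally show ?thesis by (simp add: d_def D_def b_def distrib_right)
      qed
      have "dist (LINT x|M. (norm (v k x))\<^sup>2) (LINT x|M. (norm (w x))\<^sup>2) =
          \<bar>LINT x|M. (norm (v k x))\<^sup>2 - (norm (w x))\<^sup>2\<bar>"
        using int int_w by (simp add: dist_real_def)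
      also have "\<dots> \<le> (LINT x|M. \<bar>(norm (v k x))\<^sup>2 - (norm (w x))\<^sup>2\<bar>)"
        by (rule integral_abs_bound)
      also have "\<dots> \<le> (LINT x|M. (1 + 1 / \<eta>) * d k x + \<eta> * (norm (w x))\<^sup>2)"
        using int int_w elim(1) pw
        by (intro integral_mono integrable_abs Bochner_Integration.integrable_diff
            Bochner_Integration.integrable_add integrable_mult_right) auto
      also have "\<dots> = (1 + 1 / \<eta>) * (LINT x|M. d k x) + \<eta> * W"
        using int_w elim(1) by (simp add: W_def)
      also have "\<dots> < e" using elim(2) \<eta>W by linarith
      finally show ?case .
    qed
  qed
qed

section \<open>The exterior variational problem\<close>

text \<open>Gradient and trace are separate arguments, since an element of the completion carries
  them as separate data; for a test function the trace is the function itself.\<close>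

definition ext_energy :: "('a::euclidean_space \<Rightarrow> 'a) \<Rightarrow> ('a \<Rightarrow> real) \<Rightarrow> real" where
  "ext_energy G T = (LINT x:ext_domain|lborel. (norm (G x))\<^sup>2)
     - (real DIM('a) - 2) / 2 * (LINT y|sphere_measure. (T y)\<^sup>2)"

definition ext_mass :: "('a::euclidean_space \<Rightarrow> real) \<Rightarrow> ('a \<Rightarrow> real) \<Rightarrow> real" where
  "ext_mass f u = (LINT x:ext_domain|lborel. f x * (u x)\<^sup>2)"

lemma epsilon0_eq: "epsilon0 f = Inf {ereal (ext_energy G T / ext_mass f u) | u G T.
   (u, G) \<in> H1_ext \<and> has_trace (u, G) T \<and> ext_mass f u > 0}"
  unfolding epsilon0_def ext_energy_def ext_mass_def ..

lemma ext_domain_iff: "x \<in> ext_domain \<longleftrightarrow> norm x \<ge> 1"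
  by (auto simp: ext_domain_def)

lemma sets_ext_domain [simp]: "ext_domain \<in> sets borel"
  by (simp add: ext_domain_def)

lemma C1c_sphere:
  assumes "C1c u G"
  shows "u \<in> borel_measurable sphere_measure" "integrable sphere_measure (\<lambda>y. (u y)\<^sup>2)"
proof -
  interpret finite_measure "sphere_measure :: 'a measure" by (rule finite_measure_sphere_measure)
  show 1: "u \<in> borel_measurable sphere_measure"
    by (intro measurable_sphere_measure C1c_measurable[OF assms])
  obtain B where B: "\<And>x. \<bar>u x\<bar> \<le> B" using C1c_bound[OF assms] by metis
  have "(u y)\<^sup>2 \<le> B\<^sup>2" for y
    using B[of y] power_mono[of "\<bar>u y\<bar>" B 2] by simp
  then show "integrable sphere_measure (\<lambda>y. (u y)\<^sup>2)"
    using 1 by (intro integrable_const_bound[of _ "B\<^sup>2"] AE_I2) auto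
qed

locale exterior_potential =
  fixes f :: "'a::euclidean_space \<Rightarrow> real" and K \<sigma> :: real
  assumes dim: "DIM('a) \<ge> 3"
    and f_continuous: "continuous_on {x. norm x \<ge> 1} f"
    and f_nonneg: "\<And>x. norm x \<ge> 1 \<Longrightarrow> f x \<ge> 0"
    and f_radial: "\<And>x y. norm x \<ge> 1 \<Longrightarrow> norm x = norm y \<Longrightarrow> f x = f y"
    and \<sigma>: "\<sigma> > 0" and K: "K > 0"
    and f_decay: "\<And>x. norm x \<ge> 1 \<Longrightarrow> f x \<le> K * norm x powr (- 2 - \<sigma>)"
begin

section \<open>Exterior mass and energy, and reduction to test functions\<close>

lemma f_measurable: "(\<lambda>x. indicator ext_domain x * f x) \<in> borel_measurable borel"
proof -
  have "ext_domain = {x::'a. norm x \<ge> 1}" by (auto simp: ext_domain_iff)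
  then show ?thesis
    using borel_measurable_continuous_on_indicator[of ext_domain f] f_continuous by simp
qed

lemma f_le: "norm x \<ge> 1 \<Longrightarrow> f x \<le> K / (norm x)\<^sup>2"
proof -
  assume x: "norm x \<ge> 1"
  have "norm x powr (- 2 - \<sigma>) \<le> norm x powr (- 2)"
    using x \<sigma> by (intro powr_mono) auto
  also have "norm x powr (- 2) = 1 / (norm x)\<^sup>2"
    using x by (simp add: powr_minus inverse_eq_divide)
  finally have "K * norm x powr (- 2 - \<sigma>) \<le> K * (1 / (norm x)\<^sup>2)"
    using K by (intro mult_left_mono) auto
  then show ?thesis using f_decay[OF x] by simp
qed

lemma mass_density_le: "0 \<le> indicator ext_domain x * f x * (u x)\<^sup>2"
  "indicator ext_domain x * f x * (u x)\<^sup>2 \<le> K * (indicator ext_domain x * (u x / norm x)\<^sup>2)"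
proof -
  have "0 \<le> f x * (u x)\<^sup>2 \<and> f x * (u x)\<^sup>2 \<le> K * (u x / norm x)\<^sup>2" if "norm x \<ge> 1"
    using mult_right_mono[OF f_le[OF that], of "(u x)\<^sup>2"] f_nonneg[OF that] by (simp add: power_divide)
  then show "0 \<le> indicator ext_domain x * f x * (u x)\<^sup>2"
    "indicator ext_domain x * f x * (u x)\<^sup>2 \<le> K * (indicator ext_domain x * (u x / norm x)\<^sup>2)"
    by (auto simp: ext_domain_iff split: split_indicator)
qed

lemma integrable_mass:
  assumes u: "C1c u G"
  shows "integrable lborel (\<lambda>x. indicator ext_domain x * f x * (u x)\<^sup>2)"
proof (rule Bochner_Integration.integrable_bound)
  have "integrable lborel (\<lambda>x. indicator ext_domain x *\<^sub>R (u x / norm x)\<^sup>2)"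
    using integrable_hardy[OF dim u] by (intro integrable_mult_indicator) auto
  then show "integrable lborel (\<lambda>x. K * (indicator ext_domain x * (u x / norm x)\<^sup>2))"
    by (intro integrable_mult_right) simp
  note [measurable] = f_measurable C1c_measurable[OF u]
  show "(\<lambda>x. indicator ext_domain x * f x * (u x)\<^sup>2) \<in> borel_measurable lborel" by measurable
  show "AE x in lborel. norm (indicator ext_domain x * f x * (u x)\<^sup>2) \<le>
      norm (K * (indicator ext_domain x * (u x / norm x)\<^sup>2))"
  proof (rule AE_I2)
    fix x
    show "norm (indicator ext_domain x * f x * (u x)\<^sup>2) \<le>
        norm (K * (indicator ext_domain x * (u x / norm x)\<^sup>2))"
      using mass_density_le(2)[of x u] abs_ge_self[of "K * (indicator ext_domain x * (u x / norm x)\<^sup>2)"]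
      unfolding real_norm_def abs_of_nonneg[OF mass_density_le(1)] by (rule order_trans)
  qed
qed

lemma ext_mass_eq: "ext_mass f u = (LINT x|lborel. indicator ext_domain x * f x * (u x)\<^sup>2)"
  by (simp add: ext_mass_def set_lebesgue_integral_def mult.assoc)

lemma ext_mass_nonneg: "ext_mass f u \<ge> 0"
  unfolding ext_mass_eq by (intro Bochner_Integration.integral_nonneg mass_density_le)

lemma ext_energy_eq:
  fixes u :: "'a \<Rightarrow> real"
  assumes "C1c u G"
  shows "ext_energy G u = (LINT x:ext_domain|lborel. (norm (pgrad u G x))\<^sup>2)
    + ((real DIM('a) - 2) / 2)\<^sup>2 * (LINT x:ext_domain|lborel. (u x / norm x)\<^sup>2)"
  unfolding ext_energy_def by (rule hardy_ext[OF dim assms])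

lemma ext_integral_nonneg: "(LINT x:ext_domain|lborel. (h x :: real)\<^sup>2) \<ge> 0"
  unfolding set_lebesgue_integral_def by (intro Bochner_Integration.integral_nonneg) simp

text \<open>The decay of f bounds it by K/|x|^2, and the energy contains ((N-2)/2)^2 times the
  exterior Hardy integral. The quotient of these two constants becomes the explicit lower bound for
  \<open>epsilon0\<close>.\<close>

lemma ext_energy_ge:
  assumes u: "C1c u G"
  shows "ext_energy G u \<ge> ((real DIM('a) - 2) / 2)\<^sup>2 / K * ext_mass f u"
proof -
  let ?a2 = "((real DIM('a) - 2) / 2)\<^sup>2"
  have i: "integrable lborel (\<lambda>x. indicator ext_domain x *\<^sub>R (u x / norm x)\<^sup>2)"
    using integrable_hardy[OF dim u] by (intro integrable_mult_indicator) auto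
  have "ext_mass f u \<le> (LINT x|lborel. K * (indicator ext_domain x *\<^sub>R (u x / norm x)\<^sup>2))"
    unfolding ext_mass_eq using mass_density_le(2)[of _ u]
    by (intro integral_mono integrable_mass[OF u] integrable_mult_right i) simp
  also have "\<dots> = K * (LINT x:ext_domain|lborel. (u x / norm x)\<^sup>2)"
    by (simp add: set_lebesgue_integral_def)
  finally have "?a2 / K * ext_mass f u \<le> ?a2 / K * (K * (LINT x:ext_domain|lborel. (u x / norm x)\<^sup>2))"
    using K by (intro mult_left_mono) auto
  also have "\<dots> = ?a2 * (LINT x:ext_domain|lborel. (u x / norm x)\<^sup>2)" using K by simp
  also have "\<dots> \<le> ext_energy G u"
    unfolding ext_energy_eq[OF u] using ext_integral_nonneg[of "\<lambda>x. norm (pgrad u G x)"] by simp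
  finally show ?thesis .
qed

lemma ext_energy_nonneg: "C1c (u :: 'a \<Rightarrow> real) G \<Longrightarrow> ext_energy G u \<ge> 0"
  using ext_energy_ge[of u G] ext_mass_nonneg[of u] K
  by (meson divide_nonneg_pos mult_nonneg_nonneg order_trans zero_le_power2)

lemma H1_ext_Cc_infinity:
  assumes "u \<in> Cc_infinity"
  shows "(u, grad u) \<in> H1_ext" "has_trace (u, grad u) u"
proof -
  note [measurable] = C1c_measurable[OF Cc_infinity_C1c[OF assms]]
  have approx: "H1_ext_approx (\<lambda>_. u) u (grad u)"
    using assms by (simp add: H1_ext_approx_def)
  have "set_borel_measurable lborel ext_domain u" "set_borel_measurable lborel ext_domain (grad u)"
    unfolding set_borel_measurable_def by (intro borel_measurable_scaleR borel_measurable_indicator; simp)+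
  with approx show "(u, grad u) \<in> H1_ext" by (auto simp: H1_ext_def)
  show "has_trace (u, grad u) u"
    using approx C1c_sphere(1)[OF Cc_infinity_C1c[OF assms]]
    by (auto simp: has_trace_def intro!: exI[of _ "\<lambda>_. u"])
qed

lemma epsilon0_le:
  assumes "u \<in> Cc_infinity" "ext_mass f u > 0"
  shows "epsilon0 f \<le> ereal (ext_energy (grad u) u / ext_mass f u)"
  unfolding epsilon0_eq using H1_ext_Cc_infinity[OF assms(1)] assms(2) by (intro Inf_lower) blast

text \<open>The sequence provided by \<open>has_trace\<close> converges in the norm of the
  completion and on the sphere simultaneously, so the same sequence gives convergence of energy and
  mass. The mass is controlled by the Hardy part of the norm.\<close>

lemma H1_ext_approximation:
  assumes "(u, G) \<in> H1_ext" "has_trace (u, G) T"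
  obtains \<phi> where "\<And>k::nat. \<phi> k \<in> Cc_infinity" "(\<lambda>k. ext_mass f (\<phi> k)) \<longlonglongrightarrow> ext_mass f u"
    "(\<lambda>k. ext_energy (grad (\<phi> k)) (\<phi> k)) \<longlonglongrightarrow> ext_energy G T"
proof -
  have mu: "(\<lambda>x. indicator ext_domain x *\<^sub>R u x) \<in> borel_measurable lborel"
    and mG: "(\<lambda>x. indicator ext_domain x *\<^sub>R G x) \<in> borel_measurable lborel"
    using assms(1) by (auto simp: H1_ext_def set_borel_measurable_def)
  from assms(2) obtain \<phi> where T: "T \<in> borel_measurable sphere_measure" and \<phi>: "H1_ext_approx \<phi> u G"
    and limT: "(\<lambda>k. \<integral>\<^sup>+y. ennreal (\<bar>\<phi> k y - T y\<bar>\<^sup>2) \<partial>sphere_measure) \<longlonglongrightarrow> 0"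
    by (auto simp: has_trace_def)
  have Cc: "\<phi> k \<in> Cc_infinity" for k using \<phi> by (auto simp: H1_ext_approx_def)
  have limG: "(\<lambda>k. \<integral>\<^sup>+x\<in>ext_domain. ennreal ((norm (grad (\<phi> k) x - G x))\<^sup>2) \<partial>lborel) \<longlonglongrightarrow> 0"
    and limu: "(\<lambda>k. \<integral>\<^sup>+x\<in>ext_domain. ennreal (\<bar>\<phi> k x - u x\<bar>\<^sup>2 / (norm x)\<^sup>2) \<partial>lborel) \<longlonglongrightarrow> 0"
    using \<phi> by (auto simp: H1_ext_approx_def)
  note C1 = Cc_infinity_C1c[OF Cc]
  note meas = C1c_measurable[OF C1]
  let ?I = "indicator ext_domain :: 'a \<Rightarrow> real"
  have G: "(\<lambda>k. LINT x|lborel. (norm (?I x *\<^sub>R grad (\<phi> k) x))\<^sup>2) \<longlonglongrightarrow> (LINT x|lborel. (norm (?I x *\<^sub>R G x))\<^sup>2)"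
  proof (rule L2_norm_convergence(2))
    fix k
    show "(\<lambda>x. ?I x *\<^sub>R grad (\<phi> k) x) \<in> borel_measurable lborel"
      using meas(2) by (intro borel_measurable_scaleR borel_measurable_indicator; simp)
    have "integrable lborel (\<lambda>x. ?I x *\<^sub>R (norm (grad (\<phi> k) x))\<^sup>2)"
      using integrable_grad[OF dim C1] by (intro integrable_mult_indicator) auto
    moreover have "(norm (?I x *\<^sub>R grad (\<phi> k) x))\<^sup>2 = ?I x *\<^sub>R (norm (grad (\<phi> k) x))\<^sup>2" for x
      by (auto split: split_indicator)
    ultimately show "integrable lborel (\<lambda>x. (norm (?I x *\<^sub>R grad (\<phi> k) x))\<^sup>2)" by simp
  next
    have "(\<integral>\<^sup>+x. ennreal ((norm (?I x *\<^sub>R grad (\<phi> k) x - ?I x *\<^sub>R G x))\<^sup>2) \<partial>lborel) =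
      (\<integral>\<^sup>+x\<in>ext_domain. ennreal ((norm (grad (\<phi> k) x - G x))\<^sup>2) \<partial>lborel)" for k
      by (intro nn_integral_cong) (auto split: split_indicator)
    with limG show "(\<lambda>k. \<integral>\<^sup>+x. ennreal ((norm (?I x *\<^sub>R grad (\<phi> k) x - ?I x *\<^sub>R G x))\<^sup>2) \<partial>lborel) \<longlonglongrightarrow> 0"
      by simp
  qed (rule mG)
  have sq: "(norm (?I x *\<^sub>R h x))\<^sup>2 = ?I x *\<^sub>R (norm (h x))\<^sup>2" for h :: "'a \<Rightarrow> 'a" and x
    by (auto split: split_indicator)
  have T': "(\<lambda>k. LINT y|sphere_measure. (norm (\<phi> k y))\<^sup>2) \<longlonglongrightarrow> (LINT y|sphere_measure. (norm (T y))\<^sup>2)"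
  proof (rule L2_norm_convergence(2))
    show "\<phi> k \<in> borel_measurable sphere_measure" for k by (rule C1c_sphere(1)[OF C1])
    show "integrable sphere_measure (\<lambda>x. (norm (\<phi> k x))\<^sup>2)" for k using C1c_sphere(2)[OF C1] by simp
    show "(\<lambda>k. \<integral>\<^sup>+x. ennreal ((norm (\<phi> k x - T x))\<^sup>2) \<partial>sphere_measure) \<longlonglongrightarrow> 0"
      using limT by simp
  qed (rule T)
  have energy: "(\<lambda>k. ext_energy (grad (\<phi> k)) (\<phi> k)) \<longlonglongrightarrow> ext_energy G T"
    unfolding ext_energy_def set_lebesgue_integral_def
    using G[unfolded sq] T' by (intro tendsto_intros) simp_all
  \<comment> \<open>With the square root of f as a factor the mass becomes a squared L^2 norm, to
    which \<open>L2_norm_convergence\<close> applies.\<close>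
  define s where "s x = sqrt (?I x * f x)" for x
  have s0: "?I x * f x \<ge> 0" for x using f_nonneg by (auto simp: ext_domain_iff split: split_indicator)
  have s_meas: "s \<in> borel_measurable lborel"
    unfolding s_def[abs_def] using f_measurable by simp
  \<comment> \<open>s vanishes inside the ball, so the values of u there, for which no measurability
    is assumed, do not enter.\<close>
  have s_ind: "s x * (?I x *\<^sub>R h) = s x * h" for x h
    by (auto simp: s_def split: split_indicator)
  have s_sq: "(norm (s x * h))\<^sup>2 = ?I x * f x * h\<^sup>2" for x h
    using s0[of x] by (simp add: s_def power_mult_distrib)
  have "(\<lambda>k. LINT x|lborel. (norm (s x * \<phi> k x))\<^sup>2) \<longlonglongrightarrow> (LINT x|lborel. (norm (s x * u x))\<^sup>2)"
  proof (rule L2_norm_convergence(2))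
    show "(\<lambda>x. s x * \<phi> k x) \<in> borel_measurable lborel" for k
      using s_meas meas(1)[of k] by (intro borel_measurable_times) auto
    have "(\<lambda>x. s x * (?I x *\<^sub>R u x)) \<in> borel_measurable lborel"
      using s_meas mu by (intro borel_measurable_times) auto
    then show "(\<lambda>x. s x * u x) \<in> borel_measurable lborel" unfolding s_ind .
    show "integrable lborel (\<lambda>x. (norm (s x * \<phi> k x))\<^sup>2)" for k
      unfolding s_sq by (rule integrable_mass[OF C1])
    have le: "(\<integral>\<^sup>+x. ennreal ((norm (s x * \<phi> k x - s x * u x))\<^sup>2) \<partial>lborel) \<le>
      ennreal K * (\<integral>\<^sup>+x\<in>ext_domain. ennreal (\<bar>\<phi> k x - u x\<bar>\<^sup>2 / (norm x)\<^sup>2) \<partial>lborel)" for k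
    proof -
      have m: "(\<lambda>x. ennreal (\<bar>\<phi> k x - u x\<bar>\<^sup>2 / (norm x)\<^sup>2) * indicator ext_domain x)
          \<in> borel_measurable lborel"
      proof -
        define v p where "v x = ?I x * u x" and "p x = ?I x * \<phi> k x" for x
        have [measurable]: "v \<in> borel_measurable lborel"
          using mu by (simp add: v_def[abs_def])
        have [measurable]: "p \<in> borel_measurable lborel"
          unfolding p_def[abs_def] using meas(1)[of k]
          by (intro borel_measurable_times borel_measurable_indicator) auto
        have "(\<lambda>x. ennreal (\<bar>p x - v x\<bar>\<^sup>2 / (norm x)\<^sup>2)) \<in> borel_measurable lborel"
          by measurable
        then have "(\<lambda>x. ennreal (\<bar>?I x * \<phi> k x - ?I x * u x\<bar>\<^sup>2 / (norm x)\<^sup>2)) \<in> borel_measurable lborel"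
          by (simp only: v_def p_def)
        also have "(\<lambda>x. ennreal (\<bar>?I x * \<phi> k x - ?I x * u x\<bar>\<^sup>2 / (norm x)\<^sup>2)) =
            (\<lambda>x. ennreal (\<bar>\<phi> k x - u x\<bar>\<^sup>2 / (norm x)\<^sup>2) * indicator ext_domain x)"
          by (auto split: split_indicator)
        finally show ?thesis .
      qed
      have "(\<integral>\<^sup>+x. ennreal ((norm (s x * \<phi> k x - s x * u x))\<^sup>2) \<partial>lborel) \<le>
        (\<integral>\<^sup>+x. ennreal K * (ennreal (\<bar>\<phi> k x - u x\<bar>\<^sup>2 / (norm x)\<^sup>2) * indicator ext_domain x) \<partial>lborel)"
      proof (intro nn_integral_mono)
        fix x
        have "(norm (s x * \<phi> k x - s x * u x))\<^sup>2 = ?I x * f x * (\<phi> k x - u x)\<^sup>2"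
          by (simp only: s_sq flip: right_diff_distrib)
        also have "\<dots> \<le> K * (?I x * ((\<phi> k x - u x) / norm x)\<^sup>2)"
          by (rule mass_density_le(2))
        finally have "ennreal ((norm (s x * \<phi> k x - s x * u x))\<^sup>2) \<le>
            ennreal (K * (?I x * ((\<phi> k x - u x) / norm x)\<^sup>2))"
          by (rule ennreal_leI)
        also have "\<dots> = ennreal K * (ennreal (\<bar>\<phi> k x - u x\<bar>\<^sup>2 / (norm x)\<^sup>2) * indicator ext_domain x)"
          using K by (cases "x \<in> ext_domain") (simp_all add: power_divide flip: ennreal_mult')
        finally show "ennreal ((norm (s x * \<phi> k x - s x * u x))\<^sup>2) \<le>
            ennreal K * (ennreal (\<bar>\<phi> k x - u x\<bar>\<^sup>2 / (norm x)\<^sup>2) * indicator ext_domain x)" .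
      qed
      then show ?thesis unfolding nn_integral_cmult[OF m] .
    qed
    have "(\<lambda>k. ennreal K * (\<integral>\<^sup>+x\<in>ext_domain. ennreal (\<bar>\<phi> k x - u x\<bar>\<^sup>2 / (norm x)\<^sup>2) \<partial>lborel)) \<longlonglongrightarrow> ennreal K * 0"
      by (intro ennreal_tendsto_cmult limu) simp
    then have "(\<lambda>k. ennreal K * (\<integral>\<^sup>+x\<in>ext_domain. ennreal (\<bar>\<phi> k x - u x\<bar>\<^sup>2 / (norm x)\<^sup>2) \<partial>lborel)) \<longlonglongrightarrow> 0"
      by simp
    then show "(\<lambda>k. \<integral>\<^sup>+x. ennreal ((norm (s x * \<phi> k x - s x * u x))\<^sup>2) \<partial>lborel) \<longlonglongrightarrow> 0"
      by (rule tendsto_sandwich[OF _ _ tendsto_const, rotated 2]) (intro always_eventually allI le zero_le)+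
  qed
  then have "(\<lambda>k. ext_mass f (\<phi> k)) \<longlonglongrightarrow> ext_mass f u"
    unfolding s_sq ext_mass_eq .
  with energy Cc show ?thesis using that by blast
qed

text \<open>Positive mass and a quotient strictly below t are open conditions, so they pass from an
  admissible element of the completion to a late member of its approximating sequence.\<close>

lemma epsilon0_less_D:
  assumes "epsilon0 f < ereal t"
  obtains \<phi> where "\<phi> \<in> Cc_infinity" "ext_mass f \<phi> > 0" "ext_energy (grad \<phi>) \<phi> < t * ext_mass f \<phi>"
proof -
  from assms obtain u G T where u: "(u, G) \<in> H1_ext" "has_trace (u, G) T" "ext_mass f u > 0"
    "ext_energy G T / ext_mass f u < t"
    unfolding epsilon0_eq Inf_less_iff by auto
  obtain \<phi> where \<phi>: "\<And>k::nat. \<phi> k \<in> Cc_infinity" "(\<lambda>k. ext_mass f (\<phi> k)) \<longlonglongrightarrow> ext_mass f u"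
    "(\<lambda>k. ext_energy (grad (\<phi> k)) (\<phi> k)) \<longlonglongrightarrow> ext_energy G T"
    using H1_ext_approximation[OF u(1,2)] by metis
  have "(\<lambda>k. ext_energy (grad (\<phi> k)) (\<phi> k) - t * ext_mass f (\<phi> k)) \<longlonglongrightarrow> ext_energy G T - t * ext_mass f u"
    by (intro tendsto_intros \<phi>)
  moreover have "ext_energy G T - t * ext_mass f u < 0"
    using u(3,4) by (simp add: divide_less_eq)
  ultimately have "\<forall>\<^sub>F k in sequentially. ext_energy (grad (\<phi> k)) (\<phi> k) - t * ext_mass f (\<phi> k) < 0"
    by (rule order_tendstoD(2))
  moreover have "\<forall>\<^sub>F k in sequentially. ext_mass f (\<phi> k) > 0"
    by (rule order_tendstoD(1)[OF \<phi>(2) u(3)])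
  ultimately have "\<forall>\<^sub>F k in sequentially. ext_energy (grad (\<phi> k)) (\<phi> k) -
      t * ext_mass f (\<phi> k) < 0 \<and> ext_mass f (\<phi> k) > 0"
    by (rule eventually_conj)
  then obtain k where "ext_energy (grad (\<phi> k)) (\<phi> k) - t * ext_mass f (\<phi> k) < 0" "ext_mass f (\<phi> k) > 0"
    by (auto simp: eventually_sequentially)
  then show ?thesis using that[of "\<phi> k"] \<phi>(1) by simp
qed

theorem epsilon0_pos: "epsilon0 f > 0"
proof -
  define t where "t = ((real DIM('a) - 2) / 2)\<^sup>2 / K"
  have "t > 0" using dim K by (simp add: t_def)
  have "ereal t \<le> epsilon0 f"
  proof (rule ccontr)
    assume "\<not> ereal t \<le> epsilon0 f"
    then have "epsilon0 f < ereal t" by simp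
    then obtain \<phi> where "\<phi> \<in> Cc_infinity" "ext_mass f \<phi> > 0" "ext_energy (grad \<phi>) \<phi> < t * ext_mass f \<phi>"
      by (rule epsilon0_less_D)
    then show False
      using ext_energy_ge[OF Cc_infinity_C1c, of \<phi>] by (simp add: t_def)
  qed
  then show ?thesis using \<open>t > 0\<close> by (metis ereal_less(2) less_le_trans)
qed

text \<open>The trace that the ball yields by \<open>hardy_ball\<close> cancels against the trace
  subtracted in \<open>ext_energy\<close>.\<close>

lemma hardy_sobolev_lhs:
  fixes u :: "'a \<Rightarrow> real"
  assumes u: "C1c u G"
  shows "(LINT x|lborel. (norm (G x))\<^sup>2) - (LINT x|lborel. V_pot f \<epsilon> x * (u x)\<^sup>2) =
    (LINT x:ball 0 1|lborel. (norm (pgrad u G x))\<^sup>2) + ext_energy G u - \<epsilon> * ext_mass f u"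
proof -
  let ?a = "(real DIM('a) - 2) / 2"
  let ?B = "indicator (ball 0 1) :: 'a \<Rightarrow> real" and ?E = "indicator ext_domain :: 'a \<Rightarrow> real"
  have iB: "integrable lborel (\<lambda>x. ?B x *\<^sub>R (norm (G x))\<^sup>2)"
      and iE: "integrable lborel (\<lambda>x. ?E x *\<^sub>R (norm (G x))\<^sup>2)"
    using integrable_grad[OF dim u] by (auto intro!: integrable_mult_indicator simp del: real_scaleR_def)
  have iH: "integrable lborel (\<lambda>x. ?B x *\<^sub>R (u x / norm x)\<^sup>2)"
    using integrable_hardy[OF dim u] by (auto intro!: integrable_mult_indicator simp del: real_scaleR_def)
  have "(LINT x|lborel. (norm (G x))\<^sup>2) = (LINT x|lborel. ?B x *\<^sub>R (norm (G x))\<^sup>2 + ?E x *\<^sub>R (norm (G x))\<^sup>2)"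
    by (intro Bochner_Integration.integral_cong) (auto simp: ext_domain_def split: split_indicator)
  also have "\<dots> = (LINT x:ball 0 1|lborel. (norm (G x))\<^sup>2) + (LINT x:ext_domain|lborel. (norm (G x))\<^sup>2)"
    unfolding set_lebesgue_integral_def by (rule Bochner_Integration.integral_add[OF iB iE])
  finally have 1: "(LINT x|lborel. (norm (G x))\<^sup>2) =
    (LINT x:ball 0 1|lborel. (norm (G x))\<^sup>2) + (LINT x:ext_domain|lborel. (norm (G x))\<^sup>2)" .
  have "(LINT x|lborel. V_pot f \<epsilon> x * (u x)\<^sup>2) =
    (LINT x|lborel. ?a\<^sup>2 * (?B x *\<^sub>R (u x / norm x)\<^sup>2) + \<epsilon> * (?E x * f x * (u x)\<^sup>2))"
    by (intro Bochner_Integration.integral_cong)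
        (auto simp: V_pot_def ext_domain_def power_divide split: split_indicator)
  also have "\<dots> = ?a\<^sup>2 * (LINT x:ball 0 1|lborel. (u x / norm x)\<^sup>2) + \<epsilon> * ext_mass f u"
    unfolding set_lebesgue_integral_def ext_mass_eq
    by (subst Bochner_Integration.integral_add[OF integrable_mult_right[OF iH]
        integrable_mult_right[OF integrable_mass[OF u]]]) simp
  finally have 2: "(LINT x|lborel. V_pot f \<epsilon> x * (u x)\<^sup>2) =
    ?a\<^sup>2 * (LINT x:ball 0 1|lborel. (u x / norm x)\<^sup>2) + \<epsilon> * ext_mass f u" .
  show ?thesis
    unfolding 1 2 ext_energy_def hardy_ball[OF dim u] by simp
qed

theorem hardy_sobolev_below_epsilon0:
  assumes "\<epsilon> > 0" "ereal \<epsilon> < epsilon0 f"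
  shows "\<exists>c>0. \<forall>u\<in>Cc_infinity. hardy_sobolev_ineq f \<epsilon> c u"
proof -
  let ?n = "real DIM('a)"
  define a where "a = (?n - 2) / 2"
  have a: "a > 0" using dim by (simp add: a_def)
  \<comment> \<open>A real number strictly between, because \<open>epsilon0 f\<close> may be
    infinite. The fraction \<delta> of the energy that survives is 1 -
    \<epsilon>/\<epsilon>'.\<close>
  obtain \<epsilon>' where \<epsilon>': "ereal \<epsilon> < ereal \<epsilon>'" "ereal \<epsilon>' < epsilon0 f"
    using ereal_dense2[OF assms(2)] by auto
  define \<delta> where "\<delta> = 1 - \<epsilon> / \<epsilon>'"
  have pos: "\<epsilon>' > 0" "0 < \<delta>" "\<delta> \<le> 1" using \<epsilon>' assms(1) by (simp_all add: \<delta>_def)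
  obtain C where C: "C > 0" and Sob: "\<And>(u :: 'a \<Rightarrow> real) G. C1c u G \<Longrightarrow>
    (LINT x|lborel. \<bar>u x\<bar> powr (2 * ?n / (?n - 2)) * X1_tilde (norm x) powr ((2 * ?n - 2) / (?n - 2)))
        powr ((?n - 2) / ?n) \<le>
    C * ((LINT x|lborel. (norm (pgrad u G x))\<^sup>2) + (LINT x|lborel. (X1_tilde (norm x) * (u x / norm x))\<^sup>2))"
    using weighted_Sobolev_inequality[OF dim] by auto
  \<comment> \<open>The 5 collects PB itself and the 4 PB from the logarithmic Hardy inequality. The
    rest comes from PE \<le> E, 2 S \<le> 2 E/a and HE \<le> E/a^2.\<close>
  define A where "A = 5 + 2 / a + 1 / a\<^sup>2"
  have A: "A > 0" "A \<ge> 5" "A \<ge> 1 + 2 / a + 1 / a\<^sup>2" using a by (auto simp: A_def add_pos_nonneg)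
  have "hardy_sobolev_ineq f \<epsilon> (\<delta> / (C * A)) u" if "u \<in> Cc_infinity" for u
  proof -
    let ?G = "grad u"
    have u: "C1c u ?G" using that by (rule Cc_infinity_C1c)
    define E PB PE HB HE S where "E = ext_energy ?G u"
      and "PB = (LINT x:ball 0 1|lborel. (norm (pgrad u ?G x))\<^sup>2)"
      and "PE = (LINT x:ext_domain|lborel. (norm (pgrad u ?G x))\<^sup>2)"
      and "HB = (LINT x:ball 0 1|lborel. (X1 (norm x) * (u x / norm x))\<^sup>2)"
      and "HE = (LINT x:ext_domain|lborel. (u x / norm x)\<^sup>2)"
      and "S = (LINT w|sphere_measure. (u w)\<^sup>2)"
    have E: "E = PE + a\<^sup>2 * HE"
      unfolding E_def PE_def HE_def a_def by (rule ext_energy_eq[OF u])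
    have nonneg: "PB \<ge> 0" "PE \<ge> 0" "HE \<ge> 0" "E \<ge> 0"
      unfolding PB_def PE_def HE_def E_def set_lebesgue_integral_def
      by (auto intro!: Bochner_Integration.integral_nonneg ext_energy_nonneg[OF u])
    have trace: "a * S \<le> E"
      using hardy_trace[OF dim u] unfolding ext_energy_def E_def S_def a_def .
    have log: "HB / 4 \<le> PB + S / 2"
      using log_hardy_ball[OF dim u] unfolding HB_def PB_def S_def .
    \<comment> \<open>A test function of zero exterior mass is not admissible in the infimum; for it
      the bound is just nonnegativity of the energy.\<close>
    have mass: "\<epsilon>' * ext_mass f u \<le> E"
    proof (cases "ext_mass f u > 0")
      case True
      have "ereal \<epsilon>' < ereal (E / ext_mass f u)"
        using less_le_trans[OF \<epsilon>'(2) epsilon0_le[OF that True]] by (simp add: E_def)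
      then show ?thesis using True by (simp add: less_divide_eq)
    next
      case False
      then have "ext_mass f u = 0" using ext_mass_nonneg[of u] by simp
      then show ?thesis using nonneg by simp
    qed
    have "\<epsilon> * ext_mass f u = \<epsilon> / \<epsilon>' * (\<epsilon>' * ext_mass f u)" using pos by simp
    also have "\<dots> \<le> \<epsilon> / \<epsilon>' * E" using assms(1) pos by (intro mult_left_mono mass) auto
    finally have "E - \<epsilon> * ext_mass f u \<ge> \<delta> * E" by (simp add: \<delta>_def algebra_simps)
    moreover have "\<delta> * PB \<le> PB" using pos nonneg by (simp add: mult_left_le_one_le)
    ultimately have lhs: "PB + E - \<epsilon> * ext_mass f u \<ge> \<delta> * (PB + E)" by (simp add: distrib_left)
    have split: "(LINT x|lborel. h x) = (LINT x:ball 0 1|lborel. h x) + (LINT x:ext_domain|lborel. h x)"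
      if "integrable lborel h" for h :: "'a \<Rightarrow> real"
    proof -
      have "(LINT x|lborel. h x) =
          (LINT x|lborel. indicator (ball 0 1) x *\<^sub>R h x + indicator ext_domain x *\<^sub>R h x)"
        by (intro Bochner_Integration.integral_cong) (auto simp: ext_domain_def split: split_indicator)
      also have "\<dots> = (LINT x:ball 0 1|lborel. h x) + (LINT x:ext_domain|lborel. h x)"
        unfolding set_lebesgue_integral_def using that
        by (intro Bochner_Integration.integral_add integrable_mult_indicator) auto
      finally show ?thesis .
    qed
    have P: "(LINT x|lborel. (norm (pgrad u ?G x))\<^sup>2) = PB + PE"
      unfolding PB_def PE_def by (rule split[OF integrable_pgrad[OF dim u]])
    have "(LINT x|lborel. (X1_tilde (norm x) * (u x / norm x))\<^sup>2) =
      (LINT x:ball 0 1|lborel. (X1_tilde (norm x) * (u x / norm x))\<^sup>2)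
          + (LINT x:ext_domain|lborel. (X1_tilde (norm x) * (u x / norm x))\<^sup>2)"
      by (rule split[OF integrable_X1_tilde_hardy[OF dim u]])
    also have "(LINT x:ball 0 1|lborel. (X1_tilde (norm x) * (u x / norm x))\<^sup>2) = HB"
      unfolding HB_def set_lebesgue_integral_def
      by (intro Bochner_Integration.integral_cong) (auto simp: X1_tilde_def split: split_indicator)
    also have "(LINT x:ext_domain|lborel. (X1_tilde (norm x) * (u x / norm x))\<^sup>2) = HE"
      unfolding HE_def set_lebesgue_integral_def
      by (intro Bochner_Integration.integral_cong)
          (auto simp: X1_tilde_def ext_domain_iff split: split_indicator)
    finally have H: "(LINT x|lborel. (X1_tilde (norm x) * (u x / norm x))\<^sup>2) = HB + HE" .
    have "HB \<le> 4 * PB + 2 * S" using log by simp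
    moreover have "S \<le> E / a" using trace a by (simp add: le_divide_eq mult.commute)
    moreover have "HE \<le> E / a\<^sup>2" using E nonneg a by (simp add: le_divide_eq mult.commute)
    moreover have "PE \<le> E" using E nonneg by simp
    ultimately have "PB + PE + (HB + HE) \<le> 5 * PB + (E + 2 * (E / a) + E / a\<^sup>2)"
      by linarith
    also have "E + 2 * (E / a) + E / a\<^sup>2 = (1 + 2 / a + 1 / a\<^sup>2) * E" by (simp add: algebra_simps)
    also have "5 * PB + (1 + 2 / a + 1 / a\<^sup>2) * E \<le> A * PB + A * E"
      using A nonneg by (intro add_mono mult_right_mono) auto
    also have "\<dots> = A * (PB + E)" by (simp add: distrib_left)
    finally have total: "PB + PE + (HB + HE) \<le> A * (PB + E)" .
    let ?N = "(LINT x|lborel. \<bar>u x\<bar> powr (2 * ?n / (?n - 2)) * X1_tilde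
        (norm x) powr ((2 * ?n - 2) / (?n - 2))) powr ((?n - 2) / ?n)"
    have "?N \<le> C * (PB + PE + (HB + HE))"
      using Sob[OF u] unfolding P H .
    also have "\<dots> \<le> C * (A * (PB + E))"
      using C by (intro mult_left_mono total) auto
    finally have "\<delta> / (C * A) * ?N \<le> \<delta> / (C * A) * (C * (A * (PB + E)))"
      using C A pos by (intro mult_left_mono) auto
    also have "\<dots> = \<delta> * (PB + E)" using C A by simp
    also have "\<dots> \<le> PB + E - \<epsilon> * ext_mass f u" by (rule lhs)
    finally show ?thesis
      unfolding hardy_sobolev_ineq_def hardy_sobolev_lhs[OF u] PB_def E_def .
  qed
  then show ?thesis using C A pos by (intro exI[of _ "\<delta> / (C * A)"]) auto
qed

end

section \<open>The logarithmic cutoff\<close>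

lemma smooth_step_derivative:
  obtains s' B where "\<And>x. (smooth_step has_real_derivative s' x) (at x)" "\<And>x. s' x \<noteq> 0 \<Longrightarrow> 0 \<le> x \<and> x \<le> 1"
    "\<And>x. \<bar>s' x\<bar> \<le> B" "B \<ge> 0"
proof -
  obtain s' where s': "\<And>x. (smooth_step has_real_derivative s' x) (at x)" "Ck_on UNIV 0 s'"
    using Ck_on_real_D[OF Ck_on_smooth_step[of "Suc 0"]] by auto
  have out: "0 \<le> x \<and> x \<le> 1" if "s' x \<noteq> 0" for x
  proof (rule ccontr)
    assume "\<not> (0 \<le> x \<and> x \<le> 1)"
    then consider "x < 0" | "x > 1" by linarith
    then have "s' x = 0"
    proof cases
      case 1
      have "((\<lambda>_. 0) has_real_derivative s' x) (at x)"
        by (rule has_field_derivative_transform_within_open[OF s'(1), of "{..<0}"])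
            (use 1 in \<open>auto simp: smooth_step_0\<close>)
      then show ?thesis using DERIV_unique DERIV_const by blast
    next
      case 2
      have "((\<lambda>_. 1) has_real_derivative s' x) (at x)"
        by (rule has_field_derivative_transform_within_open[OF s'(1), of "{1<..}"])
            (use 2 in \<open>auto simp: smooth_step_1\<close>)
      then show ?thesis using DERIV_unique DERIV_const by blast
    qed
    with that show False by simp
  qed
  have "continuous_on {0..1} s'"
    using s'(2) continuous_on_subset[of UNIV s' "{0..1}"] by simp
  then have "bounded (s' ` {0..1})"
    by (intro compact_imp_bounded compact_continuous_image) auto
  then obtain B where "\<forall>y\<in>s' ` {0..1}. norm y \<le> B" unfolding bounded_iff by blast
  then have B: "\<bar>s' x\<bar> \<le> B" if "0 \<le> x" "x \<le> 1" for x
    using that by auto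
  have "\<bar>s' x\<bar> \<le> max 0 B" for x
    using B[of x] out[of x] by (cases "s' x = 0") auto
  then show ?thesis using that[of s' "max 0 B"] s'(1) out by auto
qed

text \<open>It separates the two transition regions of the cutoff: the logarithmic one lies below
  exp (-1), the one next to the sphere above 1/2.\<close>

lemma exp_neg1_less_half: "exp (-1) < (1/2 :: real)"
proof -
  have "(2 :: real) < exp 1" using exp_gt_one[of "1::real"] e_approx_32 by (simp add: abs_if split: if_splits)
  then have "inverse (exp 1) < inverse (2::real)" by (intro less_imp_inverse_less) auto
  then show ?thesis by (simp add: exp_minus)
qed

text \<open>v(r) = \<psi>(r) z(\<kappa>(r)), where \<kappa> is the identity for r \<ge> 1 and the
  constant 1 for r \<le> 1 - \<delta>, and \<psi> rises from 0 to 1 as ln r runs from -2k to -k.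
  Inside, v is thus z(1) times a logarithmic cutoff, whose energy is a constant times k^{-2} times
  the integral of dr/r over that range, that is O(1/k). The smooth transition next to r = 1 has
  bounded derivative on an interval of length \<delta> = 1/(2k).\<close>

lemma logarithmic_cutoff:
  fixes z z' :: "real \<Rightarrow> real"
  assumes z: "\<And>k. Ck_on {0<..} k z" and z': "\<And>s. s > 0 \<Longrightarrow> (z has_real_derivative z' s) (at s)"
    and cont: "continuous_on {0<..} z'" and e: "e > 0"
  obtains v v' \<rho> where "\<And>k. Ck_on {0<..} k v" "\<And>r. r > 0 \<Longrightarrow> (v has_real_derivative v' r) (at r)"
    "\<rho> > 0" "\<And>r. 0 < r \<Longrightarrow> r < \<rho> \<Longrightarrow> v r = 0" "\<And>r. r \<ge> 1 \<Longrightarrow> v r = z r"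
    "(\<integral>\<^sup>+r. ennreal (indicator {0<..<1} r * (r * (v' r)\<^sup>2)) \<partial>lborel) \<le> ennreal e"
proof -
  obtain s' B where s': "\<And>x. (smooth_step has_real_derivative s' x) (at x)" "\<And>x. s' x \<noteq> 0 \<Longrightarrow> 0 \<le> x \<and> x \<le> 1"
    "\<And>x. \<bar>s' x\<bar> \<le> B" "B \<ge> 0"
    by (rule smooth_step_derivative, rule that)
  have "bounded (z' ` {1/2..1})"
    by (intro compact_imp_bounded compact_continuous_image continuous_on_subset[OF cont]) auto
  then obtain Mz where "\<forall>y\<in>z' ` {1/2..1}. norm y \<le> Mz" unfolding bounded_iff by blast
  then have Mz: "\<bar>z' s\<bar> \<le> Mz" if "1/2 \<le> s" "s \<le> 1" for s
    using that by auto
  have Mz0: "Mz \<ge> 0" using Mz[of 1] by simp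
  define C1 C2 where "C1 = (z 1)\<^sup>2 * B\<^sup>2" and "C2 = Mz\<^sup>2 * (1 + B)\<^sup>2"
  have C: "C1 \<ge> 0" "C2 \<ge> 0" by (simp_all add: C1_def C2_def)
  \<comment> \<open>Both contributions to the energy are at most C1/k and C2/k; the lower bound 1
    gives \<delta> \<le> 1/2.\<close>
  define k where "k = max 1 ((C1 + C2) / e)"
  have k: "k \<ge> 1" "k > 0" by (simp_all add: k_def)
  have ke: "C1 / k + C2 * (1 / (2 * k)) \<le> e"
  proof -
    have "(C1 + C2) / e \<le> k" by (simp add: k_def)
    then have "(C1 + C2) / k \<le> e" using e k by (simp add: field_simps)
    moreover have "C2 * (1 / (2 * k)) \<le> C2 / k" using C k by (simp add: field_simps)
    ultimately show ?thesis by (simp add: add_divide_distrib)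
  qed
  define \<delta> where "\<delta> = 1 / (2 * k)"
  have \<delta>: "\<delta> > 0" "\<delta> \<le> 1/2" using k by (simp_all add: \<delta>_def divide_simps)
  \<comment> \<open>Freezing the argument of z through \<kappa>, instead of replacing z by a
    constant, keeps v smooth across r = 1 and exactly equal to z outside.\<close>
  define \<theta> \<kappa> \<psi> v where "\<theta> r = smooth_step (1 + (r - 1) / \<delta>)" and "\<kappa> r = 1 + \<theta> r * (r - 1)"
    and "\<psi> r = smooth_step (2 + ln r / k)" and "v r = \<psi> r * z (\<kappa> r)" for r
  define \<kappa>' \<psi>' v' where "\<kappa>' r = s' (1 + (r - 1) / \<delta>) / \<delta> * (r - 1) + \<theta> r"
    and "\<psi>' r = s' (2 + ln r / k) / (k * r)" and "v' r = \<psi>' r * z (\<kappa> r) + \<psi> r * (z' (\<kappa> r) * \<kappa>' r)" for r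
  have \<theta>: "0 \<le> \<theta> r" "\<theta> r \<le> 1" for r unfolding \<theta>_def by (rule smooth_step_bounds)+
  have \<kappa>_le: "r \<le> \<kappa> r \<and> \<kappa> r \<le> 1" if "r \<le> 1" for r
  proof -
    have "\<theta> r * (1 - r) \<le> 1 * (1 - r)" using that by (intro mult_right_mono \<theta>) auto
    moreover have "\<theta> r * (1 - r) \<ge> 0" using \<theta>[of r] that by simp
    ultimately show ?thesis by (simp add: \<kappa>_def algebra_simps)
  qed
  have \<kappa>_ge: "\<kappa> r = r" if "r \<ge> 1" for r
  proof -
    have "1 + (r - 1) / \<delta> \<ge> 1" using that \<delta> by simp
    then show ?thesis by (simp add: \<kappa>_def \<theta>_def smooth_step_1)
  qed
  have \<kappa>_pos: "\<kappa> r > 0" if "r > 0" for r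
    using \<kappa>_le[of r] \<kappa>_ge[of r] that by (cases "r \<le> 1") auto
  have d\<kappa>: "(\<kappa> has_real_derivative \<kappa>' r) (at r)" for r
  proof -
    have "((\<lambda>r. 1 + (r - 1) / \<delta>) has_real_derivative 1 / \<delta>) (at r)"
      using \<delta> by (auto intro!: derivative_eq_intros)
    from DERIV_chain2[where f=smooth_step, OF s'(1) this]
    have "(\<theta> has_real_derivative s' (1 + (r - 1) / \<delta>) * (1 / \<delta>)) (at r)"
      unfolding \<theta>_def[abs_def] .
    then show ?thesis
      unfolding \<kappa>_def[abs_def] \<kappa>'_def by (auto intro!: derivative_eq_intros)
  qed
  have d\<psi>: "(\<psi> has_real_derivative \<psi>' r) (at r)" if "r > 0" for r
  proof -
    have "((\<lambda>r. 2 + ln r / k) has_real_derivative 1 / (k * r)) (at r)"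
      using that k by (auto intro!: derivative_eq_intros simp: field_simps)
    from DERIV_chain2[where f=smooth_step, OF s'(1) this]
    show ?thesis unfolding \<psi>_def[abs_def] \<psi>'_def by simp
  qed
  have dv: "(v has_real_derivative v' r) (at r)" if "r > 0" for r
  proof -
    have "((\<lambda>r. z (\<kappa> r)) has_real_derivative z' (\<kappa> r) * \<kappa>' r) (at r)"
      by (rule DERIV_chain2[OF z'[OF \<kappa>_pos[OF that]] d\<kappa>])
    from DERIV_mult[OF d\<psi>[OF that] this] show ?thesis
      unfolding v_def[abs_def] v'_def by (rule DERIV_cong) simp
  qed
  have Ckv: "Ck_on {0<..} j v" for j
  proof -
    have id: "Ck_on {0<..} j (\<lambda>r::real. r + (-1))"
      by (intro Ck_on_add Ck_on_ident Ck_on_const) auto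
    have "Ck_on {0<..} j (\<lambda>r. smooth_step (1 + (1 / \<delta>) * (r + (-1))))"
      by (rule Ck_on_compose_real[OF _ _ Ck_on_smooth_step])
          (intro Ck_on_add Ck_on_mult Ck_on_const id; simp | simp)+
    moreover have "(\<lambda>r. smooth_step (1 + (1 / \<delta>) * (r + (-1)))) = \<theta>" by (simp add: \<theta>_def fun_eq_iff)
    ultimately have \<theta>k: "Ck_on {0<..} j \<theta>" by simp
    have "Ck_on {0<..} j (\<lambda>r. 1 + \<theta> r * (r + (-1)))"
      by (intro Ck_on_add[of _ _ "\<lambda>r. 1"] Ck_on_mult \<theta>k id Ck_on_const) auto
    moreover have "(\<lambda>r. 1 + \<theta> r * (r + (-1))) = \<kappa>" by (simp add: \<kappa>_def fun_eq_iff)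
    ultimately have \<kappa>k: "Ck_on {0<..} j \<kappa>" by simp
    have zk: "Ck_on {0<..} j (\<lambda>r. z (\<kappa> r))"
      by (rule Ck_on_compose_real[OF _ _ z \<kappa>k]) (auto intro: \<kappa>_pos)
    have lnk: "Ck_on {0<..} j (\<lambda>r. 2 + (1 / k) * ln r)"
      by (intro Ck_on_add[of _ _ "\<lambda>r. 2"] Ck_on_mult[of _ _ "\<lambda>r. 1 / k"] Ck_on_ln Ck_on_const) auto
    have "Ck_on {0<..} j (\<lambda>r. smooth_step (2 + (1 / k) * ln r))"
      by (rule Ck_on_compose_real[OF _ _ Ck_on_smooth_step lnk]) auto
    moreover have "(\<lambda>r. smooth_step (2 + (1 / k) * ln r)) = \<psi>" by (simp add: \<psi>_def fun_eq_iff)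
    ultimately have "Ck_on {0<..} j \<psi>" by simp
    then show ?thesis unfolding v_def[abs_def] by (intro Ck_on_mult zk) auto
  qed
  have v0: "v r = 0" if "0 < r" "r < exp (- 2 * k)" for r
  proof -
    have "ln r < - 2 * k" using that by (metis exp_less_cancel_iff exp_ln)
    then have "2 + ln r / k \<le> 0" using k by (simp add: field_simps)
    then show ?thesis by (simp add: v_def \<psi>_def smooth_step_0)
  qed
  have v1: "v r = z r" if "r \<ge> 1" for r
  proof -
    have "ln r \<ge> 0" using that by simp
    then have "2 + ln r / k \<ge> 1" using k by (simp add: add_nonneg_nonneg)
    then show ?thesis using \<kappa>_ge[OF that] by (simp add: v_def \<psi>_def smooth_step_1)
  qed
  let ?A = "\<lambda>r. C1 / k\<^sup>2 * (1 / r * indicator {exp (- 2 * k)..exp (- k)} r) + C2 * indicator {1 - \<delta>..1} r"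
  have bound: "indicator {0<..<1} r * (r * (v' r)\<^sup>2) \<le> ?A r" for r
  proof (cases "0 < r \<and> r < 1")
    case True
    show ?thesis
    proof (cases "r < 1 - \<delta>")
      case in1: True
      have "(r - 1) / \<delta> < -1" using in1 \<delta> by (simp add: divide_less_eq)
      then have neg: "1 + (r - 1) / \<delta> < 0" by simp
      then have "s' (1 + (r - 1) / \<delta>) = 0" using s'(2)[of "1 + (r - 1) / \<delta>"] by force
      moreover have "\<theta> r = 0" using neg by (simp add: \<theta>_def smooth_step_0)
      ultimately have v'_eq: "v' r = \<psi>' r * z 1" by (simp add: v'_def \<kappa>'_def \<kappa>_def)
      show ?thesis
      proof (cases "s' (2 + ln r / k) = 0")
        case True
        then have "v' r = 0" by (simp add: v'_eq \<psi>'_def)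
        then show ?thesis using C \<open>0 < r \<and> r < 1\<close> by (auto intro!: add_nonneg_nonneg mult_nonneg_nonneg)
      next
        case False
        from s'(2)[OF this] have "ln r \<ge> - 2 * k" "ln r \<le> - k" using k by (simp_all add: field_simps)
        then have rr: "exp (- 2 * k) \<le> r" "r \<le> exp (- k)"
          using \<open>0 < r \<and> r < 1\<close> by (metis exp_le_cancel_iff exp_ln)+
        have "\<bar>s' (2 + ln r / k)\<bar>\<^sup>2 \<le> B\<^sup>2" by (intro power_mono s'(3)) auto
        then have "(s' (2 + ln r / k))\<^sup>2 * (z 1)\<^sup>2 \<le> C1" unfolding C1_def mult.commute[of "(z 1)\<^sup>2"]
          by (intro mult_right_mono) simp_all
        then have "(s' (2 + ln r / k))\<^sup>2 * (z 1)\<^sup>2 / (k\<^sup>2 * r) \<le> C1 / (k\<^sup>2 * r)"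
          using True by (intro divide_right_mono) auto
        moreover have "r * (v' r)\<^sup>2 = (s' (2 + ln r / k))\<^sup>2 * (z 1)\<^sup>2 / (k\<^sup>2 * r)"
          unfolding v'_eq \<psi>'_def power_mult_distrib power_divide using True by (simp add: power2_eq_square)
        ultimately show ?thesis using rr True C by (auto split: split_indicator simp: add_increasing2)
      qed
    next
      case False
      then have r: "1 - \<delta> \<le> r" "r \<le> 1" "r \<ge> 1/2" using True \<delta> by auto
      \<comment> \<open>The derivative of \<theta> is of size 1/\<delta>, but it is multiplied by r
        - 1, which is at most \<delta> in size here; so the bound on \<kappa>' does not depend on
        k.\<close>
      have "\<bar>(r - 1) / \<delta>\<bar> \<le> 1" using r \<delta> by (simp add: abs_le_iff divide_simps)
      moreover have "\<bar>s' (1 + (r - 1) / \<delta>) / \<delta> * (r - 1)\<bar> = \<bar>s' (1 + (r - 1) / \<delta>)\<bar> * \<bar>(r - 1) / \<delta>\<bar>"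
        by (simp add: abs_mult)
      ultimately have "\<bar>s' (1 + (r - 1) / \<delta>) / \<delta> * (r - 1)\<bar> \<le> B * 1"
        using s'(3)[of "1 + (r - 1) / \<delta>"] s'(4) by (simp only:) (intro mult_mono; simp)
      then have \<kappa>'_le: "\<bar>\<kappa>' r\<bar> \<le> 1 + B" unfolding \<kappa>'_def using \<theta>[of r] by linarith
      have "exp (- k) \<le> exp (-1)" using k by simp
      then have "exp (- k) < r" using exp_neg1_less_half r by linarith
      then have "- k < ln r" using True by (metis exp_less_cancel_iff exp_ln)
      then have gt: "2 + ln r / k > 1" using k by (simp add: field_simps)
      then have "s' (2 + ln r / k) = 0" using s'(2)[of "2 + ln r / k"] by force
      moreover have "\<psi> r = 1" using gt by (simp add: \<psi>_def smooth_step_1)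
      ultimately have "v' r = z' (\<kappa> r) * \<kappa>' r" by (simp add: v'_def \<psi>'_def)
      moreover have "\<bar>z' (\<kappa> r)\<bar> \<le> Mz" using \<kappa>_le[OF r(2)] r by (intro Mz) auto
      ultimately have "\<bar>v' r\<bar> \<le> Mz * (1 + B)"
        using \<kappa>'_le Mz0 by (simp only: abs_mult) (intro mult_mono; simp)
      then have "\<bar>v' r\<bar>\<^sup>2 \<le> (Mz * (1 + B))\<^sup>2" by (intro power_mono) auto
      then have "(v' r)\<^sup>2 \<le> C2" by (simp add: C2_def power_mult_distrib)
      then have "r * (v' r)\<^sup>2 \<le> 1 * C2" using r by (intro mult_mono) auto
      then show ?thesis using r True C by (auto split: split_indicator simp: add_increasing)
    qed
  next
    case False
    have "(0::real) \<le> 1 / r * indicator {exp (- 2 * k)..exp (- k)} r"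
      by (auto split: split_indicator intro: order_trans[OF exp_ge_zero])
    then show ?thesis using False C
      by (auto intro!: add_nonneg_nonneg mult_nonneg_nonneg split: split_indicator)
  qed
  have "(\<integral>\<^sup>+r. ennreal (indicator {0<..<1} r * (r * (v' r)\<^sup>2)) \<partial>lborel) \<le> (\<integral>\<^sup>+r. ennreal (?A r) \<partial>lborel)"
    by (intro nn_integral_mono ennreal_leI bound)
  also have "\<dots> = (\<integral>\<^sup>+r. ennreal (C1 / k\<^sup>2) * (ennreal (1 / r) * indicator {exp (- 2 * k)..exp (- k)} r) +
      ennreal C2 * indicator {1 - \<delta>..1} r \<partial>lborel)"
  proof (intro nn_integral_cong)
    fix r :: real
    have 1: "(0::real) \<le> 1 / r * indicator {exp (- 2 * k)..exp (- k)} r"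
      by (auto split: split_indicator intro: order_trans[OF exp_ge_zero])
    have "ennreal (?A r) = ennreal (C1 / k\<^sup>2) * ennreal (1 / r * indicator {exp (- 2 * k)..exp (- k)} r)
        + ennreal C2 * ennreal (indicator {1 - \<delta>..1} r)"
    proof -
      have split: "ennreal (\<alpha> * x + \<beta> * y) = ennreal \<alpha> * ennreal x + ennreal \<beta> * ennreal y"
        if "\<alpha> \<ge> 0" "x \<ge> 0" "\<beta> \<ge> 0" "y \<ge> 0" for \<alpha> x \<beta> y :: real
        using that by (simp add: ennreal_plus ennreal_mult)
      show ?thesis by (rule split) (use C 1 k in auto)
    qed
    then show "ennreal (?A r) = ennreal (C1 / k\<^sup>2) *
        (ennreal (1 / r) * indicator {exp (- 2 * k)..exp (- k)} r) + ennreal C2 * indicator {1 - \<delta>..1} r"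
      by (simp split: split_indicator)
  qed
  also have "\<dots> = ennreal (C1 / k\<^sup>2) * (\<integral>\<^sup>+r. ennreal (1 / r) * indicator
      {exp (- 2 * k)..exp (- k)} r \<partial>lborel) + ennreal C2 * ennreal \<delta>"
    using \<delta> by (subst nn_integral_add) (auto simp: nn_integral_cmult nn_integral_cmult_indicator)
  also have "(\<integral>\<^sup>+r. ennreal (1 / r) * indicator {exp (- 2 * k)..exp (- k)} r \<partial>lborel) =
      ennreal (ln (exp (- k)) - ln (exp (- 2 * k)))"
  proof (rule nn_integral_FTC_Icc)
    fix r :: real assume "r \<in> {exp (- 2 * k)..exp (- k)}"
    then have "r > 0" using exp_gt_zero[of "- 2 * k"] unfolding atLeastAtMost_iff by linarith
    then show "(ln has_real_derivative 1 / r) (at r)" "0 \<le> 1 / r"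
      by (auto intro!: derivative_eq_intros)
  qed (use k in auto)
  also have "ln (exp (- k)) - ln (exp (- 2 * k)) = k" by simp
  also have "ennreal (C1 / k\<^sup>2) * ennreal k + ennreal C2 * ennreal \<delta> = ennreal (C1 / k + C2 * (1 / (2 * k)))"
  proof -
    have "C1 / k\<^sup>2 * k = C1 / k" using k by (simp add: power2_eq_square)
    then show ?thesis using C k \<delta> by (simp add: \<delta>_def flip: ennreal_mult ennreal_plus)
  qed
  also have "\<dots> \<le> ennreal e" by (intro ennreal_leI ke)
  finally have int: "(\<integral>\<^sup>+r. ennreal (indicator {0<..<1} r * (r * (v' r)\<^sup>2)) \<partial>lborel) \<le> ennreal e" .
  show ?thesis by (rule that[OF Ckv dv _ v0 v1 int]) auto
qed

section \<open>Failure at the critical parameter\<close>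

context exterior_potential
begin

definition radial_density :: "real \<Rightarrow> ('a \<Rightarrow> real) \<Rightarrow> ('a \<Rightarrow> 'a) \<Rightarrow> 'a \<Rightarrow> real" where
  "radial_density t u G x = indicator {x. norm x > 1}
      x * ((G x \<bullet> sgn x)\<^sup>2 - t * (indicator ext_domain x * f x * (u x)\<^sup>2))"

text \<open>The contribution of the ray through w to energy minus t times mass, with only the radial
  part of the gradient kept.\<close>

definition ray_energy :: "real \<Rightarrow> ('a \<Rightarrow> real) \<Rightarrow> ('a \<Rightarrow> 'a) \<Rightarrow> 'a \<Rightarrow> real" where
  "ray_energy t u G w =
      (LINT r|lborel. indicator {0<..} r * r ^ (DIM('a) - 1) * radial_density t u G (r *\<^sub>R w))
     - (real DIM('a) - 2) / 2 * (u w)\<^sup>2"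

section \<open>Integration of the radial energy over the sphere\<close>

lemma inner_sgn_le: "(v \<bullet> sgn x)\<^sup>2 \<le> (norm v)\<^sup>2" for v x :: 'a
proof -
  have "\<bar>v \<bullet> sgn x\<bar> \<le> norm v * norm (sgn x)" by (rule Cauchy_Schwarz_ineq2)
  also have "\<dots> \<le> norm v * 1" by (intro mult_left_mono) (auto simp: norm_sgn)
  finally show ?thesis using power_mono[of "\<bar>v \<bullet> sgn x\<bar>" "norm v" 2] by simp
qed

lemma integrable_radial:
  assumes u: "C1c (u :: 'a \<Rightarrow> real) G"
  shows "integrable lborel (\<lambda>x. indicator {x. norm x > 1} x * (G x \<bullet> sgn x)\<^sup>2)"
    and "integrable lborel (\<lambda>x. indicator {x. norm x > 1} x * (indicator ext_domain x * f x * (u x)\<^sup>2))"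
proof -
  note [measurable] = C1c_measurable[OF u] f_measurable
  show "integrable lborel (\<lambda>x. indicator {x. norm x > 1} x * (G x \<bullet> sgn x)\<^sup>2)"
  proof (rule Bochner_Integration.integrable_bound[OF integrable_grad[OF dim u]])
    show "(\<lambda>x. indicator {x. norm x > 1} x * (G x \<bullet> sgn x)\<^sup>2) \<in> borel_measurable lborel"
      unfolding sgn_div_norm by measurable
    show "AE x in lborel. norm (indicator {x. norm x > 1} x * (G x \<bullet> sgn x)\<^sup>2) \<le> norm ((norm (G x))\<^sup>2)"
      using inner_sgn_le by (intro AE_I2) (auto split: split_indicator)
  qed
  have "integrable lborel (\<lambda>x. indicator {x. norm x > 1} x *\<^sub>R (indicator ext_domain x * f x * (u x)\<^sup>2))"
    by (intro integrable_mult_indicator integrable_mass[OF u]) measurable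
  then show "integrable lborel (\<lambda>x. indicator {x. norm x > 1} x * (indicator ext_domain x * f x * (u x)\<^sup>2))"
    by simp
qed

lemma integrable_radial_density:
  assumes u: "C1c (u :: 'a \<Rightarrow> real) G"
  shows "integrable lborel (radial_density t u G)"
proof -
  have "integrable lborel (\<lambda>x. indicator {x. norm x > 1} x * (G x \<bullet> sgn x)\<^sup>2 -
     t * (indicator {x. norm x > 1} x * (indicator ext_domain x * f x * (u x)\<^sup>2)))"
    by (intro Bochner_Integration.integrable_diff integrable_mult_right integrable_radial[OF u])
  then show ?thesis unfolding radial_density_def[abs_def] by (simp add: algebra_simps)
qed

lemma integral_radial_density:
  assumes u: "C1c (u :: 'a \<Rightarrow> real) G"
  shows "(LINT x|lborel. radial_density t u G x) =
    (LINT x|lborel. indicator {x. norm x > 1} x * (G x \<bullet> sgn x)\<^sup>2) - t * ext_mass f u"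
proof -
  have AE1: "AE x in lborel. norm (x::'a) \<noteq> 1" by (rule AE_lborel_norm_neq)
  note [measurable] = C1c_measurable[OF u] f_measurable
  have "ext_mass f u =
      (LINT x|lborel. indicator {x. norm x > 1} x * (indicator ext_domain x * f x * (u x)\<^sup>2))"
    unfolding ext_mass_eq
  proof (rule integral_cong_AE)
    show "AE x in lborel. indicator ext_domain x * f x * (u x)\<^sup>2 =
        indicator {x. norm x > 1} x * (indicator ext_domain x * f x * (u x)\<^sup>2)"
      using AE1 by eventually_elim (auto simp: ext_domain_iff split: split_indicator)
  qed measurable
  moreover have "(LINT x|lborel. radial_density t u G x) =
      (LINT x|lborel. indicator {x. norm x > 1} x * (G x \<bullet> sgn x)\<^sup>2 -
     t * (indicator {x. norm x > 1} x * (indicator ext_domain x * f x * (u x)\<^sup>2)))"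
    unfolding radial_density_def by (simp add: algebra_simps)
  ultimately show ?thesis
    using integrable_radial[OF u] by simp
qed

lemma ext_grad_integral:
  assumes u: "C1c (u :: 'a \<Rightarrow> real) G"
  shows "(LINT x:ext_domain|lborel. (norm (G x))\<^sup>2) =
      (LINT x|lborel. indicator {x. norm x > 1} x * (norm (G x))\<^sup>2)"
  unfolding set_lebesgue_integral_def
proof (rule integral_cong_AE)
  note [measurable] = C1c_measurable[OF u]
  show "(\<lambda>x. indicator ext_domain x *\<^sub>R (norm (G x))\<^sup>2) \<in> borel_measurable lborel"
    by (intro borel_measurable_scaleR borel_measurable_indicator; simp)
  have "AE x in lborel. norm (x::'a) \<noteq> 1" by (rule AE_lborel_norm_neq)
  then show "AE x in lborel. indicator ext_domain x *\<^sub>R (norm (G x))\<^sup>2 =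
      indicator {x. norm x > 1} x * (norm (G x))\<^sup>2"
    by eventually_elim (auto simp: ext_domain_iff split: split_indicator)
qed (use C1c_measurable[OF u] in measurable)

lemma integral_ray_energy:
  assumes u: "C1c (u :: 'a \<Rightarrow> real) G"
  shows "integrable sphere_measure (ray_energy t u G)"
    and "(LINT w|sphere_measure. ray_energy t u G w) =
      (LINT x|lborel. radial_density t u G x) - (real DIM('a) - 2) / 2 * (LINT w|sphere_measure. (u w)\<^sup>2)"
proof -
  note i1 = integral_polar(2)[OF integrable_radial_density[OF u, of t]]
  note i2 = integrable_mult_right[OF C1c_sphere(2)[OF u], of "(real DIM('a) - 2) / 2"]
  show "integrable sphere_measure (ray_energy t u G)"
    unfolding ray_energy_def[abs_def] by (intro Bochner_Integration.integrable_diff i1 i2)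
  have "(LINT w|sphere_measure. ray_energy t u G w) =
    (LINT w|sphere_measure.
        (LINT r|lborel. indicator {0<..} r * r ^ (DIM('a) - 1) * radial_density t u G (r *\<^sub>R w)))
     - (LINT w|sphere_measure. (real DIM('a) - 2) / 2 * (u w)\<^sup>2)"
    unfolding ray_energy_def by (rule Bochner_Integration.integral_diff[OF i1 i2])
  then show "(LINT w|sphere_measure. ray_energy t u G w) =
      (LINT x|lborel. radial_density t u G x) - (real DIM('a) - 2) / 2 * (LINT w|sphere_measure. (u w)\<^sup>2)"
    unfolding integral_polar(1)[OF integrable_radial_density[OF u, of t]] by simp
qed

lemma measure_sphere_pos: "measure (sphere_measure :: 'a measure) (sphere 0 1) > 0"
proof -
  interpret finite_measure "sphere_measure :: 'a measure" by (rule finite_measure_sphere_measure)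
  have "{x::'a. x \<noteq> 0 \<and> norm x < 1 \<and> sgn x \<in> sphere 0 1} = ball 0 1 - {0}"
    by (auto simp: norm_sgn)
  then have "emeasure sphere_measure (sphere (0::'a) 1) =
      of_nat DIM('a) * emeasure lborel (ball 0 1 - {0::'a})"
    by (subst emeasure_sphere_measure) (auto simp: sets_restrict_space_iff)
  also have "emeasure lborel (ball 0 1 - {0::'a}) = emeasure lborel (ball (0::'a) 1)"
    by (rule emeasure_Diff_null_set) auto
  also have "emeasure lborel (ball (0::'a) 1) = ennreal (measure lborel (ball (0::'a) 1))"
    using emeasure_bounded_finite[of "ball (0::'a) 1"] by (intro emeasure_eq_ennreal_measure) auto
  finally have em: "emeasure sphere_measure (sphere (0::'a) 1) =
      of_nat DIM('a) * ennreal (measure lborel (ball (0::'a) 1))" .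
  have "measure lborel (ball (0::'a) 1) > 0" by (rule content_ball_pos) simp
  then have "emeasure sphere_measure (sphere (0::'a) 1) > 0"
    unfolding em by (intro ennreal_zero_less_mult_iff[THEN iffD2]) simp
  then show ?thesis
    by (simp add: emeasure_eq_measure)
qed

text \<open>Since the angular part of the gradient only increases the energy, a function with small Rayleigh quotient
  has a ray on which the one-dimensional quotient is small, and its profile there gives a radial competitor.\<close>

lemma radial_reduction:
  assumes u: "C1c (u :: 'a \<Rightarrow> real) G" and less: "ext_energy G u < t * ext_mass f u"
  shows "\<exists>w. norm w = 1 \<and> (\<forall>(U :: 'a \<Rightarrow> real) H. C1c U H \<longrightarrow> (\<forall>x. norm x \<ge> 1 \<longrightarrow> U x = u (norm x *\<^sub>R w)) \<longrightarrow>
    (\<forall>x. norm x > 1 \<longrightarrow> H x = (G (norm x *\<^sub>R w) \<bullet> w) *\<^sub>R sgn x) \<longrightarrow> ext_energy H U < t * ext_mass f U)"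
proof -
  interpret S: finite_measure "sphere_measure :: 'a measure" by (rule finite_measure_sphere_measure)
  have "(LINT x|lborel. indicator {x. norm x > 1} x * (G x \<bullet> sgn x)\<^sup>2) \<le>
      (LINT x|lborel. indicator {x. norm x > 1} x * (norm (G x))\<^sup>2)"
  proof (rule integral_mono)
    have "integrable lborel (\<lambda>x. indicator {x. norm x > 1} x *\<^sub>R (norm (G x))\<^sup>2)"
      by (intro integrable_mult_indicator integrable_grad[OF dim u]) measurable
    then show "integrable lborel (\<lambda>x. indicator {x. norm x > 1} x * (norm (G x))\<^sup>2)" by simp
  qed (use integrable_radial[OF u] inner_sgn_le in \<open>auto split: split_indicator\<close>)
  then have "(LINT w|sphere_measure. ray_energy t u G w) < 0"
    using less unfolding integral_ray_energy(2)[OF u] integral_radial_density[OF u]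
        ext_energy_def ext_grad_integral[OF u]
    by linarith
  \<comment> \<open>A negative average forces a negative value on some ray.\<close>
  moreover have "(LINT w|sphere_measure. ray_energy t u G w) \<ge> 0" if "\<forall>w. norm w = 1 \<longrightarrow> ray_energy t u G w \<ge> 0"
    using that by (intro integral_nonneg_AE AE_I2) simp
  ultimately obtain w where w: "norm w = 1" "ray_energy t u G w < 0"
    by (meson not_le)
  show ?thesis
  proof (intro exI[of _ w] conjI allI impI w(1))
    \<comment> \<open>U is left arbitrary inside the ball: energy and mass see only its exterior
      values and trace, and the interior is designed later.\<close>
    fix U H
    assume U: "C1c (U :: 'a \<Rightarrow> real) H" and Uu: "\<forall>x. norm x \<ge> 1 \<longrightarrow> U x = u (norm x *\<^sub>R w)"
      and HG: "\<forall>x. norm x > 1 \<longrightarrow> H x = (G (norm x *\<^sub>R w) \<bullet> w) *\<^sub>R sgn x"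
    note Uu = Uu[rule_format] and HG = HG[rule_format]
    \<comment> \<open>Since f and U are radial outside the ball, all rays of U carry the same
      energy, namely that of u on the selected ray.\<close>
    have "ray_energy t U H y = ray_energy t u G w" if y: "norm y = 1" for y
    proof -
      have e1: "indicator {0<..} r * r ^ (DIM('a) - 1) * radial_density t U H (r *\<^sub>R y) =
        indicator {0<..} r * r ^ (DIM('a) - 1) * radial_density t u G (r *\<^sub>R w)" for r
      proof (cases "r > 1")
        case True
        have n: "norm (r *\<^sub>R y) = r" "norm (r *\<^sub>R w) = r" using True y w by simp_all
        have s: "sgn (r *\<^sub>R y) = y" "sgn (r *\<^sub>R w) = w" using True y w
          by (simp_all add: sgn_scaleR sgn_div_norm)
        have "f (r *\<^sub>R y) = f (r *\<^sub>R w)" using True n by (intro f_radial) auto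
        moreover have "U (r *\<^sub>R y) = u (r *\<^sub>R w)" using Uu[of "r *\<^sub>R y"] True n by simp
        moreover have "H (r *\<^sub>R y) \<bullet> sgn (r *\<^sub>R y) = G (r *\<^sub>R w) \<bullet> sgn (r *\<^sub>R w)"
          using HG[of "r *\<^sub>R y"] True n y unfolding s by (simp add: s flip: power2_norm_eq_inner)
        ultimately show ?thesis
          using True n by (simp add: radial_density_def ext_domain_iff)
      next
        case False
        then show ?thesis using y w by (cases "r > 0") (simp_all add: radial_density_def)
      qed
      have e2: "U y = u w" using Uu[of y] y by simp
      show ?thesis unfolding ray_energy_def by (simp only: e1 e2)
    qed
    then have "(LINT y|sphere_measure. ray_energy t U H y) =
        (LINT y|(sphere_measure :: 'a measure). ray_energy t u G w)"
      by (intro Bochner_Integration.integral_cong) auto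
    also have "\<dots> = measure (sphere_measure :: 'a measure) (sphere 0 1) * ray_energy t u G w" by simp
    also have "\<dots> < 0" using measure_sphere_pos w(2) by (simp add: mult_pos_neg)
    finally have neg: "(LINT y|sphere_measure. ray_energy t U H y) < 0" .
    \<comment> \<open>The gradient of U is purely radial, so the estimate that discarded the angular
      part is an equality for U.\<close>
    have "(LINT x|lborel. indicator {x. norm x > 1} x * (H x \<bullet> sgn x)\<^sup>2) =
        (LINT x|lborel. indicator {x. norm x > 1} x * (norm (H x))\<^sup>2)"
    proof (intro Bochner_Integration.integral_cong refl)
      fix x
      show "indicator {x. norm x > 1} x * (H x \<bullet> sgn x)\<^sup>2 = indicator {x. norm x > 1} x * (norm (H x))\<^sup>2"
      proof (cases "norm x > 1")
        case True
        then have "x \<noteq> 0" by auto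
        then show ?thesis using HG[OF True] by (simp add: sgn_inner_sgn norm_sgn)
      qed simp
    qed
    then show "ext_energy H U < t * ext_mass f U"
      using neg unfolding integral_ray_energy(2)[OF U] integral_radial_density[OF U]
          ext_energy_def ext_grad_integral[OF U]
      by linarith
  qed
qed

text \<open>In polar coordinates the density is at most K^{N/2} r^{-1-b} with b = \<sigma> N/2,
  which is integrable at infinity because \<sigma> > 0.\<close>

lemma decay_integral_finite:
  "(\<integral>\<^sup>+x. epowr (ennreal (indicator ext_domain x * f x)) (real DIM('a) / 2) \<partial>lborel) < \<infinity>"
proof -
  let ?n = "real DIM('a)"
  interpret S: finite_measure "sphere_measure :: 'a measure" by (rule finite_measure_sphere_measure)
  define b where "b = \<sigma> * ?n / 2"
  have b: "b > 0" using \<sigma> by (simp add: b_def)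
  have [measurable]: "(\<lambda>x. epowr (ennreal (indicator ext_domain x * f x)) (?n / 2)) \<in> borel_measurable borel"
    using f_measurable by measurable
  have "(\<integral>\<^sup>+x. epowr (ennreal (indicator ext_domain x * f x)) (?n / 2) \<partial>lborel) =
    (\<integral>\<^sup>+w. \<integral>\<^sup>+r. ennreal (indicator {0<..} r * r ^ (DIM('a) - 1)) * epowr
        (ennreal (indicator ext_domain (r *\<^sub>R w) * f (r *\<^sub>R w))) (?n / 2) \<partial>lborel \<partial>sphere_measure)"
    by (rule nn_integral_polar) measurable
  also have "\<dots> \<le> (\<integral>\<^sup>+w. \<integral>\<^sup>+r. ennreal (K powr (?n / 2)) *
      (ennreal (r powr (- b - 1)) * indicator {1..} r) \<partial>lborel \<partial>(sphere_measure :: 'a measure))"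
  proof (intro nn_integral_mono)
    fix w :: 'a and r :: real assume "w \<in> space sphere_measure"
    then have w: "norm w = 1" by simp
    show "ennreal (indicator {0<..} r * r ^ (DIM('a) - 1)) * epowr
        (ennreal (indicator ext_domain (r *\<^sub>R w) * f (r *\<^sub>R w))) (?n / 2)
      \<le> ennreal (K powr (?n / 2)) * (ennreal (r powr (- b - 1)) * indicator {1..} r)"
    proof (cases "r \<ge> 1")
      case True
      have n: "norm (r *\<^sub>R w) = r" using True w by simp
      have f0: "f (r *\<^sub>R w) \<ge> 0" using f_nonneg[of "r *\<^sub>R w"] n True by simp
      have "f (r *\<^sub>R w) \<le> K * r powr (- 2 - \<sigma>)" using f_decay[of "r *\<^sub>R w"] n True by simp
      then have "f (r *\<^sub>R w) powr (?n / 2) \<le> (K * r powr (- 2 - \<sigma>)) powr (?n / 2)"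
        using f0 by (intro powr_mono2) auto
      also have "\<dots> = K powr (?n / 2) * r powr ((- 2 - \<sigma>) * (?n / 2))"
        by (simp add: powr_mult powr_powr)
      finally have "r powr (?n - 1) * f (r *\<^sub>R w) powr (?n / 2) \<le>
          r powr (?n - 1) * (K powr (?n / 2) * r powr ((- 2 - \<sigma>) * (?n / 2)))"
        by (intro mult_left_mono) auto
      also have "\<dots> = K powr (?n / 2) * (r powr (?n - 1) * r powr ((- 2 - \<sigma>) * (?n / 2)))" by simp
      also have "r powr (?n - 1) * r powr ((- 2 - \<sigma>) * (?n / 2)) = r powr (?n - 1 + (- 2 - \<sigma>) * (?n / 2))"
        by (rule powr_add[symmetric])
      also have "?n - 1 + (- 2 - \<sigma>) * (?n / 2) = - b - 1" by (simp add: b_def field_simps)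
      also have "r powr (?n - 1) = r ^ (DIM('a) - 1)"
        using True dim by (subst powr_realpow[symmetric]) (auto simp: of_nat_diff)
      finally have "ennreal (r ^ (DIM('a) - 1) * f (r *\<^sub>R w) powr (?n / 2)) \<le>
          ennreal (K powr (?n / 2) * r powr (- b - 1))"
        by (rule ennreal_leI)
      then show ?thesis using True n f0 by (simp add: ext_domain_iff ennreal_mult)
    next
      case False
      then have "indicator {0<..} r = (0::real) \<or> r *\<^sub>R w \<notin> ext_domain"
        using w by (auto simp: ext_domain_iff split: split_indicator)
      then show ?thesis using False by auto
    qed
  qed
  also have "\<dots> = ennreal (K powr (?n / 2)) * ennreal (1 / b) * emeasure sphere_measure (sphere (0::'a) 1)"
  proof -
    have "(\<integral>\<^sup>+r. ennreal (r powr (- b - 1)) * indicator {1..} r \<partial>lborel) =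
        ennreal (0 - (- (1 / b) * 1 powr (- b)))"
    proof (rule nn_integral_FTC_atLeast[where F="\<lambda>r. - (1 / b) * r powr (- b)"])
      show "((\<lambda>r. - (1 / b) * r powr (- b)) has_real_derivative r powr (- b - 1)) (at r)" if "1 \<le> r" for r
        using that b by (auto intro!: derivative_eq_intros)
      have "((\<lambda>r::real. r powr (- b)) \<longlongrightarrow> 0) at_top"
        by (rule tendsto_neg_powr) (use b in \<open>auto intro: filterlim_ident\<close>)
      from tendsto_mult[OF tendsto_const this, of "- (1 / b)"]
      show "((\<lambda>r. - (1 / b) * r powr (- b)) \<longlongrightarrow> 0) at_top" by simp
    qed auto
    then show ?thesis by (simp add: nn_integral_cmult mult.assoc)
  qed
  also have "\<dots> < \<infinity>"
  proof -
    have "emeasure sphere_measure (sphere (0::'a) 1) < \<infinity>"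
      using S.emeasure_finite[of "sphere (0::'a) 1"] unfolding infinity_ennreal_def top.not_eq_extremum .
    then show ?thesis by (simp add: ennreal_mult_less_top)
  qed
  finally show ?thesis .
qed

text \<open>Hoelder's inequality with exponents N/(N-2) and N/2 for |u|^2 and f; the weight equals 1
  on the exterior, where f is integrated.\<close>

lemma ext_mass_le_weighted_norm:
  defines "q \<equiv> 2 * real DIM('a) / (real DIM('a) - 2)" and "m \<equiv> (2 * real DIM('a) - 2) / (real DIM('a) - 2)"
  shows "\<exists>C>0. \<forall>(u :: 'a \<Rightarrow> real) G. C1c u G \<longrightarrow>
    ext_mass f u \<le> C * (LINT x|lborel. \<bar>u x\<bar> powr q * X1_tilde (norm x) powr m)
        powr ((real DIM('a) - 2) / real DIM('a))"
proof -
  define n where "n = real DIM('a)"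
  have n: "n \<ge> 3" using dim by (simp add: n_def)
  define I where "I = (\<integral>\<^sup>+x. epowr (ennreal (indicator ext_domain x * f x)) (n / 2) \<partial>lborel)"
  obtain c where c: "I = ennreal c" "c \<ge> 0"
  proof -
    have "I < \<infinity>" unfolding I_def n_def by (rule decay_integral_finite)
    then show ?thesis using that by (cases I) auto
  qed
  \<comment> \<open>The summand 1 keeps the constant positive when c = 0.\<close>
  have "ext_mass f u \<le> (c powr (2 / n) + 1) * (LINT x|lborel. \<bar>u x\<bar> powr q * X1_tilde (norm x) powr m)
      powr ((n - 2) / n)"
    if u: "C1c u G" for u :: "'a \<Rightarrow> real" and G
  proof -
    note [measurable] = C1c_measurable[OF u]
    let ?k = "\<lambda>x. \<bar>u x\<bar> powr q * X1_tilde (norm x) powr m"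
    let ?h = "\<lambda>x. indicator ext_domain x * f x"
    have h0: "?h x \<ge> 0" for x using f_nonneg by (auto simp: ext_domain_iff split: split_indicator)
    have [measurable]: "?h \<in> borel_measurable lborel" using f_measurable by simp
    have [measurable]: "?k \<in> borel_measurable lborel" by measurable
    have q: "q > 0" "q * ((n - 2) / n) = 2" using n by (simp_all add: q_def n_def[symmetric])
    have m: "m > 0" using n by (simp add: m_def n_def[symmetric])
    have int_k: "integrable lborel ?k"
    proof -
      obtain M where "M > 1" "\<And>x. norm x > M \<Longrightarrow> u x = 0" using C1c_support[OF u] by metis
      then have "integrable lborel (\<lambda>x. \<bar>u x\<bar> powr q)"
        using q by (intro integrable_continuous_bounded_support[of _ M]
            continuous_on_powr' continuous_intros C1c_continuous[OF u]) auto
      then show ?thesis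
      proof (rule Bochner_Integration.integrable_bound)
        show "AE x in lborel. norm (?k x) \<le> norm (\<bar>u x\<bar> powr q)"
        proof (rule AE_I2)
          fix x :: 'a
          have "X1_tilde (norm x) powr m \<le> 1 powr m"
            using X1_tilde_bounds[of x] m by (intro powr_mono2) auto
          then show "norm (?k x) \<le> norm (\<bar>u x\<bar> powr q)"
            by (simp add: abs_mult mult_left_le)
        qed
      qed measurable
    qed
    define N where "N = (LINT x|lborel. ?k x)"
    have N: "(\<integral>\<^sup>+x. ennreal (?k x) \<partial>lborel) = ennreal N" "N \<ge> 0"
      unfolding N_def by (auto intro!: nn_integral_eq_integral int_k)
    have "ennreal (ext_mass f u) = (\<integral>\<^sup>+x. ennreal (?h x * (u x)\<^sup>2) \<partial>lborel)"
      unfolding ext_mass_eq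
        by (intro nn_integral_eq_integral[symmetric] integrable_mass[OF u] AE_I2 mass_density_le)
    also have "\<dots> \<le> (\<integral>\<^sup>+x. epowr (ennreal (?k x)) ((n - 2) / n) * epowr
        (epowr (ennreal (?h x)) (n / 2)) (1 - (n - 2) / n) \<partial>lborel)"
    proof (intro nn_integral_mono)
      fix x
      have e: "1 - (n - 2) / n = 2 / n" using n by (simp add: field_simps)
      have "epowr (epowr (ennreal (?h x)) (n / 2)) (1 - (n - 2) / n) = ennreal (?h x)"
        using n h0[of x] by (simp add: e powr_powr)
      moreover have "epowr (ennreal (?k x)) ((n - 2) / n) * ennreal (?h x) = ennreal (?h x * (u x)\<^sup>2)"
      proof (cases "x \<in> ext_domain")
        case True
        then have "X1_tilde (norm x) = 1" by (simp add: ext_domain_iff X1_tilde_def)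
        moreover have "(\<bar>u x\<bar> powr q) powr ((n - 2) / n) = (u x)\<^sup>2"
          unfolding powr_powr q(2) by simp
        ultimately show ?thesis using h0[of x] by (simp add: mult.commute flip: ennreal_mult)
      qed simp
      ultimately show "ennreal (?h x * (u x)\<^sup>2) \<le> epowr (ennreal (?k x))
          ((n - 2) / n) * epowr (epowr (ennreal (?h x)) (n / 2)) (1 - (n - 2) / n)"
        by simp
    qed
    also have "\<dots> \<le> epowr (\<integral>\<^sup>+x. ennreal (?k x) \<partial>lborel) ((n - 2) / n) * epowr
        (\<integral>\<^sup>+x. epowr (ennreal (?h x)) (n / 2) \<partial>lborel) (1 - (n - 2) / n)"
      using n by (intro nn_integral_Holder2) auto
    also have "\<dots> = ennreal (N powr ((n - 2) / n) * c powr (2 / n))"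
      unfolding N I_def[symmetric] c using N c n by (simp add: ennreal_mult diff_divide_distrib)
    finally have "ext_mass f u \<le> N powr ((n - 2) / n) * c powr (2 / n)"
      by (subst (asm) ennreal_le_iff) auto
    also have "\<dots> \<le> (c powr (2 / n) + 1) * N powr ((n - 2) / n)" by (simp add: algebra_simps)
    finally show ?thesis unfolding N_def .
  qed
  moreover have "c powr (2 / n) + 1 > 0" by (simp add: add_nonneg_pos)
  ultimately show ?thesis unfolding n_def by blast
qed

text \<open>A bump function that is positive on a large ball sees a nonempty open set where f > 0.
  Continuity of f is available only for |x| \<ge> 1 and x0 may lie on the sphere, so the open set is
  sought in |x| > 1 by moving outward from x0.\<close>

lemma exists_positive_mass:
  assumes x0: "norm x0 \<ge> 1" "f x0 \<noteq> 0"
  obtains \<phi> where "\<phi> \<in> Cc_infinity" "ext_mass f \<phi> > 0"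
proof -
  define L where "L = (norm x0 + 1)\<^sup>2 + 1"
  \<comment> \<open>The squared norm is a polynomial, so the bump is smooth at the origin as
    well.\<close>
  define \<phi> :: "'a \<Rightarrow> real" where "\<phi> x = smooth_step (L + (-1) * (\<Sum>b\<in>Basis. (x \<bullet> b) * (x \<bullet> b)))" for x
  have \<phi>_eq: "\<phi> x = smooth_step (L - (norm x)\<^sup>2)" for x
    unfolding \<phi>_def power2_norm_eq_inner euclidean_inner[of x x] by simp
  have "Ck_on UNIV k \<phi>" for k
    unfolding \<phi>_def[abs_def]
    by (rule Ck_on_compose_real[OF open_UNIV subset_UNIV Ck_on_smooth_step])
      (intro Ck_on_add Ck_on_mult Ck_on_const Ck_on_sum Ck_on_inner open_UNIV finite_Basis)
  then have smooth: "\<forall>k. C_k k \<phi>" by (simp add: C_k_iff_Ck_on)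
  have zero: "\<phi> x = 0" if "norm x > sqrt L" for x
  proof -
    have "L \<ge> 0" by (simp add: L_def)
    then have "L = (sqrt L)\<^sup>2" by simp
    also have "\<dots> \<le> (norm x)\<^sup>2" using that \<open>L \<ge> 0\<close> by (intro power_mono) auto
    finally have "L \<le> (norm x)\<^sup>2" .
    then show ?thesis by (simp add: \<phi>_eq smooth_step_0)
  qed
  have "{x. \<phi> x \<noteq> 0} \<subseteq> cball 0 (sqrt L)" using zero by (force simp: not_le)
  then have "bounded {x. \<phi> x \<noteq> 0}" using bounded_subset bounded_cball by blast
  then have "compact (closure {x. \<phi> x \<noteq> 0})" by simp
  with smooth have Cc: "\<phi> \<in> Cc_infinity" by (simp add: Cc_infinity_def)
  have \<phi>_pos: "\<phi> x > 0" if "norm x < norm x0 + 1" for x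
  proof -
    have "(norm x)\<^sup>2 < (norm x0 + 1)\<^sup>2" using that by (intro power_strict_mono) auto
    then show ?thesis unfolding \<phi>_eq by (intro smooth_step_pos) (simp add: L_def)
  qed
  define V where "V = {x::'a. 1 < norm x}"
  have "open V" unfolding V_def by (intro open_Collect_less continuous_intros)
  have fV: "continuous_on V f" by (rule continuous_on_subset[OF f_continuous]) (auto simp: V_def)
  define W where "W = {x \<in> V. 0 < f x} \<inter> ball 0 (norm x0 + 1)"
  have "open {x \<in> V. 0 < f x}"
    using continuous_on_open_vimage[OF \<open>open V\<close>, of f] fV open_greaterThan[of "0::real"]
    by (auto simp: vimage_def Int_def conj_commute dest!: spec[of _ "{0<..}"])
  then have "open W" unfolding W_def by (intro open_Int) auto
  have "W \<noteq> {}"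
  proof -
    have f0: "f x0 > 0" using f_nonneg[OF x0(1)] x0(2) by simp
    \<comment> \<open>Only nonnegative s is considered, since the segment must stay in the set where
      f is continuous.\<close>
    have "((\<lambda>s. f ((1 + s) *\<^sub>R x0)) \<longlongrightarrow> f ((1 + 0) *\<^sub>R x0)) (at 0 within {0..})"
    proof -
      have "continuous_on {0..} (\<lambda>s::real. f ((1 + s) *\<^sub>R x0))"
      proof (rule continuous_on_compose2[OF f_continuous])
        show "(\<lambda>s. (1 + s) *\<^sub>R x0) ` {0..} \<subseteq> {x. 1 \<le> norm x}"
        proof (intro image_subsetI)
          fix s :: real assume "s \<in> {0..}"
          then show "(1 + s) *\<^sub>R x0 \<in> {x. 1 \<le> norm x}"
            using mult_mono[of 1 "1 + s" 1 "norm x0"] x0 by simp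
        qed
      qed (intro continuous_intros)
      then show ?thesis unfolding continuous_on_def by (elim ballE[of _ _ 0]) auto
    qed
    then have "\<forall>\<^sub>F s in at_right 0. f ((1 + s) *\<^sub>R x0) > 0"
      using f0 by (intro order_tendstoD(1)[of _ "f x0"]) (auto elim!: tendsto_within_subset)
    moreover have "\<forall>\<^sub>F s in at_right (0::real). s < 1 / norm x0"
      using x0 by (intro order_tendstoD(2)[OF tendsto_ident_at]) auto
    moreover have "\<forall>\<^sub>F s in at_right (0::real). s > 0"
      by (simp add: eventually_at_right_less)
    ultimately have "\<forall>\<^sub>F s in at_right 0. f ((1 + s) *\<^sub>R x0) > 0 \<and> s < 1 / norm x0 \<and> s > 0"
      by eventually_elim auto
    then obtain s where s: "f ((1 + s) *\<^sub>R x0) > 0" "s < 1 / norm x0" "s > 0"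
      using eventually_happens'[OF trivial_limit_at_right_real] by blast
    have "norm x0 > 0" using x0 by linarith
    then have "s * norm x0 < 1" "s * norm x0 > 0" using s by (simp_all add: less_divide_eq)
    then have "(1 + s) *\<^sub>R x0 \<in> W"
      using s x0 by (simp add: W_def V_def distrib_right)
    then show ?thesis by blast
  qed
  have "ext_mass f \<phi> \<noteq> 0"
  proof
    assume "ext_mass f \<phi> = 0"
    then have "AE x in lborel. indicator ext_domain x * f x * (\<phi> x)\<^sup>2 = 0"
      using integral_nonneg_eq_0_iff_AE[OF integrable_mass[OF Cc_infinity_C1c[OF Cc]]] mass_density_le(1)
      by (simp add: ext_mass_eq)
    moreover have "indicator ext_domain x * f x * (\<phi> x)\<^sup>2 \<noteq> 0" if "x \<in> W" for x
      using that \<phi>_pos[of x] by (auto simp: W_def V_def ext_domain_iff)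
    ultimately have "AE x in lborel. x \<notin> W" by (auto elim!: eventually_mono)
    then have "W \<in> null_sets lborel"
      using \<open>open W\<close> by (subst AE_iff_null_sets) auto
    then have "negligible W"
      by (simp add: negligible_iff_null_sets null_sets_completionI)
    then show False using open_not_negligible \<open>open W\<close> \<open>W \<noteq> {}\<close> by blast
  qed
  then show ?thesis using that[OF Cc] ext_mass_nonneg[of \<phi>] by simp
qed

end

section \<open>Construction of the radial competitor\<close>

lemma C1c_grad_unique:
  fixes u :: "'a::euclidean_space \<Rightarrow> real"
  assumes "C1c u G" "(u has_derivative (\<lambda>h. g \<bullet> h)) (at x)"
  shows "G x = g"
proof -
  have "(\<lambda>h. G x \<bullet> h) = (\<lambda>h. g \<bullet> h)"
    by (rule has_derivative_unique[OF C1c_has_derivative[OF assms(1)] assms(2)])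
  then have eq: "G x \<bullet> b = g \<bullet> b" for b by (rule fun_cong)
  show ?thesis by (rule euclidean_eqI) (rule eq)
qed

lemma radial_grad:
  fixes U :: "'a::euclidean_space \<Rightarrow> real" and q :: "real \<Rightarrow> real"
  assumes "C1c U G" "(q has_real_derivative d) (at (norm x))" "x \<noteq> 0" "open S" "x \<in> S"
    and "\<And>y. y \<in> S \<Longrightarrow> q (norm y) = U y"
  shows "G x = d *\<^sub>R sgn x"
proof (rule C1c_grad_unique[OF assms(1)])
  have "((\<lambda>x. q (norm x)) has_derivative (\<lambda>h. h \<bullet> sgn x * d)) (at x)"
    by (rule DERIV_compose_FDERIV[OF assms(2) has_derivative_norm[OF assms(3)]])
  then have "(U has_derivative (\<lambda>h. h \<bullet> sgn x * d)) (at x)"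
    by (rule has_derivative_transform_within_open[OF _ assms(4,5,6)])
  then show "(U has_derivative (\<lambda>h. d *\<^sub>R sgn x \<bullet> h)) (at x)"
    by (simp add: inner_commute mult.commute)
qed

text \<open>With z(r) = r^a p(r), where p is the profile of \<phi> on the ray, the cutoff v of z
  gives U = |x|^{-a} v(|x|), which agrees with p outside the ball. By the ground state substitution
  the \<open>pgrad\<close> of U is |x|^{-a} v' \<open>sgn x\<close>, so its energy over the ball is
  the quantity bounded in \<open>logarithmic_cutoff\<close>, times the area of the sphere.\<close>

lemma radial_test_function:
  fixes \<phi> :: "'a::euclidean_space \<Rightarrow> real"
  assumes dim: "DIM('a) \<ge> 3" and \<phi>: "\<phi> \<in> Cc_infinity" and w: "norm w = 1" and e: "e > 0"
  obtains U :: "'a \<Rightarrow> real" where "U \<in> Cc_infinity" "\<And>x. norm x \<ge> 1 \<Longrightarrow> U x = \<phi> (norm x *\<^sub>R w)"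
    "\<And>x. norm x > 1 \<Longrightarrow> grad U x = (grad \<phi> (norm x *\<^sub>R w) \<bullet> w) *\<^sub>R sgn x"
    "(LINT x:ball 0 1|lborel. (norm (pgrad U (grad U) x))\<^sup>2) \<le> e"
proof -
  let ?n = "real DIM('a)"
  define a where "a = (?n - 2) / 2"
  interpret S: finite_measure "sphere_measure :: 'a measure" by (rule finite_measure_sphere_measure)
  define A where "A = measure (sphere_measure :: 'a measure) (sphere 0 1)"
  \<comment> \<open>The error is divided by the area of the sphere, increased by 1 so that the
    division is safe.\<close>
  define e' where "e' = e / (A + 1)"
  have A: "A \<ge> 0" by (simp add: A_def)
  have e': "e' > 0" using e A by (simp add: e'_def)
  note C1 = Cc_infinity_C1c[OF \<phi>]
  obtain M where M: "M > 1" "\<And>x. norm x > M \<Longrightarrow> \<phi> x = 0" using C1c_support[OF C1] by metis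
  define p where "p r = \<phi> (r *\<^sub>R w)" for r :: real
  define z where "z r = r powr a * p r" for r
  have "Ck_on UNIV k \<phi>" for k using \<phi> by (simp add: Cc_infinity_def C_k_iff_Ck_on)
  then have "Ck_on UNIV k p" for k unfolding p_def[abs_def] by (rule Ck_on_line)
  then have pk: "Ck_on {0<..} k p" for k by (rule Ck_on_subset) simp
  have zk: "Ck_on {0<..} k z" for k
    unfolding z_def[abs_def] by (intro Ck_on_mult Ck_on_powr pk) simp
  obtain z' where z': "\<And>s. s \<in> {0<..} \<Longrightarrow> (z has_real_derivative z' s) (at s)" "Ck_on {0<..} 0 z'"
    by (rule Ck_on_real_D[OF zk[of "Suc 0"]], rule that)
  have z'_cont: "continuous_on {0<..} z'" using z'(2) by simp
  obtain v v' \<rho> where v: "\<And>k. Ck_on {0<..} k v" "\<And>r. r > 0 \<Longrightarrow> (v has_real_derivative v' r) (at r)"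
    "\<rho> > 0" "\<And>r. 0 < r \<Longrightarrow> r < \<rho> \<Longrightarrow> v r = 0" "\<And>r. r \<ge> 1 \<Longrightarrow> v r = z r"
    "(\<integral>\<^sup>+r. ennreal (indicator {0<..<1} r * (r * (v' r)\<^sup>2)) \<partial>lborel) \<le> ennreal e'"
  proof (rule logarithmic_cutoff[OF zk _ z'_cont e'])
    show "(z has_real_derivative z' s) (at s)" if "s > 0" for s using z'(1) that by simp
  qed (rule that)
  define U where "U x = norm x powr (- a) * v (norm x)" for x :: 'a
  have "Ck_on (- {0}) k U" for k
  proof -
    have "Ck_on (- {0::'a}) k (\<lambda>x. norm x powr (- a))"
      by (rule Ck_on_compose_real[OF _ _ Ck_on_powr Ck_on_norm]) auto
    moreover have "Ck_on (- {0::'a}) k (\<lambda>x. v (norm x))"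
      by (rule Ck_on_compose_real[OF _ _ v(1) Ck_on_norm]) auto
    ultimately show ?thesis unfolding U_def[abs_def] by (intro Ck_on_mult) auto
  qed
  \<comment> \<open>U vanishes near the origin, which removes the singularity of |x|^{-a}; the two
    open sets cover the space.\<close>
  moreover have "Ck_on (ball 0 \<rho>) k U" for k
  proof (rule Ck_on_cong[OF _ _ Ck_on_const[where c=0]])
    fix x :: 'a assume "x \<in> ball 0 \<rho>"
    then show "0 = U x" using v(4)[of "norm x"] by (cases "x = 0") (auto simp: U_def)
  qed auto
  ultimately have "Ck_on (- {0} \<union> ball 0 \<rho>) k U" for k
    by (intro Ck_on_union) auto
  moreover have "- {0} \<union> ball 0 \<rho> = (UNIV :: 'a set)" using v(3) by auto
  ultimately have smooth: "\<forall>k. C_k k U" by (simp add: C_k_iff_Ck_on)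
  have ext: "U x = \<phi> (norm x *\<^sub>R w)" if "norm x \<ge> 1" for x
  proof -
    have "norm x powr a \<noteq> 0" using that by auto
    then have "norm x powr (- a) * norm x powr a = 1" by (simp add: powr_minus)
    then show ?thesis using v(5)[OF that] by (simp add: U_def z_def p_def flip: mult.assoc)
  qed
  have "U x = 0" if "norm x > M" for x
    using ext[of x] M that w by simp
  then have "{x. U x \<noteq> 0} \<subseteq> cball 0 M" by (force simp: not_le)
  then have "bounded {x. U x \<noteq> 0}" using bounded_subset bounded_cball by blast
  then have "compact (closure {x. U x \<noteq> 0})" by simp
  with smooth have U: "U \<in> Cc_infinity" by (simp add: Cc_infinity_def)
  note C1U = Cc_infinity_C1c[OF U]
  have grad_ext: "grad U x = (grad \<phi> (norm x *\<^sub>R w) \<bullet> w) *\<^sub>R sgn x" if "norm x > 1" for x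
  proof (rule radial_grad[OF C1U, where q=p and S="{x. norm x > 1}"])
    have "((\<lambda>r. \<phi> (r *\<^sub>R w)) has_derivative (\<lambda>h. grad \<phi> (norm x *\<^sub>R w) \<bullet> (h *\<^sub>R w))) (at (norm x))"
      by (rule has_derivative_compose[of "\<lambda>r. r *\<^sub>R w" "\<lambda>h. h *\<^sub>R w"
          "norm x" UNIV \<phi>, OF _ C1c_has_derivative[OF C1]])
        (auto intro!: derivative_eq_intros)
    then show "(p has_real_derivative grad \<phi> (norm x *\<^sub>R w) \<bullet> w) (at (norm x))"
      by (simp add: has_field_derivative_def mult_commute_abs p_def[abs_def])
    show "open {x::'a. norm x > 1}" by (intro open_Collect_less continuous_intros)
    show "x \<noteq> 0" using that by auto
    show "p (norm y) = U y" if "y \<in> {x. norm x > 1}" for y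
      using ext[of y] that by (simp add: p_def)
  qed (use that in simp)
  have pgrad_eq: "(norm (pgrad U (grad U) x))\<^sup>2 = norm x powr (- 2 * a) * (v' (norm x))\<^sup>2" if "x \<noteq> 0" for x
  proof -
    define r where "r = norm x"
    have r: "r > 0" using that by (simp add: r_def)
    let ?d = "- a * r powr (- a - 1) * v r + v' r * r powr (- a)"
    have "((\<lambda>r. r powr (- a)) has_real_derivative - a * r powr (- a - 1)) (at r)"
      using r by (auto intro!: derivative_eq_intros)
    from DERIV_mult[OF this v(2)[OF r]]
    have "((\<lambda>r. r powr (- a) * v r) has_real_derivative ?d) (at (norm x))"
      unfolding r_def[symmetric] .
    then have "grad U x = ?d *\<^sub>R sgn x"
      by (rule radial_grad[OF C1U _ that, where S=UNIV]) (auto simp: U_def)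
    then have "pgrad U (grad U) x = (?d + a * (U x / r)) *\<^sub>R sgn x"
      by (simp add: pgrad_def a_def r_def scaleR_add_left)
    moreover have "?d + a * (U x / r) = v' r * r powr (- a)"
      using r by (simp add: U_def r_def[symmetric] powr_diff)
    ultimately have "(norm (pgrad U (grad U) x))\<^sup>2 = (v' r * r powr (- a))\<^sup>2"
      using that by (simp add: norm_sgn)
    also have "\<dots> = (r powr (- a))\<^sup>2 * (v' r)\<^sup>2" by (simp add: power_mult_distrib)
    also have "(r powr (- a))\<^sup>2 = r powr (- 2 * a)"
      by (simp add: power2_eq_square flip: powr_add)
    finally show ?thesis by (simp add: r_def)
  qed
  note [measurable] = measurable_pgrad(1)[OF C1U]
  let ?P = "\<lambda>x. indicator (ball 0 1) x * (norm (pgrad U (grad U) x))\<^sup>2"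
  have P_meas: "(\<lambda>x. ennreal (?P x)) \<in> borel_measurable borel"
    by (intro measurable_compose[OF _ measurable_ennreal] borel_measurable_times
        borel_measurable_indicator) (simp, measurable)
  have "(\<integral>\<^sup>+x. ennreal (?P x) \<partial>lborel) =
    (\<integral>\<^sup>+y. \<integral>\<^sup>+r. ennreal (indicator {0<..} r * r ^ (DIM('a) - 1)) * ennreal
        (?P (r *\<^sub>R y)) \<partial>lborel \<partial>sphere_measure)"
    by (rule nn_integral_polar[OF P_meas])
  also have "\<dots> \<le> (\<integral>\<^sup>+y. ennreal e' \<partial>(sphere_measure :: 'a measure))"
  proof (intro nn_integral_mono)
    fix y :: 'a assume "y \<in> space sphere_measure"
    then have y: "norm y = 1" by simp
    have "(\<integral>\<^sup>+r. ennreal (indicator {0<..} r * r ^ (DIM('a) - 1)) * ennreal (?P (r *\<^sub>R y)) \<partial>lborel) =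
      (\<integral>\<^sup>+r. ennreal (indicator {0<..<1} r * (r * (v' r)\<^sup>2)) \<partial>lborel)"
    proof (intro nn_integral_cong)
      fix r :: real
      show "ennreal (indicator {0<..} r * r ^ (DIM('a) - 1)) * ennreal (?P (r *\<^sub>R y)) =
          ennreal (indicator {0<..<1} r * (r * (v' r)\<^sup>2))"
      proof (cases "0 < r \<and> r < 1")
        case True
        have n: "norm (r *\<^sub>R y) = r" using True y by simp
        have nz: "r *\<^sub>R y \<noteq> 0" using True y by auto
        have "r ^ (DIM('a) - 1) = r powr (?n - 1)"
          using True dim by (subst powr_realpow[symmetric]) (auto simp: of_nat_diff)
        then have "r ^ (DIM('a) - 1) * r powr (- 2 * a) = r powr (?n - 1 + - 2 * a)"
          by (simp only: powr_add)
        \<comment> \<open>The Jacobian exponent N - 1 and the exponent -2a from the ground state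
          leave r^1, the weight of the two-dimensional energy.\<close>
        also have "?n - 1 + - 2 * a = 1" by (simp add: a_def field_simps)
        finally have "r ^ (DIM('a) - 1) * r powr (- 2 * a) = r" using True by simp
        then have "r ^ (DIM('a) - 1) * (r powr (- 2 * a) * (v' r)\<^sup>2) = r * (v' r)\<^sup>2"
          by (simp only: mult.assoc[symmetric])
        moreover have "indicator (ball 0 1) (r *\<^sub>R y) = (1::real)" using True n by simp
        ultimately show ?thesis
          using True unfolding pgrad_eq[OF nz] n by (simp flip: ennreal_mult)
      next
        case False
        then show ?thesis using y by (cases "r > 0") auto
      qed
    qed
    also have "\<dots> \<le> ennreal e'" by (rule v(6))
    finally show "(\<integral>\<^sup>+r. ennreal (indicator {0<..} r * r ^ (DIM('a) - 1)) * ennreal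
        (?P (r *\<^sub>R y)) \<partial>lborel) \<le> ennreal e'" .
  qed
  also have "\<dots> = ennreal (e' * A)"
    using e' by (simp add: A_def S.emeasure_eq_measure ennreal_mult)
  also have "\<dots> \<le> ennreal e"
  proof (rule ennreal_leI)
    have "e' * A \<le> e' * (A + 1)" using e' by simp
    then show "e' * A \<le> e" using A by (simp add: e'_def)
  qed
  finally have "enn2real (\<integral>\<^sup>+x. ennreal (?P x) \<partial>lborel) \<le> e"
    using e by (intro enn2real_leI) auto
  moreover have "(LINT x:ball 0 1|lborel. (norm (pgrad U (grad U) x))\<^sup>2) = (LINT x|lborel. ?P x)"
    by (simp add: set_lebesgue_integral_def)
  moreover have "(LINT x|lborel. ?P x) = enn2real (\<integral>\<^sup>+x. ennreal (?P x) \<partial>lborel)"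
  proof (rule integral_eq_nn_integral)
    show "?P \<in> borel_measurable lborel"
      by (intro borel_measurable_times borel_measurable_indicator) (simp, measurable)
  qed simp
  ultimately have small: "(LINT x:ball 0 1|lborel. (norm (pgrad U (grad U) x))\<^sup>2) \<le> e" by simp
  show ?thesis by (rule that[OF U ext grad_ext small])
qed

context exterior_potential
begin

section \<open>Contradiction at the critical parameter\<close>

lemma ext_mass_cong:
  assumes "\<And>x. norm x \<ge> 1 \<Longrightarrow> u x = v x"
  shows "ext_mass f u = ext_mass f v"
  unfolding ext_mass_eq
  by (intro Bochner_Integration.integral_cong) (auto simp: ext_domain_iff assms split: split_indicator)

theorem hardy_sobolev_fails_at_epsilon0:
  assumes e0: "epsilon0 f = ereal e0" and c: "c > 0"
  shows "\<exists>u\<in>Cc_infinity. \<not> hardy_sobolev_ineq f e0 c u"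
proof (rule ccontr)
  assume "\<not> (\<exists>u\<in>Cc_infinity. \<not> hardy_sobolev_ineq f e0 c u)"
  then have ineq: "hardy_sobolev_ineq f e0 c u" if "u \<in> Cc_infinity" for u using that by blast
  let ?n = "real DIM('a)"
  let ?N = "\<lambda>u::'a \<Rightarrow> real. (LINT x|lborel. \<bar>u x\<bar> powr (2 * ?n / (?n - 2)) * X1_tilde
      (norm x) powr ((2 * ?n - 2) / (?n - 2))) powr ((?n - 2) / ?n)"
  obtain C where C: "C > 0" and mass_le: "\<And>(u :: 'a \<Rightarrow> real) G. C1c u G \<Longrightarrow> ext_mass f u \<le> C * ?N u"
    using ext_mass_le_weighted_norm by auto
  \<comment> \<open>The assumed inequality will give c \<mu>/C < 2 \<eta> \<mu>, and with this
    \<eta> the right-hand side is half of the left.\<close>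
  define \<eta> where "\<eta> = c / (4 * C)"
  have \<eta>: "\<eta> > 0" using c C by (simp add: \<eta>_def)
  have "epsilon0 f < ereal (e0 + \<eta>)" using e0 \<eta> by simp
  then obtain \<phi> where \<phi>: "\<phi> \<in> Cc_infinity" "ext_energy (grad \<phi>) \<phi> < (e0 + \<eta>) * ext_mass f \<phi>"
    by (rule epsilon0_less_D)
  obtain w where w: "norm w = 1" and red: "\<forall>(U :: 'a \<Rightarrow> real) H. C1c U H \<longrightarrow>
    (\<forall>x. norm x \<ge> 1 \<longrightarrow> U x = \<phi> (norm x *\<^sub>R w)) \<longrightarrow>
    (\<forall>x. norm x > 1 \<longrightarrow> H x = (grad \<phi> (norm x *\<^sub>R w) \<bullet> w) *\<^sub>R sgn x) \<longrightarrow> ext_energy H U < (e0 + \<eta>) * ext_mass f U"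
    using radial_reduction[OF Cc_infinity_C1c[OF \<phi>(1)] \<phi>(2)] by (elim exE conjE)
  \<comment> \<open>All competitors have this same exterior mass, whatever the cutoff. So \<mu> is
    known in advance, and the cutoff error e can later be set to \<eta> \<mu>.\<close>
  define \<mu> where "\<mu> = ext_mass f (\<lambda>x::'a. \<phi> (norm x *\<^sub>R w))"
  have bound: "c * (\<mu> / C) < e + \<eta> * \<mu> \<and> \<mu> > 0" if e: "e > 0" for e
  proof -
    obtain U :: "'a \<Rightarrow> real" where U: "U \<in> Cc_infinity" "\<And>x. norm x \<ge> 1 \<Longrightarrow> U x = \<phi> (norm x *\<^sub>R w)"
      "\<And>x. norm x > 1 \<Longrightarrow> grad U x = (grad \<phi> (norm x *\<^sub>R w) \<bullet> w) *\<^sub>R sgn x"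
      "(LINT x:ball 0 1|lborel. (norm (pgrad U (grad U) x))\<^sup>2) \<le> e"
      by (rule radial_test_function[OF dim \<phi>(1) w e], rule that)
    note C1U = Cc_infinity_C1c[OF U(1)]
    have mass: "ext_mass f U = \<mu>" unfolding \<mu>_def by (rule ext_mass_cong) (rule U(2))
    have energy: "ext_energy (grad U) U < (e0 + \<eta>) * \<mu>"
      using red[rule_format, OF C1U U(2,3)] unfolding mass by simp
    have "\<mu> \<ge> 0" using ext_mass_nonneg[of U] mass by simp
    \<comment> \<open>If \<mu> were 0, the energy would be strictly negative, against
      \<open>ext_energy_nonneg\<close>.\<close>
    moreover have "\<mu> \<noteq> 0" using energy ext_energy_nonneg[OF C1U] by auto
    ultimately have \<mu>: "\<mu> > 0" by simp
    have "c * (\<mu> / C) \<le> c * ?N U"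
      using mass_le[OF C1U] c C unfolding mass
        by (intro mult_left_mono) (auto simp: divide_le_eq mult.commute)
    also have "\<dots> \<le> (LINT x:ball 0 1|lborel. (norm (pgrad U (grad U) x))\<^sup>2) + ext_energy (grad U) U - e0 * \<mu>"
      using ineq[OF U(1)] unfolding hardy_sobolev_ineq_def hardy_sobolev_lhs[OF C1U] mass .
    also have "\<dots> < e + \<eta> * \<mu>" using U(4) energy by (simp add: distrib_right)
    finally show ?thesis using \<mu> by blast
  qed
  have \<mu>: "\<mu> > 0" using bound[of 1] by simp
  have "c * (\<mu> / C) < 2 * \<eta> * \<mu>"
    using bound[of "\<eta> * \<mu>"] \<mu> \<eta> by simp
  also have "\<dots> = c * (\<mu> / C) / 2" by (simp add: \<eta>_def)
  finally show False using c C \<mu> by (simp add: field_simps)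
qed

theorem epsilon0_finite:
  assumes "norm x0 \<ge> 1" "f x0 \<noteq> 0"
  obtains e0 where "epsilon0 f = ereal e0"
proof -
  obtain \<phi> where "\<phi> \<in> Cc_infinity" "ext_mass f \<phi> > 0"
    by (rule exists_positive_mass[OF assms])
  then have "epsilon0 f < \<infinity>" using epsilon0_le[of \<phi>] by (auto intro: le_less_trans)
  then show ?thesis using epsilon0_pos that by (cases "epsilon0 f") auto
qed

end

theorem theorem3p4:
  fixes f :: "'a::euclidean_space \<Rightarrow> real" and K \<sigma> :: real
  assumes "DIM('a) \<ge> 3"
    and "continuous_on {x. norm x \<ge> 1} f"
    and "\<And>x. norm x \<ge> 1 \<Longrightarrow> f x \<ge> 0"
    and "\<And>x y. norm x \<ge> 1 \<Longrightarrow> norm x = norm y \<Longrightarrow> f x = f y"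
    and "\<sigma> > 0" and "K > 0"
    and "\<And>x. norm x \<ge> 1 \<Longrightarrow> f x \<le> K * norm x powr (- 2 - \<sigma>)"
  shows "epsilon0 f > 0 \<and>
    (\<forall>\<epsilon>>0. ereal \<epsilon> < epsilon0 f \<longrightarrow>
       (\<exists>c>0. \<forall>u\<in>Cc_infinity. hardy_sobolev_ineq f \<epsilon> c u)) \<and>
    ((\<exists>x. norm x \<ge> 1 \<and> f x \<noteq> 0) \<longrightarrow>
       (\<exists>\<epsilon>. epsilon0 f = ereal \<epsilon> \<and>
          \<not> (\<exists>c>0. \<forall>u\<in>Cc_infinity. hardy_sobolev_ineq f \<epsilon> c u)))"
proof -
  interpret exterior_potential f K \<sigma>
    by (rule exterior_potential.intro) (fact assms)+
  have "\<exists>\<epsilon>. epsilon0 f = ereal \<epsilon> \<and> \<not> (\<exists>c>0. \<forall>u\<in>Cc_infinity. hardy_sobolev_ineq f \<epsilon> c u)"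
    if x0: "norm x0 \<ge> 1" "f x0 \<noteq> 0" for x0
  proof -
    obtain e0 where e0: "epsilon0 f = ereal e0"
      by (rule epsilon0_finite[OF x0])
    then show ?thesis using hardy_sobolev_fails_at_epsilon0[OF e0] by blast
  qed
  then show ?thesis
    using epsilon0_pos hardy_sobolev_below_epsilon0 by blast
qed

end
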